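(* Let $k$ be a finite field with $q$ elements and let $(\mathscr C,\mathbb E,\mathfrak s)$ be an extriangulated category, where $\mathscr C$ is an essentially small Krull–Schmidt additive $k$-linear category and $\mathbb E$ is $k$-bilinear. Assume: (a) $\mathscr C$ has enough projective objects and enough injective objects; (b) for all $X,Y\in\mathscr C$ and $d\in\{\mathrm I,\mathrm{II}\}$, $\dim_k\mathbb E_d^{i}(X,Y)<\infty$ for every $i\in\mathbb Z$ and $\sum_{i\in\mathbb Z}\dim_k\mathbb E_d^i(X,Y)<\infty$; (c) $\mathrm{Hom}(I,x)$ is a monomorphism for every injective object $I$ and every inflation $x$; (d) $\mathrm{Hom}(y,P)$ is a monomorphism for every projective object $P$ and every deflation $y$. Then the Hall algebra $\mathcal H(\mathscr C)$ coincides with the twisted Hall algebra $\overline{\mathcal H}_{\mathrm{tw}}(\mathscr C)$; that is, for all $X,Y\in\mathscr C$, $$\sum_{[L]}F_{XY}^L\,u_{[L]}=q^{-\langle X,Y\rangle}\sum_{[L]}G_{XY}^L\,u_{[L]}.$$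
   Context: An extriangulated category (Nakaoka–Palu) is a triple $(\mathscr C,\mathbb E,\mathfrak s)$ as follows. (ET1) $\mathscr C$ is additive and $\mathbb E:\mathscr C^{op}\times\mathscr C\to Ab$ is a biadditive functor; elements $\delta\in\mathbb E(C,A)$ are called extensions; for $a:A\to A'$, $c:C'\to C$ put $a_*\delta=\mathbb E(C,a)(\delta)$, $c^*\delta=\mathbb E(c,A)(\delta)$; a morphism from $\delta\in\mathbb E(C,A)$ to $\delta'\in\mathbb E(C',A')$ is a pair $(a:A\to A',c:C\to C')$ with $a_*\delta=c^*\delta'$. (ET2) $\mathfrak s$ assigns to each $\delta\in\mathbb E(C,A)$ an equivalence class $[A\to B\to C]$ of sequences (two sequences $A\to B\to C$ and $A\to B'\to C$ are equivalent if there is an isomorphism $B\cong B'$ compatible with the identities of $A$ and $C$), such that every morphism $(a,c):\delta\to\delta'$ is realized by some $(a,b,c)$ making both squares between representing sequences commute, $\mathfrak s(0)$ is the class of the split sequence $A\to A\oplus C\to C$, and $\mathfrak s(\delta\oplus\delta')=\mathfrak s(\delta)\oplus\mathfrak s(\delta')$. (ET3) If $\mathfrak s(\delta)=[A\xrightarrow{x}B\xrightarrow{y}C]$, $\mathfrak s(\delta')=[A'\xrightarrow{x'}B'\xrightarrow{y'}C']$ and $bx=x'a$, there is $c$ with $cy=y'b$ and $a_*\delta=c^*\delta'$. (ET4) If $\delta\in\mathbb E(D,A)$, $\delta'\in\mathbb E(F,B)$ are realized by $A\xrightarrow{f}B\xrightarrow{f'}D$ and $B\xrightarrow{g}C\xrightarrow{g'}F$,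 there are an object $E$, an extension $\delta''\in\mathbb E(E,A)$ realized by $A\xrightarrow{h}C\xrightarrow{h'}E$ with $h=gf$, and a sequence $D\xrightarrow{d}E\xrightarrow{e}F$ realizing $f'_*\delta'$, with $h'g=df'$, $eh'=g'$, $d^*\delta''=\delta$, $f_*\delta''=e^*\delta'$. The duals of (ET3) and (ET4) also hold. If $\mathfrak s(\delta)=[A\xrightarrow{x}B\xrightarrow{y}C]$, then $A\xrightarrow{x}B\xrightarrow{y}C\overset{\delta}{\dashrightarrow}$ is called an $\mathbb E$-triangle, $x$ an inflation, $y$ a deflation, $C=\mathrm{cone}(x)$ and $A=\mathrm{cocone}(y)$ (well defined up to isomorphism). An object $P$ is projective if for every deflation $y:B\to C$ every morphism $P\to C$ factors through $y$; injective objects are defined dually. $\mathscr C$ has enough projective objects if every $M$ admits an $\mathbb E$-triangle $A\to P\to M\dashrightarrow$ with $P$ projective; dually for enough injective objects. Positive extensions: $\mathbb E^0=\mathrm{Hom}$, $\mathbb E^1=\mathbb E$, $\mathbb E^n(C,A)=\int^{M\in\mathscr C}\mathbb E^{n-1}(M,A)\otimes_k\mathbb E(C,M)$ for $n\ge2$ (Yoneda-type coend); put $\mathbb E^n_{\mathrm I}=\mathbb E^n_{\mathrm{II}}=\mathbb E^n$ for $n\ge0$. A morphism $f$ is projective if $\mathbb E(f,-)=f^*$ is zero, and injective if $\mathbb E(-,f)=f_*$ is zero. (If there are enough projective objects, every $C$ admits a deflation $G\to C$ that is a projective morphism; dually for injectives.) Negative extensions (Gorsky–Nakaoka–Palu),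 up to natural isomorphism: for $n\ge1$ and an $\mathbb E$-triangle $K\to G\xrightarrow{g}C\dashrightarrow$ with $g$ a projective morphism, $\mathbb E_{\mathrm I}^{-n}(X,C)=\mathrm{Ker}\big(\mathbb E_{\mathrm I}^{-n+1}(X,K)\to\mathbb E_{\mathrm I}^{-n+1}(X,G)\big)$. Dually, for an $\mathbb E$-triangle $A\xrightarrow{j}J\to S\dashrightarrow$ with $j$ an injective morphism, $\mathbb E_{\mathrm{II}}^{-n}(A,X)=\mathrm{Ker}\big(\mathbb E_{\mathrm{II}}^{-n+1}(S,X)\to\mathbb E_{\mathrm{II}}^{-n+1}(J,X)\big)$. These do not depend on the choices, up to isomorphism. Under the assumptions of the claim, $\dim_k\mathbb E_{\mathrm I}^i(X,Y)=\dim_k\mathbb E_{\mathrm{II}}^i(X,Y)$ for all $i$ (Gorsky–Nakaoka–Palu); this number is denoted $e^i(X,Y)$. The Euler form is $\langle X,Y\rangle:=\sum_{i\in\mathbb Z}(-1)^ie^i(X,Y)$. Notation: $(X,L)_Y$ is the set of inflations $f:X\to L$ with $\mathrm{cone}(f)\cong Y$; ${}_X(L,Y)$ is the set of deflations $g:L\to Y$ with $\mathrm{cocone}(g)\cong X$. Put $\{X,Y\}':=\prod_{i>0}|\mathbb E^i(X,Y)|^{(-1)^i}$, $[X,Y]:=\dfrac1{\{X,Y\}'|\mathrm{Hom}(X,Y)|}$, and $\{X,Y\}:=\prod_{i>0}|\mathbb E_{d}^{-i}(X,Y)|^{(-1)^i}$ (the same for $d=\mathrm I,\mathrm{II}$).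 Let $[X]$ denote the isomorphism class of $X$. Hall algebras: $\mathcal H(\mathscr C)$ and $\overline{\mathcal H}(\mathscr C)$ are both the $\mathbb Q$-vector space with basis $\{u_{[X]}\}$ over isomorphism classes of objects. The multiplication of $\mathcal H(\mathscr C)$ is $u_{[X]}\ast u_{[Y]}=\sum_{[L]}F_{XY}^Lu_{[L]}$ with $F_{XY}^L=\frac{|{}_X(L,Y)|}{|\mathrm{Aut}\,Y|}\frac{[L,Y]}{[Y,Y]}=\frac{|(X,L)_Y|}{|\mathrm{Aut}\,X|}\frac{[X,L]}{[X,X]}$. The multiplication of $\overline{\mathcal H}(\mathscr C)$ is $u_{[X]}\diamond u_{[Y]}=\sum_{[L]}G_{XY}^Lu_{[L]}$ with $G_{XY}^L=\frac{|{}_X(L,Y)|}{|\mathrm{Aut}\,Y|}\frac{\{L,Y\}}{\{Y,Y\}}=\frac{|(X,L)_Y|}{|\mathrm{Aut}\,X|}\frac{\{X,L\}}{\{X,X\}}$. The twisted Hall algebra $\overline{\mathcal H}_{\mathrm{tw}}(\mathscr C)$ is the same vector space as $\overline{\mathcal H}(\mathscr C)$ with multiplication $u_{[X]}\ast u_{[Y]}=q^{-\langle X,Y\rangle}u_{[X]}\diamond u_{[Y]}$. *)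

theory Defs
  imports "HOL-Analysis.Analysis" "HOL-Library.Poly_Mapping"
begin

section \<open>Linear algebra: quotients and free vector spaces\<close>

definition fin_dim :: "('a::field \<Rightarrow> 'b::ab_group_add \<Rightarrow> 'b) \<Rightarrow> 'b set \<Rightarrow> bool" where
  "fin_dim sc V \<longleftrightarrow> (\<exists>B. finite B \<and> B \<subseteq> V \<and> V \<subseteq> module.span sc B)"

text \<open>For subspaces \<open>W \<subseteq> V\<close>, the quotient \<open>V / W\<close> is described without a new type: a set \<open>B\<close> as
  in \<open>quot_basis\<close> maps injectively onto a basis of \<open>V / W\<close>.\<close>

definition quot_basis ::
    "('a::field \<Rightarrow> 'b::ab_group_add \<Rightarrow> 'b) \<Rightarrow> 'b set \<Rightarrow> 'b set \<Rightarrow> 'b set \<Rightarrow> bool" where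
  "quot_basis sc V W B \<longleftrightarrow>
     B \<subseteq> V \<and> \<not> module.dependent sc B \<and> module.span sc B \<inter> W = {0} \<and>
     V \<subseteq> module.span sc (B \<union> W)"

definition quot_fin_dim ::
    "('a::field \<Rightarrow> 'b::ab_group_add \<Rightarrow> 'b) \<Rightarrow> 'b set \<Rightarrow> 'b set \<Rightarrow> bool" where
  "quot_fin_dim sc V W \<longleftrightarrow> (\<exists>B. finite B \<and> B \<subseteq> V \<and> V \<subseteq> module.span sc (B \<union> W))"

definition quot_dim ::
    "('a::field \<Rightarrow> 'b::ab_group_add \<Rightarrow> 'b) \<Rightarrow> 'b set \<Rightarrow> 'b set \<Rightarrow> nat" where
  "quot_dim sc V W = card (SOME B. quot_basis sc V W B)"

definition quot_space :: "'v::ab_group_add set \<Rightarrow> 'v set \<Rightarrow> 'v set set" where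
  "quot_space V W = V // {(x, y). x \<in> V \<and> y \<in> V \<and> x - y \<in> W}"

definition pm_scale :: "'a::field \<Rightarrow> ('w \<Rightarrow>\<^sub>0 'a) \<Rightarrow> ('w \<Rightarrow>\<^sub>0 'a)" where
  "pm_scale c p = Poly_Mapping.map ((*) c) p"

lemma lookup_pm_scale: "Poly_Mapping.lookup (pm_scale c p) w = c * Poly_Mapping.lookup p w"
  by (simp add: pm_scale_def map.rep_eq when_def)

interpretation pm: vector_space pm_scale
  by unfold_locales
    (auto intro!: poly_mapping_eqI simp: lookup_pm_scale lookup_add algebra_simps)


section \<open>Linear categories\<close>

text \<open>The objects are the elements of the type \<open>'o\<close> (so the category is small). All spaces
  \<open>Hom X Y\<close> are subspaces of one ambient vector space, for instance of the direct sum of all of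
  them, and composition is one operation on the ambient space that is only constrained on composable
  pairs. A morphism does not determine its source and target, so the notions below take these as
  arguments. \<open>g \<cdot> f\<close> is ``\<open>g\<close> after \<open>f\<close>''.\<close>

record ('k, 'o, 'm) lin_cat =
  Hom :: "'o \<Rightarrow> 'o \<Rightarrow> 'm set"
  ide :: "'o \<Rightarrow> 'm"
  comp :: "'m \<Rightarrow> 'm \<Rightarrow> 'm"  (infixl "\<cdot>\<index>" 70)
  hscale :: "'k \<Rightarrow> 'm \<Rightarrow> 'm"

locale linear_category = hom: vector_space "hscale C"
  for C :: "('k::field, 'o, 'm::ab_group_add, 'z) lin_cat_scheme" (structure) +
  assumes Hom_subspace: "hom.subspace (Hom C X Y)"
    and ide_in: "ide C X \<in> Hom C X X"
    and comp_in: "f \<in> Hom C X Y \<Longrightarrow> g \<in> Hom C Y Z \<Longrightarrow> g \<cdot> f \<in> Hom C X Z"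
    and comp_ide: "f \<in> Hom C X Y \<Longrightarrow> f \<cdot> ide C X = f"
    and ide_comp: "f \<in> Hom C X Y \<Longrightarrow> ide C Y \<cdot> f = f"
    and comp_assoc: "f \<in> Hom C X Y \<Longrightarrow> g \<in> Hom C Y Z \<Longrightarrow> h \<in> Hom C Z W
       \<Longrightarrow> (h \<cdot> g) \<cdot> f = h \<cdot> (g \<cdot> f)"
    and comp_add_left: "f \<in> Hom C X Y \<Longrightarrow> g \<in> Hom C Y Z \<Longrightarrow> g' \<in> Hom C Y Z
       \<Longrightarrow> (g + g') \<cdot> f = g \<cdot> f + g' \<cdot> f"
    and comp_add_right: "f \<in> Hom C X Y \<Longrightarrow> f' \<in> Hom C X Y \<Longrightarrow> g \<in> Hom C Y Z
       \<Longrightarrow> g \<cdot> (f + f') = g \<cdot> f + g \<cdot> f'"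
    and comp_scale_left: "f \<in> Hom C X Y \<Longrightarrow> g \<in> Hom C Y Z
       \<Longrightarrow> hscale C c g \<cdot> f = hscale C c (g \<cdot> f)"
    and comp_scale_right: "f \<in> Hom C X Y \<Longrightarrow> g \<in> Hom C Y Z
       \<Longrightarrow> g \<cdot> hscale C c f = hscale C c (g \<cdot> f)"

definition is_iso :: "('k, 'o, 'm, 'z) lin_cat_scheme \<Rightarrow> 'o \<Rightarrow> 'o \<Rightarrow> 'm \<Rightarrow> bool" where
  "is_iso C X Y f \<longleftrightarrow> f \<in> Hom C X Y \<and>
     (\<exists>g\<in>Hom C Y X. g \<cdot>\<^bsub>C\<^esub> f = ide C X \<and> f \<cdot>\<^bsub>C\<^esub> g = ide C Y)"

definition isomorphic :: "('k, 'o, 'm, 'z) lin_cat_scheme \<Rightarrow> 'o \<Rightarrow> 'o \<Rightarrow> bool" where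
  "isomorphic C X Y \<longleftrightarrow> (\<exists>f. is_iso C X Y f)"

definition Aut :: "('k, 'o, 'm, 'z) lin_cat_scheme \<Rightarrow> 'o \<Rightarrow> 'm set" where
  "Aut C X = {f. is_iso C X X f}"

definition is_biproduct ::
    "('k, 'o, 'm::ab_group_add, 'z) lin_cat_scheme
       \<Rightarrow> 'o \<Rightarrow> 'o \<Rightarrow> 'o \<Rightarrow> 'm \<Rightarrow> 'm \<Rightarrow> 'm \<Rightarrow> 'm \<Rightarrow> bool" where
  "is_biproduct C X Y S i1 i2 p1 p2 \<longleftrightarrow>
     i1 \<in> Hom C X S \<and> i2 \<in> Hom C Y S \<and> p1 \<in> Hom C S X \<and> p2 \<in> Hom C S Y \<and>
     p1 \<cdot>\<^bsub>C\<^esub> i1 = ide C X \<and> p2 \<cdot>\<^bsub>C\<^esub> i2 = ide C Y \<and>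
     p1 \<cdot>\<^bsub>C\<^esub> i2 = 0 \<and> p2 \<cdot>\<^bsub>C\<^esub> i1 = 0 \<and>
     i1 \<cdot>\<^bsub>C\<^esub> p1 + i2 \<cdot>\<^bsub>C\<^esub> p2 = ide C S"

locale additive_linear_category = linear_category +
  assumes zero_object: "\<exists>Z. ide C Z = 0"
    and biproducts: "\<exists>S i1 i2 p1 p2. is_biproduct C X Y S i1 i2 p1 p2"

definition is_direct_sum ::
    "('k, 'o, 'm::ab_group_add, 'z) lin_cat_scheme
       \<Rightarrow> nat \<Rightarrow> (nat \<Rightarrow> 'o) \<Rightarrow> 'o \<Rightarrow> (nat \<Rightarrow> 'm) \<Rightarrow> (nat \<Rightarrow> 'm) \<Rightarrow> bool" where
  "is_direct_sum C n Xs S i p \<longleftrightarrow>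
     (\<forall>j<n. i j \<in> Hom C (Xs j) S \<and> p j \<in> Hom C S (Xs j)) \<and>
     (\<forall>j<n. \<forall>l<n. p j \<cdot>\<^bsub>C\<^esub> i l = (if j = l then ide C (Xs j) else 0)) \<and>
     (\<Sum>j<n. i j \<cdot>\<^bsub>C\<^esub> p j) = ide C S"

text \<open>A ring is local if it is nonzero and its non-units are closed under addition; the units of
  the endomorphism ring are the automorphisms.\<close>

definition local_endo :: "('k, 'o, 'm::ab_group_add, 'z) lin_cat_scheme \<Rightarrow> 'o \<Rightarrow> bool" where
  "local_endo C X \<longleftrightarrow> ide C X \<noteq> 0 \<and>
     (\<forall>f\<in>Hom C X X. \<forall>g\<in>Hom C X X.
        \<not> is_iso C X X f \<longrightarrow> \<not> is_iso C X X g \<longrightarrow> \<not> is_iso C X X (f + g))"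

locale krull_schmidt_category = additive_linear_category +
  assumes krull_schmidt:
    "\<exists>n Xs i p. is_direct_sum C n Xs X i p \<and> (\<forall>j<n. local_endo C (Xs j))"


section \<open>Extriangulated categories\<close>

text \<open>\<open>Ext C A\<close> is \<open>\<bbbE>(C, A)\<close>, \<open>push a \<delta>\<close> is \<open>a\<^sub>* \<delta>\<close>, and \<open>pull c \<delta>\<close> is \<open>c\<^sup>* \<delta>\<close>. \<open>realization C A \<delta>\<close> is an
  equivalence class of sequences \<open>A \<rightarrow> B \<rightarrow> C\<close>, a set of triples \<open>(B, x, y)\<close>.\<close>

record ('k, 'o, 'm, 'e) extri_cat = "('k, 'o, 'm) lin_cat" +
  Ext :: "'o \<Rightarrow> 'o \<Rightarrow> 'e set"
  push :: "'m \<Rightarrow> 'e \<Rightarrow> 'e"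
  pull :: "'m \<Rightarrow> 'e \<Rightarrow> 'e"
  escale :: "'k \<Rightarrow> 'e \<Rightarrow> 'e"
  realization :: "'o \<Rightarrow> 'o \<Rightarrow> 'e \<Rightarrow> ('o \<times> 'm \<times> 'm) set"

definition seq_class ::
    "('k, 'o, 'm, 'z) lin_cat_scheme \<Rightarrow> 'o \<Rightarrow> 'o \<Rightarrow> 'o \<times> 'm \<times> 'm \<Rightarrow> ('o \<times> 'm \<times> 'm) set" where
  "seq_class C A D = (\<lambda>(B, x, y). {(B', x', y').
     x' \<in> Hom C A B' \<and> y' \<in> Hom C B' D \<and>
     (\<exists>b. is_iso C B B' b \<and> b \<cdot>\<^bsub>C\<^esub> x = x' \<and> y' \<cdot>\<^bsub>C\<^esub> b = y)})"

text \<open>\<open>triangle C A B D x y \<delta>\<close>: \<open>A \<rightarrow>\<^sub>x B \<rightarrow>\<^sub>y D\<close> with \<open>\<delta> \<in> \<bbbE>(D, A)\<close> is an \<open>\<bbbE>\<close>-triangle.\<close>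

definition triangle ::
    "('k, 'o, 'm, 'e, 'z) extri_cat_scheme \<Rightarrow> 'o \<Rightarrow> 'o \<Rightarrow> 'o \<Rightarrow> 'm \<Rightarrow> 'm \<Rightarrow> 'e \<Rightarrow> bool" where
  "triangle C A B D x y \<delta> \<longleftrightarrow> \<delta> \<in> Ext C D A \<and> (B, x, y) \<in> realization C D A \<delta>"

locale extriangulated_category =
  additive_linear_category C + ext: vector_space "escale C"
  for C :: "('k::field, 'o, 'm::ab_group_add, 'e::ab_group_add, 'z) extri_cat_scheme" (structure) +
  assumes
    \<comment> \<open>(ET1): \<open>\<bbbE>\<close> is a \<open>k\<close>-bilinear bifunctor\<close>
    Ext_subspace: "ext.subspace (Ext C D A)"
    and push_in: "a \<in> Hom C A A' \<Longrightarrow> \<delta> \<in> Ext C D A \<Longrightarrow> push C a \<delta> \<in> Ext C D A'"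
    and pull_in: "c \<in> Hom C D' D \<Longrightarrow> \<delta> \<in> Ext C D A \<Longrightarrow> pull C c \<delta> \<in> Ext C D' A"
    and push_ide: "\<delta> \<in> Ext C D A \<Longrightarrow> push C (ide C A) \<delta> = \<delta>"
    and pull_ide: "\<delta> \<in> Ext C D A \<Longrightarrow> pull C (ide C D) \<delta> = \<delta>"
    and push_comp: "a \<in> Hom C A A' \<Longrightarrow> a' \<in> Hom C A' A'' \<Longrightarrow> \<delta> \<in> Ext C D A
       \<Longrightarrow> push C (a' \<cdot> a) \<delta> = push C a' (push C a \<delta>)"
    and pull_comp: "c \<in> Hom C D' D \<Longrightarrow> c' \<in> Hom C D'' D' \<Longrightarrow> \<delta> \<in> Ext C D A
       \<Longrightarrow> pull C (c \<cdot> c') \<delta> = pull C c' (pull C c \<delta>)"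
    and push_pull: "a \<in> Hom C A A' \<Longrightarrow> c \<in> Hom C D' D \<Longrightarrow> \<delta> \<in> Ext C D A
       \<Longrightarrow> push C a (pull C c \<delta>) = pull C c (push C a \<delta>)"
    and push_add: "a \<in> Hom C A A' \<Longrightarrow> \<delta> \<in> Ext C D A \<Longrightarrow> \<delta>' \<in> Ext C D A
       \<Longrightarrow> push C a (\<delta> + \<delta>') = push C a \<delta> + push C a \<delta>'"
    and pull_add: "c \<in> Hom C D' D \<Longrightarrow> \<delta> \<in> Ext C D A \<Longrightarrow> \<delta>' \<in> Ext C D A
       \<Longrightarrow> pull C c (\<delta> + \<delta>') = pull C c \<delta> + pull C c \<delta>'"
    and push_scale: "a \<in> Hom C A A' \<Longrightarrow> \<delta> \<in> Ext C D A
       \<Longrightarrow> push C a (escale C t \<delta>) = escale C t (push C a \<delta>)"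
    and pull_scale: "c \<in> Hom C D' D \<Longrightarrow> \<delta> \<in> Ext C D A
       \<Longrightarrow> pull C c (escale C t \<delta>) = escale C t (pull C c \<delta>)"
    and add_push: "a \<in> Hom C A A' \<Longrightarrow> a' \<in> Hom C A A' \<Longrightarrow> \<delta> \<in> Ext C D A
       \<Longrightarrow> push C (a + a') \<delta> = push C a \<delta> + push C a' \<delta>"
    and add_pull: "c \<in> Hom C D' D \<Longrightarrow> c' \<in> Hom C D' D \<Longrightarrow> \<delta> \<in> Ext C D A
       \<Longrightarrow> pull C (c + c') \<delta> = pull C c \<delta> + pull C c' \<delta>"
    and scale_push: "a \<in> Hom C A A' \<Longrightarrow> \<delta> \<in> Ext C D A
       \<Longrightarrow> push C (hscale C t a) \<delta> = escale C t (push C a \<delta>)"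
    and scale_pull: "c \<in> Hom C D' D \<Longrightarrow> \<delta> \<in> Ext C D A
       \<Longrightarrow> pull C (hscale C t c) \<delta> = escale C t (pull C c \<delta>)"
    \<comment> \<open>(ET2): \<open>\<ss>\<close> is an additive realization\<close>
    and realization_class: "\<delta> \<in> Ext C D A \<Longrightarrow>
       \<exists>B x y. x \<in> Hom C A B \<and> y \<in> Hom C B D \<and> realization C D A \<delta> = seq_class C A D (B, x, y)"
    and realize_morphism:
      "triangle C A B D x y \<delta> \<Longrightarrow> triangle C A' B' D' x' y' \<delta>' \<Longrightarrow>
       a \<in> Hom C A A' \<Longrightarrow> c \<in> Hom C D D' \<Longrightarrow> push C a \<delta> = pull C c \<delta>' \<Longrightarrow>
       \<exists>b\<in>Hom C B B'. b \<cdot> x = x' \<cdot> a \<and> y' \<cdot> b = c \<cdot> y"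
    and realization_zero: "is_biproduct C A D S i1 i2 p1 p2 \<Longrightarrow>
       realization C D A 0 = seq_class C A D (S, i1, p2)"
    and realization_sum:
      "triangle C A B D x y \<delta> \<Longrightarrow> triangle C A' B' D' x' y' \<delta>' \<Longrightarrow>
       is_biproduct C A A' SA iA iA' pA pA' \<Longrightarrow>
       is_biproduct C B B' SB iB iB' pB pB' \<Longrightarrow>
       is_biproduct C D D' SD iD iD' pD pD' \<Longrightarrow>
       realization C SD SA (push C iA (pull C pD \<delta>) + push C iA' (pull C pD' \<delta>')) =
       seq_class C SA SD (SB, iB \<cdot> x \<cdot> pA + iB' \<cdot> x' \<cdot> pA', iD \<cdot> y \<cdot> pB + iD' \<cdot> y' \<cdot> pB')"
    and ET3:
      "triangle C A B D x y \<delta> \<Longrightarrow> triangle C A' B' D' x' y' \<delta>' \<Longrightarrow>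
       a \<in> Hom C A A' \<Longrightarrow> b \<in> Hom C B B' \<Longrightarrow> b \<cdot> x = x' \<cdot> a \<Longrightarrow>
       \<exists>c\<in>Hom C D D'. c \<cdot> y = y' \<cdot> b \<and> push C a \<delta> = pull C c \<delta>'"
    and ET3_op:
      "triangle C A B D x y \<delta> \<Longrightarrow> triangle C A' B' D' x' y' \<delta>' \<Longrightarrow>
       b \<in> Hom C B B' \<Longrightarrow> c \<in> Hom C D D' \<Longrightarrow> c \<cdot> y = y' \<cdot> b \<Longrightarrow>
       \<exists>a\<in>Hom C A A'. b \<cdot> x = x' \<cdot> a \<and> push C a \<delta> = pull C c \<delta>'"
    and ET4:
      "triangle C A B D f f' \<delta> \<Longrightarrow> triangle C B M F g g' \<delta>' \<Longrightarrow>
       \<exists>E d e h' \<delta>''.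
         triangle C A M E (g \<cdot> f) h' \<delta>'' \<and>
         triangle C D E F d e (push C f' \<delta>') \<and>
         h' \<cdot> g = d \<cdot> f' \<and> e \<cdot> h' = g' \<and>
         pull C d \<delta>'' = \<delta> \<and> push C f \<delta>'' = pull C e \<delta>'"
    and ET4_op:
      "triangle C D B A f' f \<delta> \<Longrightarrow> triangle C F M B g' g \<delta>' \<Longrightarrow>
       \<exists>E d e h' \<delta>''.
         triangle C E M A h' (f \<cdot> g) \<delta>'' \<and>
         triangle C F E D e d (pull C f' \<delta>') \<and>
         g \<cdot> h' = f' \<cdot> d \<and> h' \<cdot> e = g' \<and>
         push C d \<delta>'' = \<delta> \<and> pull C f \<delta>'' = push C e \<delta>'"

definition inflation :: "('k, 'o, 'm, 'e, 'z) extri_cat_scheme \<Rightarrow> 'o \<Rightarrow> 'o \<Rightarrow> 'm \<Rightarrow> bool" where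
  "inflation C A B x \<longleftrightarrow> (\<exists>D y \<delta>. triangle C A B D x y \<delta>)"

definition deflation :: "('k, 'o, 'm, 'e, 'z) extri_cat_scheme \<Rightarrow> 'o \<Rightarrow> 'o \<Rightarrow> 'm \<Rightarrow> bool" where
  "deflation C B D y \<longleftrightarrow> (\<exists>A x \<delta>. triangle C A B D x y \<delta>)"

definition projective_obj :: "('k, 'o, 'm, 'e, 'z) extri_cat_scheme \<Rightarrow> 'o \<Rightarrow> bool" where
  "projective_obj C P \<longleftrightarrow>
     (\<forall>B D y. deflation C B D y \<longrightarrow> (\<forall>f\<in>Hom C P D. \<exists>g\<in>Hom C P B. y \<cdot>\<^bsub>C\<^esub> g = f))"

definition injective_obj :: "('k, 'o, 'm, 'e, 'z) extri_cat_scheme \<Rightarrow> 'o \<Rightarrow> bool" where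
  "injective_obj C I \<longleftrightarrow>
     (\<forall>A B x. inflation C A B x \<longrightarrow> (\<forall>f\<in>Hom C A I. \<exists>g\<in>Hom C B I. g \<cdot>\<^bsub>C\<^esub> x = f))"

definition enough_projectives :: "('k, 'o, 'm, 'e, 'z) extri_cat_scheme \<Rightarrow> bool" where
  "enough_projectives C \<longleftrightarrow> (\<forall>M. \<exists>A P x y \<delta>. triangle C A P M x y \<delta> \<and> projective_obj C P)"

definition enough_injectives :: "('k, 'o, 'm, 'e, 'z) extri_cat_scheme \<Rightarrow> bool" where
  "enough_injectives C \<longleftrightarrow> (\<forall>M. \<exists>I D x y \<delta>. triangle C M I D x y \<delta> \<and> injective_obj C I)"

definition projective_mor ::
    "('k, 'o, 'm, 'e::zero, 'z) extri_cat_scheme \<Rightarrow> 'o \<Rightarrow> 'o \<Rightarrow> 'm \<Rightarrow> bool" where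
  "projective_mor C X Y f \<longleftrightarrow> f \<in> Hom C X Y \<and> (\<forall>A. \<forall>\<delta>\<in>Ext C Y A. pull C f \<delta> = 0)"

definition injective_mor ::
    "('k, 'o, 'm, 'e::zero, 'z) extri_cat_scheme \<Rightarrow> 'o \<Rightarrow> 'o \<Rightarrow> 'm \<Rightarrow> bool" where
  "injective_mor C X Y f \<longleftrightarrow> f \<in> Hom C X Y \<and> (\<forall>D. \<forall>\<delta>\<in>Ext C D X. push C f \<delta> = 0)"


section \<open>Positive extensions\<close>

text \<open>For \<open>n \<ge> 1\<close>, the iterated coend \<open>\<bbbE>\<^sup>n(X, A) = \<integral>\<^sup>M \<bbbE>\<^sup>n\<^sup>-\<^sup>1(M, A) \<otimes> \<bbbE>(X, M)\<close> is presented by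
  generators and relations. A generator is a chain \<open>[(M\<^sub>1, \<delta>\<^sub>1), \<dots>, (M\<^sub>n, \<delta>\<^sub>n)]\<close> with
  \<open>\<delta>\<^sub>1 \<in> \<bbbE>(X, M\<^sub>1)\<close>, \<open>\<delta>\<^sub>2 \<in> \<bbbE>(M\<^sub>1, M\<^sub>2)\<close>, \dots and \<open>M\<^sub>n = A\<close>; the chain \<open>(M, \<delta>) # w\<close> stands for the
  element \<open>w \<otimes> \<delta>\<close> of the summand of index \<open>M\<close>. The relations, spanning \<open>yon_rel\<close>, are: those of
  \<open>\<bbbE>\<^sup>n\<^sup>-\<^sup>1(M, A)\<close> tensored with \<open>\<delta>\<close>; linearity in \<open>\<delta>\<close>; and the coend relation
  \<open>w \<otimes> a\<^sub>* \<delta> = a\<^sup>* w \<otimes> \<delta>\<close>. At \<open>n = 1\<close> this gives back \<open>\<bbbE>(X, A)\<close>.\<close>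

fun is_chain :: "('k, 'o, 'm, 'e, 'z) extri_cat_scheme \<Rightarrow> 'o \<Rightarrow> 'o \<Rightarrow> ('o \<times> 'e) list \<Rightarrow> bool" where
  "is_chain C X A [] \<longleftrightarrow> X = A"
| "is_chain C X A ((M, \<delta>) # w) \<longleftrightarrow> \<delta> \<in> Ext C X M \<and> is_chain C M A w"

definition chain_gen :: "('o \<times> 'e) list \<Rightarrow> (('o \<times> 'e) list \<Rightarrow>\<^sub>0 'k::field)" where
  "chain_gen w = Poly_Mapping.single w 1"

definition tensor_ext ::
    "(('o \<times> 'e) list \<Rightarrow>\<^sub>0 'k::field) \<Rightarrow> 'o \<Rightarrow> 'e \<Rightarrow> (('o \<times> 'e) list \<Rightarrow>\<^sub>0 'k)" where
  "tensor_ext r M \<delta> =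
     (\<Sum>w\<in>Poly_Mapping.keys r. pm_scale (Poly_Mapping.lookup r w) (chain_gen ((M, \<delta>) # w)))"

definition yon_free ::
    "('k::field, 'o, 'm, 'e, 'z) extri_cat_scheme
       \<Rightarrow> nat \<Rightarrow> 'o \<Rightarrow> 'o \<Rightarrow> (('o \<times> 'e) list \<Rightarrow>\<^sub>0 'k) set" where
  "yon_free C n X A = pm.span {chain_gen w | w. is_chain C X A w \<and> length w = n}"

primrec yon_rel ::
    "('k::field, 'o, 'm, 'e::ab_group_add, 'z) extri_cat_scheme
       \<Rightarrow> nat \<Rightarrow> 'o \<Rightarrow> 'o \<Rightarrow> (('o \<times> 'e) list \<Rightarrow>\<^sub>0 'k) set" where
  "yon_rel C 0 X A = {0}"
| "yon_rel C (Suc n) X A = pm.span (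
     {tensor_ext r M \<delta> | r M \<delta>. \<delta> \<in> Ext C X M \<and> r \<in> yon_rel C n M A} \<union>
     {chain_gen ((M, \<delta> + \<delta>') # w) - chain_gen ((M, \<delta>) # w) - chain_gen ((M, \<delta>') # w) | M \<delta> \<delta>' w.
        \<delta> \<in> Ext C X M \<and> \<delta>' \<in> Ext C X M \<and> is_chain C M A w \<and> length w = n} \<union>
     {chain_gen ((M, escale C t \<delta>) # w) - pm_scale t (chain_gen ((M, \<delta>) # w)) | M t \<delta> w.
        \<delta> \<in> Ext C X M \<and> is_chain C M A w \<and> length w = n} \<union>
     {chain_gen ((M', push C a \<delta>) # (N, \<epsilon>) # w) - chain_gen ((M, \<delta>) # (N, pull C a \<epsilon>) # w)
        | M M' N a \<delta> \<epsilon> w.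
        a \<in> Hom C M M' \<and> \<delta> \<in> Ext C X M \<and> \<epsilon> \<in> Ext C M' N \<and> is_chain C N A w \<and> Suc (length w) = n})"


section \<open>Negative extensions\<close>

definition proj_res ::
    "('k, 'o, 'm, 'e::zero, 'z) extri_cat_scheme \<Rightarrow> 'o \<Rightarrow> 'o \<times> 'o \<times> 'm \<times> 'm \<times> 'e" where
  "proj_res C D = (SOME (K, G, i, g, \<delta>). triangle C K G D i g \<delta> \<and> projective_mor C G D g)"

definition syz :: "('k, 'o, 'm, 'e::zero, 'z) extri_cat_scheme \<Rightarrow> 'o \<Rightarrow> 'o" where
  "syz C D = (case proj_res C D of (K, G, i, g, \<delta>) \<Rightarrow> K)"
definition syz_mid :: "('k, 'o, 'm, 'e::zero, 'z) extri_cat_scheme \<Rightarrow> 'o \<Rightarrow> 'o" where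
  "syz_mid C D = (case proj_res C D of (K, G, i, g, \<delta>) \<Rightarrow> G)"
definition syz_infl :: "('k, 'o, 'm, 'e::zero, 'z) extri_cat_scheme \<Rightarrow> 'o \<Rightarrow> 'm" where
  "syz_infl C D = (case proj_res C D of (K, G, i, g, \<delta>) \<Rightarrow> i)"
definition syz_ext :: "('k, 'o, 'm, 'e::zero, 'z) extri_cat_scheme \<Rightarrow> 'o \<Rightarrow> 'e" where
  "syz_ext C D = (case proj_res C D of (K, G, i, g, \<delta>) \<Rightarrow> \<delta>)"

text \<open>For \<open>f : D \<rightarrow> D'\<close>, a morphism \<open>a\<close> of syzygies such that \<open>(a, f)\<close> is a morphism of extensions. It
  exists because \<open>f\<^sup>* \<delta>'\<close> is killed by the projective morphism onto \<open>D\<close>, and two choices differ by a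
  morphism factoring through the inflation, which vanishes on the kernels below.\<close>

definition syz_mor ::
    "('k, 'o, 'm, 'e::zero, 'z) extri_cat_scheme \<Rightarrow> 'o \<Rightarrow> 'o \<Rightarrow> 'm \<Rightarrow> 'm" where
  "syz_mor C D D' f =
     (SOME a. a \<in> Hom C (syz C D) (syz C D') \<and> push C a (syz_ext C D) = pull C f (syz_ext C D'))"

text \<open>\<open>neg_I C n X D\<close> is \<open>\<bbbE>\<^sub>I\<^sup>-\<^sup>n(X, D)\<close>, a subspace of \<open>Hom\<close> from \<open>X\<close> to the \<open>n\<close>-th syzygy of \<open>D\<close>;
  \<open>neg_I_map C n D D' f\<close> is \<open>\<bbbE>\<^sub>I\<^sup>-\<^sup>n(X, f)\<close> for \<open>f : D \<rightarrow> D'\<close> (it is the same formula for every \<open>X\<close>).\<close>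

primrec neg_I_map ::
    "('k, 'o, 'm, 'e::zero, 'z) extri_cat_scheme \<Rightarrow> nat \<Rightarrow> 'o \<Rightarrow> 'o \<Rightarrow> 'm \<Rightarrow> 'm \<Rightarrow> 'm" where
  "neg_I_map C 0 = (\<lambda>D D' f u. f \<cdot>\<^bsub>C\<^esub> u)"
| "neg_I_map C (Suc n) = (\<lambda>D D' f u. neg_I_map C n (syz C D) (syz C D') (syz_mor C D D' f) u)"

primrec neg_I ::
    "('k, 'o, 'm::zero, 'e::zero, 'z) extri_cat_scheme \<Rightarrow> nat \<Rightarrow> 'o \<Rightarrow> 'o \<Rightarrow> 'm set" where
  "neg_I C 0 = (\<lambda>X D. Hom C X D)"
| "neg_I C (Suc n) = (\<lambda>X D. {u \<in> neg_I C n X (syz C D).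
     neg_I_map C n (syz C D) (syz_mid C D) (syz_infl C D) u = 0})"

definition inj_res ::
    "('k, 'o, 'm, 'e::zero, 'z) extri_cat_scheme \<Rightarrow> 'o \<Rightarrow> 'o \<times> 'o \<times> 'm \<times> 'm \<times> 'e" where
  "inj_res C A = (SOME (J, S, j, s, \<delta>). triangle C A J S j s \<delta> \<and> injective_mor C A J j)"

definition cosyz :: "('k, 'o, 'm, 'e::zero, 'z) extri_cat_scheme \<Rightarrow> 'o \<Rightarrow> 'o" where
  "cosyz C A = (case inj_res C A of (J, S, j, s, \<delta>) \<Rightarrow> S)"
definition cosyz_mid :: "('k, 'o, 'm, 'e::zero, 'z) extri_cat_scheme \<Rightarrow> 'o \<Rightarrow> 'o" where
  "cosyz_mid C A = (case inj_res C A of (J, S, j, s, \<delta>) \<Rightarrow> J)"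
definition cosyz_defl :: "('k, 'o, 'm, 'e::zero, 'z) extri_cat_scheme \<Rightarrow> 'o \<Rightarrow> 'm" where
  "cosyz_defl C A = (case inj_res C A of (J, S, j, s, \<delta>) \<Rightarrow> s)"
definition cosyz_ext :: "('k, 'o, 'm, 'e::zero, 'z) extri_cat_scheme \<Rightarrow> 'o \<Rightarrow> 'e" where
  "cosyz_ext C A = (case inj_res C A of (J, S, j, s, \<delta>) \<Rightarrow> \<delta>)"

definition cosyz_mor ::
    "('k, 'o, 'm, 'e::zero, 'z) extri_cat_scheme \<Rightarrow> 'o \<Rightarrow> 'o \<Rightarrow> 'm \<Rightarrow> 'm" where
  "cosyz_mor C A A' f =
     (SOME c. c \<in> Hom C (cosyz C A) (cosyz C A') \<and>
        push C f (cosyz_ext C A) = pull C c (cosyz_ext C A'))"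

text \<open>\<open>neg_II C n A X\<close> is \<open>\<bbbE>\<^sub>I\<^sub>I\<^sup>-\<^sup>n(A, X)\<close>; \<open>neg_II_map C n A A' f\<close> maps \<open>\<bbbE>\<^sub>I\<^sub>I\<^sup>-\<^sup>n(A', X)\<close> to
  \<open>\<bbbE>\<^sub>I\<^sub>I\<^sup>-\<^sup>n(A, X)\<close> for \<open>f : A \<rightarrow> A'\<close>.\<close>

primrec neg_II_map ::
    "('k, 'o, 'm, 'e::zero, 'z) extri_cat_scheme \<Rightarrow> nat \<Rightarrow> 'o \<Rightarrow> 'o \<Rightarrow> 'm \<Rightarrow> 'm \<Rightarrow> 'm" where
  "neg_II_map C 0 = (\<lambda>A A' f u. u \<cdot>\<^bsub>C\<^esub> f)"
| "neg_II_map C (Suc n) =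
     (\<lambda>A A' f u. neg_II_map C n (cosyz C A) (cosyz C A') (cosyz_mor C A A' f) u)"

primrec neg_II ::
    "('k, 'o, 'm::zero, 'e::zero, 'z) extri_cat_scheme \<Rightarrow> nat \<Rightarrow> 'o \<Rightarrow> 'o \<Rightarrow> 'm set" where
  "neg_II C 0 = (\<lambda>A X. Hom C A X)"
| "neg_II C (Suc n) = (\<lambda>A X. {u \<in> neg_II C n (cosyz C A) X.
     neg_II_map C n (cosyz_mid C A) (cosyz C A) (cosyz_defl C A) u = 0})"


section \<open>Dimensions, cardinalities and the Euler form\<close>

datatype neg_type = TypeI | TypeII

definition neg_ext ::
    "('k, 'o, 'm::zero, 'e::zero, 'z) extri_cat_scheme
       \<Rightarrow> neg_type \<Rightarrow> nat \<Rightarrow> 'o \<Rightarrow> 'o \<Rightarrow> 'm set" where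
  "neg_ext C d n X Y = (case d of TypeI \<Rightarrow> neg_I C n X Y | TypeII \<Rightarrow> neg_II C n X Y)"

text \<open>Finite-dimensionality, dimension and cardinality of \<open>\<bbbE>\<^sub>d\<^sup>i(X, Y)\<close>.\<close>

definition ext_fin_dim ::
    "('k::field, 'o, 'm::ab_group_add, 'e::ab_group_add, 'z) extri_cat_scheme
       \<Rightarrow> neg_type \<Rightarrow> int \<Rightarrow> 'o \<Rightarrow> 'o \<Rightarrow> bool" where
  "ext_fin_dim C d i X Y \<longleftrightarrow>
     (if i \<le> 0 then fin_dim (hscale C) (neg_ext C d (nat (- i)) X Y)
      else if i = 1 then fin_dim (escale C) (Ext C X Y)
      else quot_fin_dim pm_scale (yon_free C (nat i) X Y) (yon_rel C (nat i) X Y))"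

definition ext_dim ::
    "('k::field, 'o, 'm::ab_group_add, 'e::ab_group_add, 'z) extri_cat_scheme
       \<Rightarrow> neg_type \<Rightarrow> int \<Rightarrow> 'o \<Rightarrow> 'o \<Rightarrow> nat" where
  "ext_dim C d i X Y =
     (if i \<le> 0 then vector_space.dim (hscale C) (neg_ext C d (nat (- i)) X Y)
      else if i = 1 then vector_space.dim (escale C) (Ext C X Y)
      else quot_dim pm_scale (yon_free C (nat i) X Y) (yon_rel C (nat i) X Y))"

definition ext_card ::
    "('k::field, 'o, 'm::ab_group_add, 'e::ab_group_add, 'z) extri_cat_scheme
       \<Rightarrow> neg_type \<Rightarrow> int \<Rightarrow> 'o \<Rightarrow> 'o \<Rightarrow> nat" where
  "ext_card C d i X Y =
     (if i \<le> 0 then card (neg_ext C d (nat (- i)) X Y)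
      else if i = 1 then card (Ext C X Y)
      else card (quot_space (yon_free C (nat i) X Y) (yon_rel C (nat i) X Y)))"

text \<open>The sum and the products below run over all degrees; only finitely many terms are
  nontrivial when the total dimension is finite.\<close>

definition euler_form ::
    "('k::field, 'o, 'm::ab_group_add, 'e::ab_group_add, 'z) extri_cat_scheme
       \<Rightarrow> neg_type \<Rightarrow> 'o \<Rightarrow> 'o \<Rightarrow> int" where
  "euler_form C d X Y =
     Sum_any (\<lambda>i::int. (if even i then 1 else -1) * int (ext_dim C d i X Y))"

text \<open>\<open>{X, Y}'\<close>; the type is irrelevant in positive degrees.\<close>

definition pos_euler ::
    "('k::field, 'o, 'm::ab_group_add, 'e::ab_group_add, 'z) extri_cat_scheme
       \<Rightarrow> 'o \<Rightarrow> 'o \<Rightarrow> rat" where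
  "pos_euler C X Y =
     Prod_any (\<lambda>i::nat. if i > 0 then of_nat (ext_card C TypeI (int i) X Y) powi ((-1) ^ i) else 1)"

text \<open>\<open>{X, Y}\<close>\<close>

definition neg_euler ::
    "('k::field, 'o, 'm::ab_group_add, 'e::ab_group_add, 'z) extri_cat_scheme
       \<Rightarrow> neg_type \<Rightarrow> 'o \<Rightarrow> 'o \<Rightarrow> rat" where
  "neg_euler C d X Y =
     Prod_any (\<lambda>i::nat. if i > 0 then of_nat (ext_card C d (- int i) X Y) powi ((-1) ^ i) else 1)"

text \<open>\<open>[X, Y]\<close>\<close>

definition hom_euler ::
    "('k::field, 'o, 'm::ab_group_add, 'e::ab_group_add, 'z) extri_cat_scheme
       \<Rightarrow> 'o \<Rightarrow> 'o \<Rightarrow> rat" where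
  "hom_euler C X Y = 1 / (pos_euler C X Y * of_nat (card (Hom C X Y)))"


section \<open>Hall algebras\<close>

text \<open>\<open>\<^sub>X(L, Y)\<close>\<close>

definition deflations_cocone ::
    "('k, 'o, 'm, 'e, 'z) extri_cat_scheme \<Rightarrow> 'o \<Rightarrow> 'o \<Rightarrow> 'o \<Rightarrow> 'm set" where
  "deflations_cocone C X L Y =
     {g \<in> Hom C L Y. \<exists>A x \<delta>. triangle C A L Y x g \<delta> \<and> isomorphic C A X}"

definition hall_F ::
    "('k::field, 'o, 'm::ab_group_add, 'e::ab_group_add, 'z) extri_cat_scheme
       \<Rightarrow> 'o \<Rightarrow> 'o \<Rightarrow> 'o \<Rightarrow> rat" where
  "hall_F C X Y L =
     of_nat (card (deflations_cocone C X L Y)) / of_nat (card (Aut C Y)) *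
     (hom_euler C L Y / hom_euler C Y Y)"

definition hall_G ::
    "('k::field, 'o, 'm::ab_group_add, 'e::ab_group_add, 'z) extri_cat_scheme
       \<Rightarrow> neg_type \<Rightarrow> 'o \<Rightarrow> 'o \<Rightarrow> 'o \<Rightarrow> rat" where
  "hall_G C d X Y L =
     of_nat (card (deflations_cocone C X L Y)) / of_nat (card (Aut C Y)) *
     (neg_euler C d L Y / neg_euler C d Y Y)"

definition iso_class :: "('k, 'o, 'm, 'z) lin_cat_scheme \<Rightarrow> 'o \<Rightarrow> 'o set" where
  "iso_class C X = {Y. isomorphic C X Y}"

definition class_rep :: "'o set \<Rightarrow> 'o" where
  "class_rep c = (SOME X. X \<in> c)"

text \<open>The \<open>\<rat>\<close>-vector space with basis \<open>u\<^bsub>[X]\<^esub>\<close>, inside the free vector space on all sets of objects.\<close>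

definition hall_space :: "('k, 'o, 'm, 'z) lin_cat_scheme \<Rightarrow> ('o set \<Rightarrow>\<^sub>0 rat) set" where
  "hall_space C = {v. Poly_Mapping.keys v \<subseteq> range (iso_class C)}"

definition hall_basis :: "('k, 'o, 'm, 'z) lin_cat_scheme \<Rightarrow> 'o \<Rightarrow> ('o set \<Rightarrow>\<^sub>0 rat)" where
  "hall_basis C X = Poly_Mapping.single (iso_class C X) 1"

text \<open>The sum of \<open>\<phi> L\<close> over the isomorphism classes \<open>[L]\<close>. In the Hall products it is finite, as
  \<open>\<bbbE>(Y, X)\<close> is finite and every extension has one middle term up to isomorphism.\<close>

definition class_sum ::
    "('k, 'o, 'm, 'z) lin_cat_scheme \<Rightarrow> ('o \<Rightarrow> ('o set \<Rightarrow>\<^sub>0 rat)) \<Rightarrow> ('o set \<Rightarrow>\<^sub>0 rat)" where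
  "class_sum C \<phi> = Sum_any (\<lambda>c. if c \<in> range (iso_class C) then \<phi> (class_rep c) else 0)"

text \<open>Bilinear extension to \<open>hall_space\<close> of a product \<open>\<mu>\<close> of basis vectors.\<close>

definition bilinear_ext ::
    "('o \<Rightarrow> 'o \<Rightarrow> ('o set \<Rightarrow>\<^sub>0 rat))
       \<Rightarrow> ('o set \<Rightarrow>\<^sub>0 rat) \<Rightarrow> ('o set \<Rightarrow>\<^sub>0 rat) \<Rightarrow> ('o set \<Rightarrow>\<^sub>0 rat)" where
  "bilinear_ext \<mu> v w = (\<Sum>a\<in>Poly_Mapping.keys v. \<Sum>b\<in>Poly_Mapping.keys w.
     pm_scale (Poly_Mapping.lookup v a * Poly_Mapping.lookup w b) (\<mu> (class_rep a) (class_rep b)))"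

definition hall_mult ::
    "('k::field, 'o, 'm::ab_group_add, 'e::ab_group_add, 'z) extri_cat_scheme
       \<Rightarrow> ('o set \<Rightarrow>\<^sub>0 rat) \<Rightarrow> ('o set \<Rightarrow>\<^sub>0 rat) \<Rightarrow> ('o set \<Rightarrow>\<^sub>0 rat)" where
  "hall_mult C = bilinear_ext
     (\<lambda>X Y. class_sum C (\<lambda>L. pm_scale (hall_F C X Y L) (hall_basis C L)))"

definition tw_hall_mult ::
    "('k::{field,finite}, 'o, 'm::ab_group_add, 'e::ab_group_add, 'z) extri_cat_scheme
       \<Rightarrow> neg_type \<Rightarrow> ('o set \<Rightarrow>\<^sub>0 rat) \<Rightarrow> ('o set \<Rightarrow>\<^sub>0 rat) \<Rightarrow> ('o set \<Rightarrow>\<^sub>0 rat)" where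
  "tw_hall_mult C d = bilinear_ext
     (\<lambda>X Y. pm_scale (of_nat CARD('k) powi (- euler_form C d X Y))
        (class_sum C (\<lambda>L. pm_scale (hall_G C d X Y L) (hall_basis C L))))"

end

(* Both structure constants count the same deflations L -> Y, so the claim amounts to the identity
   <L, Y> = <X, Y> + <Y, Y>, that is, to additivity of the Euler form in the first argument on a
   triangle A -> B -> D. Since k is finite, all dimensions are compared through cardinalities.

   Positive degrees, and negative degrees of type II: rotate the triangle along a projective
   resolution K -> P -> D to K -> A + P -> B, or along an injective one in the opposite category.
   Three rotations shift all degrees by one and E^n(D, -) = E^(n-1)(K, -), so finiteness of the
   total dimension lets an induction start from the zero situation.

   Negative degrees of type I: here the connecting map in the first argument need not exist, but the
   cardinalities still match, by counting a relation in its place. The count expresses the defect of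
   additivity at Y by the defect at a syzygy of Y, whose negative extensions are those of Y shifted
   by one degree. *)

theory Submission
  imports Defs
begin

text \<open>The Euler form is cut at degree 0. In positive degrees additivity fails by the dimension
  of the kernel of E(D,Y) -> E(B,Y), in negative degrees by that of the kernel of Hom(D,Y) ->
  Hom(B,Y), and in degree 0 by minus the sum of the two. Hence no long exact sequence is assembled:
  each half is an induction that carries a single defect. The obstacle for type I is that these
  groups are satellites in the second argument, while the triangle varies in the first. For an
  E-triangle K -> P -> Y with P projective, a morphism A -> K killed by K -> P determines D -> Y
  only up to morphisms through P. Assumption (d), applied to P, is what makes this ambiguity
  countable. The power of q comes from [X,Y] = q^(-<X,Y>) {X,Y}: the quotients [L,Y]/[Y,Y] and
  {L,Y}/{Y,Y} differ by q to the power <Y,Y> - <L,Y>.\<close>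

section \<open>Cardinalities of vector spaces and alternating sums\<close>

text \<open>The first isomorphism theorem as a count. Additivity of \<open>h\<close> is asked on
  \<open>G\<close> only, since composition in the ambient space is constrained only on composable
  pairs.\<close>

lemma card_eq_card_kernel_times_card_image:
  fixes h :: "'a::ab_group_add \<Rightarrow> 'b::ab_group_add"
  assumes fin: "finite G" and zero: "0 \<in> G"
    and diff: "\<And>x y. x \<in> G \<Longrightarrow> y \<in> G \<Longrightarrow> x - y \<in> G"
    and hom: "\<And>x y. x \<in> G \<Longrightarrow> y \<in> G \<Longrightarrow> h (x - y) = h x - h y"
  shows "card G = card {x \<in> G. h x = 0} * card (h ` G)"
proof -
  have add: "x + y \<in> G" if "x \<in> G" "y \<in> G" for x y
    using diff[OF that(1) diff[OF zero that(2)]] by simp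
  have fiber: "card {x \<in> G. h x = z} = card {x \<in> G. h x = 0}" if "z \<in> h ` G" for z
  proof -
    obtain g where g: "g \<in> G" "z = h g" using \<open>z \<in> h ` G\<close> by blast
    have "bij_betw (\<lambda>x. x - g) {x \<in> G. h x = z} {x \<in> G. h x = 0}"
    proof (rule bij_betw_byWitness[where f' = "\<lambda>x. x + g"])
      show "(\<lambda>x. x + g) ` {x \<in> G. h x = 0} \<subseteq> {x \<in> G. h x = z}"
      proof safe
        fix x assume x: "x \<in> G" "h x = 0"
        have "h (x + g) - h g = h x" using hom[OF add[OF x(1) g(1)] g(1)] by simp
        then show "h (x + g) = z" using x g by simp
        show "x + g \<in> G" using add x g by blast
      qed
    qed (use diff hom g in auto)
    then show ?thesis by (rule bij_betw_same_card)
  qed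
  have "card G = (\<Sum>z\<in>h ` G. card {x \<in> G. h x = z})"
    using sum.image_gen[OF fin, of "\<lambda>_. 1::nat" h] by simp
  also have "\<dots> = card {x \<in> G. h x = 0} * card (h ` G)"
    using fiber by simp
  finally show ?thesis .
qed

context vector_space
begin

lemma card_span_independent:
  assumes "finite (UNIV :: 'a set)" "finite B" "independent B"
  shows "finite (span B)" and "card (span B) = CARD('a) ^ card B"
proof -
  have "finite (span B) \<and> card (span B) = CARD('a) ^ card B"
    using assms(2,3)
  proof (induction B rule: finite_induct)
    case empty
    then show ?case by simp
  next
    case (insert a B)
    have ind: "independent B" using insert.prems independent_mono by blast
    have a: "a \<notin> span B" using insert.hyps insert.prems by (simp add: independent_insert)
    have "bij_betw (\<lambda>(c, v). scale c a + v) (UNIV \<times> span B) (span (insert a B))"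
    proof (rule bij_betwI')
      fix p p' :: "'a \<times> 'b" assume pp: "p \<in> UNIV \<times> span B" "p' \<in> UNIV \<times> span B"
      obtain c v c' v' where p: "p = (c, v)" "p' = (c', v')" by (metis surj_pair)
      show "((case p of (c, v) \<Rightarrow> scale c a + v) = (case p' of (c, v) \<Rightarrow> scale c a + v)) = (p = p')"
      proof
        assume "(case p of (c, v) \<Rightarrow> scale c a + v) = (case p' of (c, v) \<Rightarrow> scale c a + v)"
        then have *: "scale (c - c') a = v' - v"
          by (simp add: p algebra_simps scale_left_diff_distrib)
        have "c = c'"
        proof (rule ccontr)
          assume "c \<noteq> c'"
          have "scale (c - c') a \<in> span B" unfolding * using pp p by (auto intro: span_diff)
          then have "scale (inverse (c - c')) (scale (c - c') a) \<in> span B" by (rule span_scale)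
          then show False using a \<open>c \<noteq> c'\<close> by simp
        qed
        then show "p = p'" using * p by simp
      qed simp
    next
      fix p :: "'a \<times> 'b" assume "p \<in> UNIV \<times> span B"
      then show "(case p of (c, v) \<Rightarrow> scale c a + v) \<in> span (insert a B)"
        by (auto simp: span_insert intro!: exI[of _ "fst p"])
    next
      fix w assume "w \<in> span (insert a B)"
      then obtain c where "w - scale c a \<in> span B" by (auto simp: span_insert)
      then show "\<exists>p\<in>UNIV \<times> span B. w = (case p of (c, v) \<Rightarrow> scale c a + v)"
        by (intro bexI[of _ "(c, w - scale c a)"]) auto
    qed
    from bij_betw_same_card[OF this] bij_betw_finite[OF this] insert.IH[OF ind] assms(1) insert.hyps
    show ?case by (simp add: card_cartesian_product)
  qed
  then show "finite (span B)" "card (span B) = CARD('a) ^ card B" by auto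
qed

lemma card_finite_subspace:
  assumes "finite (UNIV :: 'a set)" "subspace V" "finite V"
  shows "card V = CARD('a) ^ dim V"
proof -
  obtain B where B: "B \<subseteq> V" "independent B" "V \<subseteq> span B" "card B = dim V"
    using basis_exists[of V] by blast
  have "V = span B" using B assms(2) span_minimal by blast
  then show ?thesis
    using card_span_independent[OF assms(1) finite_subset[OF B(1) assms(3)] B(2)] B(4) by simp
qed

lemma fin_dim_imp_finite:
  assumes "finite (UNIV :: 'a set)" "fin_dim scale V"
  shows "finite V"
proof -
  obtain B where B: "finite B" "B \<subseteq> V" "V \<subseteq> span B" using assms(2) unfolding fin_dim_def by blast
  obtain B' where "B' \<subseteq> B" "independent B'" "B \<subseteq> span B'" "card B' = dim B"
    using basis_exists[of B] by blast
  moreover have "V \<subseteq> span B'"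
    using B(3) \<open>B \<subseteq> span B'\<close> by (meson span_minimal subspace_span subset_trans)
  ultimately show ?thesis
    using card_span_independent(1)[OF assms(1)] B(1) finite_subset by meson
qed

text \<open>A generating set modulo \<open>W\<close> of least cardinality works: if one of its
  vectors lay in the span of the others and \<open>W\<close>, it could be dropped. Independence and
  trivial intersection with \<open>W\<close> are both instances of this.\<close>

lemma quot_basis_exists:
  assumes W: "subspace W" and fd: "quot_fin_dim scale V W"
  shows "\<exists>B. finite B \<and> quot_basis scale V W B"
proof -
  define Q where "Q B \<longleftrightarrow> finite B \<and> B \<subseteq> V \<and> V \<subseteq> span (B \<union> W)" for B
  have "\<exists>B. Q B" using fd by (simp add: quot_fin_dim_def Q_def)
  then obtain B where B: "Q B" and min: "\<And>B'. Q B' \<Longrightarrow> card B \<le> card B'"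
    using ex_has_least_nat[of Q _ card] by blast
  have red: "b \<notin> span ((B - {b}) \<union> W)" if "b \<in> B" for b
  proof
    assume b: "b \<in> span ((B - {b}) \<union> W)"
    have "B \<union> W \<subseteq> span ((B - {b}) \<union> W)" using b by (auto intro: span_base)
    then have "span (B \<union> W) \<subseteq> span ((B - {b}) \<union> W)" by (simp add: span_minimal)
    then have "Q (B - {b})" using B by (auto simp: Q_def)
    then show False using min[of "B - {b}"] \<open>b \<in> B\<close> B card_Diff1_less[of B b] by (auto simp: Q_def)
  qed
  have ind: "independent B"
  proof
    assume "dependent B"
    then obtain b where "b \<in> B" "b \<in> span (B - {b})" by (auto simp: dependent_def)
    then show False using red[of b] span_mono[of "B - {b}" "(B - {b}) \<union> W"] by auto
  qed
  have "span B \<inter> W \<subseteq> {0}"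
  proof
    fix v assume v: "v \<in> span B \<inter> W"
    then obtain u where u: "v = (\<Sum>b\<in>B. scale (u b) b)"
      using B span_finite[of B] by (auto simp: Q_def)
    have "u b = 0" if "b \<in> B" for b
    proof (rule ccontr)
      assume "u b \<noteq> 0"
      have "v = scale (u b) b + (\<Sum>b\<in>B - {b}. scale (u b) b)"
        using u B \<open>b \<in> B\<close> by (simp add: Q_def sum.remove)
      then have "scale (u b) b = v - (\<Sum>b\<in>B - {b}. scale (u b) b)" by simp
      moreover have "v \<in> span ((B - {b}) \<union> W)" using v by (auto intro: span_base)
      moreover have "(\<Sum>b\<in>B - {b}. scale (u b) b) \<in> span ((B - {b}) \<union> W)"
        by (intro span_sum span_scale span_base) auto
      ultimately have "scale (u b) b \<in> span ((B - {b}) \<union> W)" by (metis span_diff)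
      then have "scale (inverse (u b)) (scale (u b) b) \<in> span ((B - {b}) \<union> W)" by (rule span_scale)
      then show False using red[OF \<open>b \<in> B\<close>] \<open>u b \<noteq> 0\<close> by simp
    qed
    then show "v \<in> {0}" using u by simp
  qed
  then have "quot_basis scale V W B"
    using B ind subspace_0[OF W] by (auto simp: quot_basis_def Q_def span_zero)
  then show ?thesis using B by (auto simp: Q_def)
qed

text \<open>Every coset of \<open>W\<close> in \<open>V\<close> meets \<open>span B\<close> in
  exactly one vector.\<close>

lemma bij_betw_span_quot_space:
  assumes W: "subspace W" and V: "subspace V" and B: "quot_basis scale V W B"
  shows "bij_betw (\<lambda>v. {(x, y). x \<in> V \<and> y \<in> V \<and> x - y \<in> W} `` {v}) (span B) (quot_space V W)"
proof -
  have sub: "span B \<subseteq> V" using B V span_minimal by (auto simp: quot_basis_def)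
  have tot: "V \<subseteq> span (B \<union> W)" and int: "span B \<inter> W = {0}"
    using B by (auto simp: quot_basis_def)
  have W0: "0 \<in> W" using W by (rule subspace_0)
  show ?thesis
  proof (rule bij_betwI')
    fix v v' assume v: "v \<in> span B" "v' \<in> span B"
    show "({(x, y). x \<in> V \<and> y \<in> V \<and> x - y \<in> W} `` {v} =
           {(x, y). x \<in> V \<and> y \<in> V \<and> x - y \<in> W} `` {v'}) = (v = v')"
    proof
      assume eq: "{(x, y). x \<in> V \<and> y \<in> V \<and> x - y \<in> W} `` {v} =
           {(x, y). x \<in> V \<and> y \<in> V \<and> x - y \<in> W} `` {v'}"
      have "v' \<in> {(x, y). x \<in> V \<and> y \<in> V \<and> x - y \<in> W} `` {v'}" using v sub W0 by auto
      then have "v' \<in> {(x, y). x \<in> V \<and> y \<in> V \<and> x - y \<in> W} `` {v}" by (simp only: eq)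
      then have "v - v' \<in> span B \<inter> W" using v span_diff by auto
      then show "v = v'" using int by simp
    qed simp
  next
    fix v assume "v \<in> span B"
    then show "{(x, y). x \<in> V \<and> y \<in> V \<and> x - y \<in> W} `` {v} \<in> quot_space V W"
      unfolding quot_space_def using sub by (intro quotientI) auto
  next
    fix c assume "c \<in> quot_space V W"
    then obtain v where v: "v \<in> V" and c: "c = {(x, y). x \<in> V \<and> y \<in> V \<and> x - y \<in> W} `` {v}"
      unfolding quot_space_def by (auto elim!: quotientE)
    obtain b w where b: "b \<in> span B" and w: "w \<in> W" and vbw: "v = b + w"
      using tot v span_Un[of B W] iffD2[OF span_eq_iff W] by auto
    have "{(x, y). x \<in> V \<and> y \<in> V \<and> x - y \<in> W} `` {v} = {(x, y). x \<in> V \<and> y \<in> V \<and> x - y \<in> W} `` {b}"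
    proof -
      have "v - z \<in> W \<longleftrightarrow> b - z \<in> W" for z
      proof -
        have "v - z = (b - z) + w" "b - z = (v - z) - w" by (simp_all add: vbw)
        then show ?thesis using subspace_add[OF W _ w] subspace_diff[OF W _ w] by metis
      qed
      then show ?thesis using v b sub by auto
    qed
    then show "\<exists>v\<in>span B. c = {(x, y). x \<in> V \<and> y \<in> V \<and> x - y \<in> W} `` {v}" using b c by blast
  qed
qed

lemma card_quot_space:
  assumes fin: "finite (UNIV :: 'a set)" and W: "subspace W" and V: "subspace V"
    and fd: "quot_fin_dim scale V W"
  shows "card (quot_space V W) = CARD('a) ^ quot_dim scale V W"
proof -
  obtain B0 where B0: "finite B0" "quot_basis scale V W B0" using quot_basis_exists[OF W fd] by blast
  define B where "B = (SOME B. quot_basis scale V W B)"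
  have B: "quot_basis scale V W B" unfolding B_def using B0(2) by (rule someI)
  \<comment> \<open>The basis chosen by \<open>SOME\<close> in \<open>quot_dim\<close> is not known
    to be finite. Its span is in bijection with the quotient, and so with the span of the finite
    \<open>B0\<close>.\<close>
  have "finite (span B0)"
    using card_span_independent[OF fin B0(1)] B0(2) by (auto simp: quot_basis_def)
  then have "finite (span B)"
    using bij_betw_finite[OF bij_betw_span_quot_space[OF W V B0(2)]]
      bij_betw_finite[OF bij_betw_span_quot_space[OF W V B]] by simp
  then have "finite B" using span_superset finite_subset by blast
  then have "card (span B) = CARD('a) ^ card B"
    using card_span_independent[OF fin] B by (auto simp: quot_basis_def)
  then show ?thesis
    using bij_betw_same_card[OF bij_betw_span_quot_space[OF W V B]] by (simp add: quot_dim_def B_def)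
qed

end

text \<open>The maps only have to respect the congruences and to be mutually inverse modulo them;
  linearity is not asked. The map sending an extension to its one-letter chain is linear only modulo
  relations.\<close>

lemma card_quot_space_eqI:
  fixes V :: "'v::ab_group_add set" and V' :: "'w::ab_group_add set"
  assumes f: "\<And>x. x \<in> V \<Longrightarrow> f x \<in> V'" and g: "\<And>x. x \<in> V' \<Longrightarrow> g x \<in> V"
    and fc: "\<And>x y. x \<in> V \<Longrightarrow> y \<in> V \<Longrightarrow> x - y \<in> W \<Longrightarrow> f x - f y \<in> W'"
    and gc: "\<And>x y. x \<in> V' \<Longrightarrow> y \<in> V' \<Longrightarrow> x - y \<in> W' \<Longrightarrow> g x - g y \<in> W"
    and gf: "\<And>x. x \<in> V \<Longrightarrow> g (f x) - x \<in> W" and fg: "\<And>x. x \<in> V' \<Longrightarrow> f (g x) - x \<in> W'"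
    and W: "0 \<in> W" "\<And>x y. x \<in> W \<Longrightarrow> y \<in> W \<Longrightarrow> x - y \<in> W"
    and W': "0 \<in> W'" "\<And>x y. x \<in> W' \<Longrightarrow> y \<in> W' \<Longrightarrow> x - y \<in> W'"
  shows "card (quot_space V W) = card (quot_space V' W')"
proof -
  define R where "R = {(x, y). x \<in> V \<and> y \<in> V \<and> x - y \<in> W}"
  define R' where "R' = {(x, y). x \<in> V' \<and> y \<in> V' \<and> x - y \<in> W'}"
  have equivI: "equiv U {(x, y). x \<in> U \<and> y \<in> U \<and> x - y \<in> Z}"
    if Z: "0 \<in> Z" "\<And>x y. x \<in> Z \<Longrightarrow> y \<in> Z \<Longrightarrow> x - y \<in> Z" for U Z :: "'z::ab_group_add set"
  proof (rule equivI)
    show "refl_on U {(x, y). x \<in> U \<and> y \<in> U \<and> x - y \<in> Z}" using Z by (auto simp: refl_on_def)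
    have m: "y - x \<in> Z" if "x - y \<in> Z" for x y using Z(2)[OF Z(1) that] by simp
    show "sym {(x, y). x \<in> U \<and> y \<in> U \<and> x - y \<in> Z}" using m by (auto simp: sym_def)
    show "trans {(x, y). x \<in> U \<and> y \<in> U \<and> x - y \<in> Z}"
    proof (rule transI, safe)
      fix x y z assume "x - y \<in> Z" "y - z \<in> Z"
      then show "x - z \<in> Z" using Z(2)[OF \<open>x - y \<in> Z\<close> m[OF \<open>y - z \<in> Z\<close>]] by simp
    qed
  qed auto
  have e: "equiv V R" unfolding R_def by (rule equivI) (use W in auto)
  have e': "equiv V' R'" unfolding R'_def by (rule equivI) (use W' in auto)
  have Rc: "R `` {x} = R `` {y} \<longleftrightarrow> x - y \<in> W" if "x \<in> V" "y \<in> V" for x y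
    using eq_equiv_class_iff[OF e that] that by (simp add: R_def)
  have Rc': "R' `` {x} = R' `` {y} \<longleftrightarrow> x - y \<in> W'" if "x \<in> V'" "y \<in> V'" for x y
    using eq_equiv_class_iff[OF e' that] that by (simp add: R'_def)
  have Wadd: "x + y \<in> W" if "x \<in> W" "y \<in> W" for x y
    using W(2)[OF that(1) W(2)[OF W(1) that(2)]] by simp
  have inj: "f x - f y \<in> W' \<longleftrightarrow> x - y \<in> W" if xy: "x \<in> V" "y \<in> V" for x y
  proof
    assume "f x - f y \<in> W'"
    then have "g (f x) - g (f y) \<in> W" using gc f xy by blast
    then have "(g (f x) - g (f y)) - (g (f x) - x) + (g (f y) - y) \<in> W"
      using gf xy W(2) Wadd by blast
    then show "x - y \<in> W" by (simp add: algebra_simps)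
  qed (use fc xy in blast)
  define r where "r c = (SOME x. x \<in> V \<and> R `` {x} = c)" for c
  have rep: "r c \<in> V" "R `` {r c} = c" if c: "c \<in> V // R" for c
  proof -
    have "\<exists>x. x \<in> V \<and> R `` {x} = c" using c by (auto elim!: quotientE)
    from someI_ex[OF this] show "r c \<in> V" "R `` {r c} = c" unfolding r_def by auto
  qed
  have "bij_betw (\<lambda>c. R' `` {f (r c)}) (V // R) (V' // R')"
  proof (rule bij_betwI')
    fix c c' assume c: "c \<in> V // R" "c' \<in> V // R"
    have "R' `` {f (r c)} = R' `` {f (r c')} \<longleftrightarrow> R `` {r c} = R `` {r c'}"
      using Rc'[OF f[OF rep(1)[OF c(1)]] f[OF rep(1)[OF c(2)]]]
        Rc[OF rep(1)[OF c(1)] rep(1)[OF c(2)]] inj[OF rep(1)[OF c(1)] rep(1)[OF c(2)]] by blast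
    then show "(R' `` {f (r c)} = R' `` {f (r c')}) = (c = c')" using rep c by simp
  next
    fix c assume "c \<in> V // R"
    then show "R' `` {f (r c)} \<in> V' // R'"
      using rep f by (intro quotientI) auto
  next
    fix c' assume "c' \<in> V' // R'"
    then obtain z where z: "z \<in> V'" "c' = R' `` {z}" by (auto elim: quotientE)
    have gz: "R `` {g z} \<in> V // R" using g z by (intro quotientI) auto
    have "r (R `` {g z}) - g z \<in> W" using Rc rep[OF gz] g z by blast
    then have "f (r (R `` {g z})) - f (g z) \<in> W'" using fc rep[OF gz] g z by blast
    then have "R' `` {f (r (R `` {g z}))} = R' `` {f (g z)}" using Rc' f rep[OF gz] g z by blast
    also have "\<dots> = R' `` {z}" using Rc' fg f g z by blast
    finally show "\<exists>c\<in>V // R. c' = R' `` {f (r c)}" using gz z by blast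
  qed
  then show ?thesis unfolding quot_space_def R_def[symmetric] R'_def[symmetric]
    by (rule bij_betw_same_card)
qed

section \<open>Truncated alternating sums and the rotation induction\<close>

definition alternating_sum :: "nat \<Rightarrow> (nat \<Rightarrow> nat) \<Rightarrow> int" where
  "alternating_sum N e = (\<Sum>n = 1..N. (-1) ^ n * int (e n))"

lemma alternating_sum_0 [simp]: "alternating_sum 0 e = 0"
  by (simp add: alternating_sum_def)

lemma alternating_sum_Suc_shift:
  assumes "\<And>n. n \<ge> 1 \<Longrightarrow> e' n = e (Suc n)"
  shows "alternating_sum (Suc N) e = - int (e 1) - alternating_sum N e'"
proof -
  have "alternating_sum (Suc N) e = - int (e 1) + (\<Sum>n = Suc 1..Suc N. (-1) ^ n * int (e n))"
    unfolding alternating_sum_def by (subst sum.atLeast_Suc_atMost) auto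
  also have "(\<Sum>n = Suc 1..Suc N. (-1) ^ n * int (e n)) = (\<Sum>n = 1..N. (-1) ^ Suc n * int (e (Suc n)))"
    by (rule sum.shift_bounds_cl_Suc_ivl)
  also have "\<dots> = - alternating_sum N e'"
    unfolding alternating_sum_def sum_negf[symmetric] by (intro sum.cong) (auto simp: assms)
  finally show ?thesis by simp
qed

text \<open>Three rotations move every term of the long exact sequence by one degree.\<close>

lemma alternating_sum_rotation:
  fixes e :: "'o \<Rightarrow> nat \<Rightarrow> nat" and T :: "'o \<Rightarrow> 'o \<Rightarrow> 'o \<Rightarrow> nat \<Rightarrow> bool"
  assumes rot: "\<And>A B D k. T A B D k \<Longrightarrow> \<exists>A' B' k'. T A' B' B k' \<and> k + k' = e D 1 \<and>
      (\<forall>n\<ge>1. e A' n = e D (Suc n)) \<and> (\<forall>n\<ge>1. e B' n = e A n)"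
    and "T A B D k"
    and "\<And>n. n > N \<Longrightarrow> e A n = 0" "\<And>n. n > N \<Longrightarrow> e B n = 0" "\<And>n. n > N \<Longrightarrow> e D n = 0"
  shows "alternating_sum N (e B) - alternating_sum N (e A) - alternating_sum N (e D) = int k"
  using assms(2-)
proof (induction N arbitrary: A B D k)
  case 0
  \<comment> \<open>All dimensions in positive degrees vanish, so two natural numbers with sum 0
    remain and \<open>k\<close> is 0.\<close>
  obtain k' where "k + k' = e D 1" using rot[OF 0(1)] by blast
  then show ?case using 0(4)[of 1] by simp
next
  case (Suc N)
  obtain A1 B1 k1 where 1: "T A1 B1 B k1" "k + k1 = e D 1"
    "\<And>n. n \<ge> 1 \<Longrightarrow> e A1 n = e D (Suc n)" "\<And>n. n \<ge> 1 \<Longrightarrow> e B1 n = e A n"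
    using rot[OF Suc.prems(1)] by blast
  obtain A2 B2 k2 where 2: "T A2 B2 B1 k2" "k1 + k2 = e B 1"
    "\<And>n. n \<ge> 1 \<Longrightarrow> e A2 n = e B (Suc n)" "\<And>n. n \<ge> 1 \<Longrightarrow> e B2 n = e A1 n"
    using rot[OF 1(1)] by blast
  obtain A3 B3 k3 where 3: "T A3 B3 B2 k3" "k2 + k3 = e B1 1"
    "\<And>n. n \<ge> 1 \<Longrightarrow> e A3 n = e B1 (Suc n)" "\<And>n. n \<ge> 1 \<Longrightarrow> e B3 n = e A2 n"
    using rot[OF 2(1)] by blast
  have sh: "e A3 n = e A (Suc n)" "e B3 n = e B (Suc n)" "e B2 n = e D (Suc n)" if "n \<ge> 1" for n
    using 1 2 3 that by auto
  have "alternating_sum N (e B3) - alternating_sum N (e A3) - alternating_sum N (e B2) = int k3"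
    by (rule Suc.IH[OF 3(1)]) (use sh Suc.prems in auto)
  moreover have "e B1 1 = e A 1" using 1(4) by simp
  moreover have
    "alternating_sum (Suc N) (e A) = - int (e A 1) - alternating_sum N (e A3)"
    "alternating_sum (Suc N) (e B) = - int (e B 1) - alternating_sum N (e B3)"
    "alternating_sum (Suc N) (e D) = - int (e D 1) - alternating_sum N (e B2)"
    by (rule alternating_sum_Suc_shift; use sh in simp)+
  \<comment> \<open>The three rotations telescope to \<open>k = e D 1 - e B 1 + e A 1 - k3\<close>,
    and these are the degree-1 terms split off by the shift.\<close>
  ultimately show ?case using 1(2) 2(2) 3(2) by linarith
qed

section \<open>Exactness of extension triangles\<close>

context linear_category
begin

lemma hom_0: "0 \<in> Hom C X Y"
  using Hom_subspace hom.subspace_0 by blast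

lemma hom_add: "f \<in> Hom C X Y \<Longrightarrow> g \<in> Hom C X Y \<Longrightarrow> f + g \<in> Hom C X Y"
  using Hom_subspace hom.subspace_add by blast

lemma hom_diff: "f \<in> Hom C X Y \<Longrightarrow> g \<in> Hom C X Y \<Longrightarrow> f - g \<in> Hom C X Y"
  using Hom_subspace hom.subspace_diff by blast

lemma hom_scale: "f \<in> Hom C X Y \<Longrightarrow> hscale C c f \<in> Hom C X Y"
  using Hom_subspace hom.subspace_scale by blast

lemma comp_0_right: "g \<in> Hom C Y Z \<Longrightarrow> g \<cdot> 0 = 0"
  using comp_add_right[OF hom_0 hom_0, of g _ Z] by simp

lemma comp_0_left: "f \<in> Hom C X Y \<Longrightarrow> 0 \<cdot> f = 0"
  using comp_add_left[OF _ hom_0 hom_0, of f X Y] by simp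

lemma comp_diff_left:
  assumes "f \<in> Hom C X Y" "g \<in> Hom C Y Z" "g' \<in> Hom C Y Z"
  shows "(g - g') \<cdot> f = g \<cdot> f - g' \<cdot> f"
  using comp_add_left[OF assms(1) hom_diff[OF assms(2,3)] assms(3)] by (simp add: algebra_simps)

lemma comp_diff_right:
  assumes "f \<in> Hom C X Y" "f' \<in> Hom C X Y" "g \<in> Hom C Y Z"
  shows "g \<cdot> (f - f') = g \<cdot> f - g \<cdot> f'"
  using comp_add_right[OF hom_diff[OF assms(1,2)] assms(2,3)] by (simp add: algebra_simps)

lemma is_iso_ide: "is_iso C X X (ide C X)"
  unfolding is_iso_def using ide_in comp_ide by blast

lemma is_iso_comp:
  assumes "is_iso C X Y f" "is_iso C Y Z g"
  shows "is_iso C X Z (g \<cdot> f)"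
proof -
  obtain f' where f: "f \<in> Hom C X Y" "f' \<in> Hom C Y X" "f' \<cdot> f = ide C X" "f \<cdot> f' = ide C Y"
    using assms(1) by (auto simp: is_iso_def)
  obtain g' where g: "g \<in> Hom C Y Z" "g' \<in> Hom C Z Y" "g' \<cdot> g = ide C Y" "g \<cdot> g' = ide C Z"
    using assms(2) by (auto simp: is_iso_def)
  have "(f' \<cdot> g') \<cdot> (g \<cdot> f) = ide C X"
    using f g comp_assoc[OF comp_in[OF f(1) g(1)] g(2) f(2)] comp_assoc[OF f(1) g(1,2)] ide_comp
    by simp
  moreover have "(g \<cdot> f) \<cdot> (f' \<cdot> g') = ide C Z"
    using f g comp_assoc[OF comp_in[OF g(2) f(2)] f(1) g(1)] comp_assoc[OF g(2) f(2,1)] ide_comp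
    by simp
  ultimately show ?thesis unfolding is_iso_def using comp_in f g by blast
qed

lemma is_iso_inverseE:
  assumes "is_iso C X Y f"
  obtains g where "is_iso C Y X g" "f \<in> Hom C X Y" "g \<in> Hom C Y X" "g \<cdot> f = ide C X" "f \<cdot> g = ide C Y"
  using assms unfolding is_iso_def by metis

end

context extriangulated_category
begin

lemma ext_0: "0 \<in> Ext C D A"
  using Ext_subspace ext.subspace_0 by blast

lemma ext_add: "\<delta> \<in> Ext C D A \<Longrightarrow> \<epsilon> \<in> Ext C D A \<Longrightarrow> \<delta> + \<epsilon> \<in> Ext C D A"
  using Ext_subspace ext.subspace_add by blast

lemma ext_diff: "\<delta> \<in> Ext C D A \<Longrightarrow> \<epsilon> \<in> Ext C D A \<Longrightarrow> \<delta> - \<epsilon> \<in> Ext C D A"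
  using Ext_subspace ext.subspace_diff by blast

lemma ext_scale: "\<delta> \<in> Ext C D A \<Longrightarrow> escale C t \<delta> \<in> Ext C D A"
  using Ext_subspace ext.subspace_scale by blast

lemma push_0: "a \<in> Hom C A A' \<Longrightarrow> push C a 0 = 0"
  using push_add[OF _ ext_0 ext_0] by fastforce

lemma pull_0: "c \<in> Hom C D' D \<Longrightarrow> pull C c 0 = 0"
  using pull_add[OF _ ext_0 ext_0] by fastforce

lemma push_zero_map: "\<delta> \<in> Ext C D A \<Longrightarrow> push C 0 \<delta> = 0"
  using add_push[OF hom_0 hom_0] by fastforce

lemma pull_zero_map: "\<delta> \<in> Ext C D A \<Longrightarrow> pull C 0 \<delta> = 0"
  using add_pull[OF hom_0 hom_0] by fastforce

lemma pull_diff: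
  assumes "c \<in> Hom C D' D" "\<delta> \<in> Ext C D A" "\<epsilon> \<in> Ext C D A"
  shows "pull C c (\<delta> - \<epsilon>) = pull C c \<delta> - pull C c \<epsilon>"
  using pull_add[OF assms(1) ext_diff[OF assms(2,3)] assms(3)] by (simp add: algebra_simps)

lemma diff_push:
  assumes "a \<in> Hom C A A'" "a' \<in> Hom C A A'" "\<delta> \<in> Ext C D A"
  shows "push C (a - a') \<delta> = push C a \<delta> - push C a' \<delta>"
  using add_push[OF hom_diff[OF assms(1,2)] assms(2,3)] by (simp add: algebra_simps)

lemma diff_pull:
  assumes "c \<in> Hom C D' D" "c' \<in> Hom C D' D" "\<delta> \<in> Ext C D A"
  shows "pull C (c - c') \<delta> = pull C c \<delta> - pull C c' \<delta>"
  using add_pull[OF hom_diff[OF assms(1,2)] assms(2,3)] by (simp add: algebra_simps)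

lemma triangle_in:
  assumes "triangle C A B D x y \<delta>"
  shows "x \<in> Hom C A B" "y \<in> Hom C B D" "\<delta> \<in> Ext C D A"
proof -
  show d: "\<delta> \<in> Ext C D A" using assms by (simp add: triangle_def)
  show "x \<in> Hom C A B" "y \<in> Hom C B D"
    using assms realization_class[OF d] by (auto simp: triangle_def seq_class_def)
qed

lemma triangle_exists:
  assumes "\<delta> \<in> Ext C D A"
  obtains B x y where "triangle C A B D x y \<delta>"
proof -
  obtain B x y where B: "x \<in> Hom C A B" "y \<in> Hom C B D" "realization C D A \<delta> = seq_class C A D (B, x, y)"
    using realization_class[OF assms] by blast
  then have "(B, x, y) \<in> realization C D A \<delta>"
    using is_iso_ide[of B] ide_comp comp_ide by (auto simp: seq_class_def)
  then show thesis using that assms by (auto simp: triangle_def)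
qed

text \<open>Both sequences are compared with the representative of the class provided by (ET2); the
  isomorphism goes back along one comparison and forth along the other.\<close>

lemma triangle_iso:
  assumes "triangle C A B D x y \<delta>" "triangle C A B' D x' y' \<delta>"
  obtains b where "is_iso C B B' b" "b \<cdot> x = x'" "y' \<cdot> b = y"
proof -
  have d: "\<delta> \<in> Ext C D A" using assms by (simp add: triangle_def)
  obtain B0 x0 y0 where 0: "x0 \<in> Hom C A B0" "y0 \<in> Hom C B0 D"
    "realization C D A \<delta> = seq_class C A D (B0, x0, y0)"
    using realization_class[OF d] by blast
  obtain b where b: "is_iso C B0 B b" "b \<cdot> x0 = x" "y \<cdot> b = y0"
    using assms(1) 0(3) by (auto simp: triangle_def seq_class_def)
  obtain b' where b': "is_iso C B0 B' b'" "b' \<cdot> x0 = x'" "y' \<cdot> b' = y0"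
    using assms(2) 0(3) by (auto simp: triangle_def seq_class_def)
  obtain c where c: "is_iso C B B0 c" "b \<in> Hom C B0 B" "c \<in> Hom C B B0"
    "c \<cdot> b = ide C B0" "b \<cdot> c = ide C B"
    using is_iso_inverseE[OF b(1)] by metis
  have b'in: "b' \<in> Hom C B0 B'" using b'(1) by (simp add: is_iso_def)
  have in': "x' \<in> Hom C A B'" "y' \<in> Hom C B' D" "x \<in> Hom C A B" "y \<in> Hom C B D"
    using assms triangle_in by blast+
  have "(b' \<cdot> c) \<cdot> x = b' \<cdot> ((c \<cdot> b) \<cdot> x0)"
    using comp_assoc[OF in'(3) c(3) b'in] comp_assoc[OF 0(1) c(2,3)] b(2) by simp
  also have "\<dots> = x'" using c(4) ide_comp[OF 0(1)] b'(2) by simp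
  finally have 1: "(b' \<cdot> c) \<cdot> x = x'" .
  have "y' \<cdot> (b' \<cdot> c) = y \<cdot> (b \<cdot> c)"
    using comp_assoc[OF c(3) b'in in'(2)] comp_assoc[OF c(3,2) in'(4)] b(3) b'(3) by simp
  then have "y' \<cdot> (b' \<cdot> c) = y" using c(5) comp_ide[OF in'(4)] by simp
  with 1 show thesis using that is_iso_comp[OF c(1) b'(1)] by blast
qed

lemma biproduct_triangle:
  assumes "is_biproduct C A D S i1 i2 p1 p2"
  shows "triangle C A S D i1 p2 0"
  unfolding triangle_def realization_zero[OF assms] seq_class_def
  using assms is_iso_ide[of S] ide_comp comp_ide ext_0 by (auto simp: is_biproduct_def)

text \<open>By (ET2) the zero extension is realized by a split sequence, whose biproduct structure
  is transported along the isomorphism of middle terms.\<close>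

lemma zero_ext_biproduct:
  assumes "triangle C A B D x y 0"
  obtains s r where "is_biproduct C A D B x s r y"
proof -
  obtain S i1 i2 p1 p2 where S: "is_biproduct C A D S i1 i2 p1 p2" using biproducts by blast
  obtain b where b: "is_iso C S B b" "b \<cdot> i1 = x" "y \<cdot> b = p2"
    using triangle_iso[OF biproduct_triangle[OF S] assms] by blast
  obtain c where c: "b \<in> Hom C S B" "c \<in> Hom C B S" "c \<cdot> b = ide C S" "b \<cdot> c = ide C B"
    using is_iso_inverseE[OF b(1)] by metis
  have S': "i1 \<in> Hom C A S" "i2 \<in> Hom C D S" "p1 \<in> Hom C S A" "p2 \<in> Hom C S D"
    "p1 \<cdot> i1 = ide C A" "p2 \<cdot> i2 = ide C D" "p1 \<cdot> i2 = 0" "p2 \<cdot> i1 = 0"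
    "i1 \<cdot> p1 + i2 \<cdot> p2 = ide C S"
    using S by (auto simp: is_biproduct_def)
  have y: "y \<in> Hom C B D" using triangle_in[OF assms] by simp
  have y': "y = p2 \<cdot> c" using comp_assoc[OF c(2,1) y] b(3) c(4) comp_ide[OF y] by simp
  have cb: "(h \<cdot> c) \<cdot> (b \<cdot> f) = h \<cdot> f" if "f \<in> Hom C X S" "h \<in> Hom C S Y" for f h X Y
    using comp_assoc[OF comp_in[OF that(1) c(1)] c(2) that(2)] comp_assoc[OF that(1) c(1,2)]
      c(3) ide_comp[OF that(1)] by simp
  have "(b \<cdot> i1) \<cdot> (p1 \<cdot> c) + (b \<cdot> i2) \<cdot> (p2 \<cdot> c) = b \<cdot> ((i1 \<cdot> p1 + i2 \<cdot> p2) \<cdot> c)"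
    using comp_assoc[OF comp_in[OF c(2) S'(3)] S'(1) c(1)] comp_assoc[OF c(2) S'(3,1)]
      comp_assoc[OF comp_in[OF c(2) S'(4)] S'(2) c(1)] comp_assoc[OF c(2) S'(4,2)]
      comp_add_left[OF c(2) comp_in[OF S'(3,1)] comp_in[OF S'(4,2)]]
      comp_add_right[OF comp_in[OF c(2) comp_in[OF S'(3,1)]] comp_in[OF c(2) comp_in[OF S'(4,2)]] c(1)]
    by simp
  then have "(b \<cdot> i1) \<cdot> (p1 \<cdot> c) + (b \<cdot> i2) \<cdot> (p2 \<cdot> c) = ide C B"
    using S'(9) c ide_comp[OF c(2)] by simp
  then have "is_biproduct C A D B (b \<cdot> i1) (b \<cdot> i2) (p1 \<cdot> c) (p2 \<cdot> c)"
    unfolding is_biproduct_def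
    using cb[OF S'(1,3)] cb[OF S'(2,3)] cb[OF S'(1,4)] cb[OF S'(2,4)] S' comp_in c by simp
  then show thesis using that b(2) y' by simp
qed

lemma zero_objectE: obtains Z where "ide C Z = 0"
  using zero_object by blast

text \<open>The trivial triangles on \<open>X\<close> and a zero object are test objects: comparing
  a triangle with them turns (ET2), (ET3) and its dual into the exactness statements that
  follow.\<close>

lemma triangle_ide_left:
  assumes "ide C Z = 0"
  shows "triangle C X X Z (ide C X) 0 0"
  by (rule biproduct_triangle[of X Z X "ide C X" 0 "ide C X" 0])
    (use assms in \<open>auto simp: is_biproduct_def ide_in hom_0 comp_ide[OF ide_in] comp_0_left[OF hom_0]
       comp_0_right[OF ide_in] comp_0_left[OF ide_in]\<close>)

lemma triangle_ide_right:
  assumes "ide C Z = 0"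
  shows "triangle C Z X X 0 (ide C X) 0"
  by (rule biproduct_triangle[of Z X X 0 "ide C X" 0 "ide C X"])
    (use assms in \<open>auto simp: is_biproduct_def ide_in hom_0 comp_ide[OF ide_in] comp_0_left[OF hom_0]
       comp_0_right[OF ide_in] comp_0_left[OF ide_in]\<close>)

context
  fixes A B D x y \<delta>
  assumes tri: "triangle C A B D x y \<delta>"
begin

lemma triangle_comp_zero: "y \<cdot> x = 0"
proof -
  obtain Z where Z: "ide C Z = 0" by (rule zero_objectE)
  have in': "x \<in> Hom C A B" "y \<in> Hom C B D" using triangle_in[OF tri] by auto
  obtain c where c: "c \<in> Hom C Z D" "c \<cdot> 0 = y \<cdot> x"
    using ET3[OF triangle_ide_left[OF Z] tri ide_in in'(1)] by blast
  then show ?thesis using comp_0_right by metis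
qed

lemma triangle_push_zero: "push C x \<delta> = 0"
proof -
  obtain Z where Z: "ide C Z = 0" by (rule zero_objectE)
  have in': "x \<in> Hom C A B" "y \<in> Hom C B D" using triangle_in[OF tri] by auto
  obtain c where c: "c \<in> Hom C D Z" "push C x \<delta> = pull C c 0"
    using ET3[OF tri triangle_ide_left[OF Z] in'(1) ide_in] by blast
  then show ?thesis using pull_0 by metis
qed

lemma triangle_pull_zero: "pull C y \<delta> = 0"
proof -
  obtain Z where Z: "ide C Z = 0" by (rule zero_objectE)
  have in': "x \<in> Hom C A B" "y \<in> Hom C B D" using triangle_in[OF tri] by auto
  obtain a where "a \<in> Hom C Z A" "push C a 0 = pull C y \<delta>"
    using ET3_op[OF triangle_ide_right[OF Z] tri ide_in in'(2)] by blast
  then show ?thesis using push_0 by metis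
qed

lemma triangle_lift:
  assumes "f \<in> Hom C X B" "y \<cdot> f = 0"
  obtains g where "g \<in> Hom C X A" "x \<cdot> g = f"
proof -
  obtain Z where Z: "ide C Z = 0" by (rule zero_objectE)
  have "0 \<cdot> 0 = y \<cdot> f" using assms(2) comp_0_left[OF hom_0] by simp
  from ET3_op[OF triangle_ide_left[OF Z] tri assms(1) hom_0 this]
  obtain g where "g \<in> Hom C X A" "f \<cdot> ide C X = x \<cdot> g" by blast
  then show thesis using that comp_ide[OF assms(1)] by simp
qed

lemma triangle_extend:
  assumes "f \<in> Hom C B Y" "f \<cdot> x = 0"
  obtains g where "g \<in> Hom C D Y" "g \<cdot> y = f"
proof -
  obtain Z where Z: "ide C Z = 0" by (rule zero_objectE)
  have "f \<cdot> x = 0 \<cdot> 0" using assms(2) comp_0_left[OF hom_0] by simp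
  from ET3[OF tri triangle_ide_right[OF Z] hom_0 assms(1) this]
  obtain g where "g \<in> Hom C D Y" "g \<cdot> y = ide C Y \<cdot> f" by blast
  then show thesis using that ide_comp[OF assms(1)] by simp
qed

lemma pull_eq_zero_lift:
  assumes "c \<in> Hom C X D" "pull C c \<delta> = 0"
  obtains b where "b \<in> Hom C X B" "y \<cdot> b = c"
proof -
  obtain Z where Z: "ide C Z = 0" by (rule zero_objectE)
  have "push C 0 0 = pull C c \<delta>" using assms(2) push_0[OF hom_0] by simp
  from realize_morphism[OF triangle_ide_right[OF Z] tri hom_0 assms(1) this]
  obtain b where "b \<in> Hom C X B" "y \<cdot> b = c \<cdot> ide C X" by blast
  then show thesis using that comp_ide[OF assms(1)] by simp
qed

lemma push_eq_zero_extend: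
  assumes "a \<in> Hom C A Y" "push C a \<delta> = 0"
  obtains b where "b \<in> Hom C B Y" "b \<cdot> x = a"
proof -
  obtain Z where Z: "ide C Z = 0" by (rule zero_objectE)
  have "push C a \<delta> = pull C 0 0" using assms(2) pull_0[OF hom_0] by simp
  from realize_morphism[OF tri triangle_ide_left[OF Z] assms(1) hom_0 this]
  obtain b where "b \<in> Hom C B Y" "b \<cdot> x = ide C Y \<cdot> a" by blast
  then show thesis using that ide_comp[OF assms(1)] by simp
qed

lemma push_comp_inflation: "b \<in> Hom C B Y \<Longrightarrow> push C (b \<cdot> x) \<delta> = 0"
  using push_comp[OF triangle_in(1)[OF tri] _ triangle_in(3)[OF tri]] triangle_push_zero push_0 by metis

lemma pull_deflation_comp: "b \<in> Hom C X B \<Longrightarrow> pull C (y \<cdot> b) \<delta> = 0"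
  using pull_comp[OF triangle_in(2)[OF tri] _ triangle_in(3)[OF tri]] triangle_pull_zero pull_0 by metis

end

text \<open>Exactness at E(X,A). Realize \<epsilon> by a triangle starting at \<open>A\<close>;
  since \<open>x\<close> kills \<epsilon> it extends to the middle term, and (ET3) completes this
  extension to a morphism of triangles with identity on \<open>A\<close>.\<close>

lemma triangle_ext_lift:
  assumes tri: "triangle C A B D x y \<delta>" and e: "\<epsilon> \<in> Ext C X A" "push C x \<epsilon> = 0"
  obtains c where "c \<in> Hom C X D" "\<epsilon> = pull C c \<delta>"
proof -
  have in': "x \<in> Hom C A B" "y \<in> Hom C B D" using triangle_in[OF tri] by auto
  obtain B' x' y' where t: "triangle C A B' X x' y' \<epsilon>" using triangle_exists[OF e(1)] by blast
  obtain b where b: "b \<in> Hom C B' B" "b \<cdot> x' = x" using push_eq_zero_extend[OF t in'(1) e(2)] by blast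
  have "b \<cdot> x' = x \<cdot> ide C A" using b comp_ide[OF in'(1)] by simp
  from ET3[OF t tri ide_in b(1) this] show thesis using that push_ide[OF e(1)] by auto
qed

lemma triangle_ext_extend:
  assumes tri: "triangle C A B D x y \<delta>" and e: "\<epsilon> \<in> Ext C D Y" "pull C y \<epsilon> = 0"
  obtains a where "a \<in> Hom C A Y" "\<epsilon> = push C a \<delta>"
proof -
  have in': "x \<in> Hom C A B" "y \<in> Hom C B D" using triangle_in[OF tri] by auto
  obtain B' x' y' where t: "triangle C Y B' D x' y' \<epsilon>" using triangle_exists[OF e(1)] by blast
  obtain b where b: "b \<in> Hom C B B'" "y' \<cdot> b = y" using pull_eq_zero_lift[OF t in'(2) e(2)] by blast
  have "ide C D \<cdot> y = y' \<cdot> b" using b ide_comp[OF in'(2)] by simp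
  from ET3_op[OF tri t b(1) ide_in this] show thesis using that pull_ide[OF e(1)] by auto
qed

text \<open>Exactness at E(B,Y). The dual of (ET4), applied to the deflation realizing \<epsilon>
  followed by \<open>y\<close>, yields an extension of \<open>D\<close> by an object
  \<open>E\<close>, which itself extends \<open>A\<close> by \<open>Y\<close> with class
  \<open>pull C x \<epsilon>\<close>. That class is zero, so \<open>Y\<close> is a retract of
  \<open>E\<close>, and the retraction pushes the extension of \<open>D\<close> to the required
  \<zeta>.\<close>

lemma triangle_ext_middle:
  assumes tri: "triangle C A B D x y \<delta>" and e: "\<epsilon> \<in> Ext C B Y" "pull C x \<epsilon> = 0"
  obtains \<zeta> where "\<zeta> \<in> Ext C D Y" "\<epsilon> = pull C y \<zeta>"
proof -
  have in': "x \<in> Hom C A B" "y \<in> Hom C B D" using triangle_in[OF tri] by auto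
  obtain M k m where t: "triangle C Y M B k m \<epsilon>" using triangle_exists[OF e(1)] by blast
  obtain E d j h' \<delta>'' where E: "triangle C E M D h' (y \<cdot> m) \<delta>''" "triangle C Y E A j d (pull C x \<epsilon>)"
    "pull C y \<delta>'' = push C j \<epsilon>"
    using ET4_op[OF tri t] by blast
  obtain s r where "is_biproduct C Y A E j s r d" using zero_ext_biproduct E(2) e(2) by metis
  then have r: "j \<in> Hom C Y E" "r \<in> Hom C E Y" "r \<cdot> j = ide C Y" by (auto simp: is_biproduct_def)
  have d: "\<delta>'' \<in> Ext C D E" using triangle_in[OF E(1)] by simp
  have "pull C y (push C r \<delta>'') = push C r (push C j \<epsilon>)"
    using push_pull[OF r(2) in'(2) d] E(3) by simp
  also have "\<dots> = \<epsilon>" using push_comp[OF r(1,2) e(1)] r(3) push_ide[OF e(1)] by simp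
  finally show thesis using that push_in[OF r(2) d] by metis
qed

end

section \<open>The opposite category and rotation of triangles\<close>

definition op_cat ::
    "('k, 'o, 'm, 'e, 'z) extri_cat_scheme \<Rightarrow> ('k, 'o, 'm, 'e, 'z) extri_cat_scheme" where
  "op_cat C = C\<lparr>Hom := \<lambda>X Y. Hom C Y X, comp := \<lambda>g f. f \<cdot>\<^bsub>C\<^esub> g,
     Ext := \<lambda>D A. Ext C A D, push := pull C, pull := push C,
     realization := \<lambda>D A \<delta>. {(B, x, y). (B, y, x) \<in> realization C A D \<delta>}\<rparr>"

lemma op_cat_simps [simp]:
  "Hom (op_cat C) X Y = Hom C Y X"
  "g \<cdot>\<^bsub>op_cat C\<^esub> f = f \<cdot>\<^bsub>C\<^esub> g"
  "ide (op_cat C) = ide C" "hscale (op_cat C) = hscale C" "escale (op_cat C) = escale C"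
  "Ext (op_cat C) D A = Ext C A D"
  "push (op_cat C) = pull C" "pull (op_cat C) = push C"
  by (simp_all add: op_cat_def)

lemma realization_op_cat:
  "realization (op_cat C) D A \<delta> = {(B, x, y). (B, y, x) \<in> realization C A D \<delta>}"
  by (simp add: op_cat_def)

lemma triangle_op_cat [simp]: "triangle (op_cat C) A B D x y \<delta> \<longleftrightarrow> triangle C D B A y x \<delta>"
  by (auto simp: triangle_def realization_op_cat)

lemma is_iso_op_cat [simp]: "is_iso (op_cat C) X Y f \<longleftrightarrow> is_iso C Y X f"
  by (auto simp: is_iso_def)

lemma is_biproduct_op_cat [simp]:
  "is_biproduct (op_cat C) X Y S i1 i2 p1 p2 \<longleftrightarrow> is_biproduct C X Y S p1 p2 i1 i2"
  by (auto simp: is_biproduct_def)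

lemma projective_obj_op_cat [simp]: "projective_obj (op_cat C) = injective_obj C"
  by (auto simp: fun_eq_iff projective_obj_def injective_obj_def deflation_def inflation_def) blast+

lemma projective_mor_op_cat [simp]: "projective_mor (op_cat C) X Y f = injective_mor C Y X f"
  by (auto simp: projective_mor_def injective_mor_def)

lemma enough_projectives_op_cat [simp]: "enough_projectives (op_cat C) = enough_injectives C"
  by (auto simp: enough_projectives_def enough_injectives_def) metis+

lemma is_biproduct_swap:
  "is_biproduct C X Y S i1 i2 p1 p2 \<Longrightarrow> is_biproduct C Y X S i2 i1 p2 p1"
  by (auto simp: is_biproduct_def add.commute)


text \<open>Reversing arrows reverses the comparison isomorphism, hence the passage to its inverse.
  The opposite inclusion is this one for the opposite category.\<close>

lemma seq_class_op_cat_subset: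
  assumes "linear_category C" "x \<in> Hom C B A" "y \<in> Hom C D B"
    and "(B', x', y') \<in> seq_class (op_cat C) A D (B, x, y)"
  shows "(B', y', x') \<in> seq_class C D A (B, y, x)"
proof -
  interpret linear_category C by fact
  obtain b where b: "x' \<in> Hom C B' A" "y' \<in> Hom C D B'" "is_iso C B' B b"
     "x \<cdot>\<^bsub>C\<^esub> b = x'" "b \<cdot>\<^bsub>C\<^esub> y' = y"
    using assms(4) by (auto simp: seq_class_def)
  obtain c where c: "is_iso C B B' c" "b \<in> Hom C B' B" "c \<in> Hom C B B'"
    "c \<cdot>\<^bsub>C\<^esub> b = ide C B'" "b \<cdot>\<^bsub>C\<^esub> c = ide C B"
    using is_iso_inverseE[OF b(3)] by metis
  have "c \<cdot>\<^bsub>C\<^esub> y = y'" using comp_assoc[OF b(2) c(2,3)] b(5) c(4) ide_comp[OF b(2)] by simp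
  moreover have "x' \<cdot>\<^bsub>C\<^esub> c = x" using comp_assoc[OF c(3,2) assms(2)] b(4) c(5) comp_ide[OF assms(2)] by simp
  ultimately show ?thesis using b(1,2) c(1) by (auto simp: seq_class_def)
qed

lemma linear_category_op_cat: "linear_category C \<Longrightarrow> linear_category (op_cat C)"
proof -
  assume "linear_category C"
  then interpret linear_category C .
  show ?thesis
    by unfold_locales
      (auto simp: Hom_subspace ide_in comp_in comp_ide ide_comp comp_assoc comp_add_left comp_add_right
       comp_scale_left comp_scale_right hom.scale_right_distrib hom.scale_left_distrib)
qed

lemma op_cat_op_cat [simp]: "op_cat (op_cat C) = C"
  by (simp add: op_cat_def)

lemma seq_class_op_cat:
  assumes "linear_category C" "x \<in> Hom C B A" "y \<in> Hom C D B"
  shows "seq_class (op_cat C) A D (B, x, y) = {(B', x', y'). (B', y', x') \<in> seq_class C D A (B, y, x)}"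
proof -
  have "(B', x', y') \<in> seq_class (op_cat C) A D (B, x, y)"
    if "(B', y', x') \<in> seq_class C D A (B, y, x)" for B' x' y'
    using seq_class_op_cat_subset[OF linear_category_op_cat[OF assms(1)], of y B D x A B' y' x'] assms that
    by simp
  then show ?thesis using seq_class_op_cat_subset[OF assms] by blast
qed

text \<open>The axioms are self-dual: (ET3) and (ET4) change places with their duals, and (ET2) is
  symmetric once the two summands of a split sequence are swapped. Results on projectives thereby
  cover injectives.\<close>

lemma (in extriangulated_category) extriangulated_category_op_cat:
  "extriangulated_category (op_cat C)"
proof -
  have lin: "linear_category C" by unfold_locales
  interpret op: linear_category "op_cat C" by (rule linear_category_op_cat[OF lin])
  show ?thesis
  proof unfold_locales
    show "\<exists>Z. ide (op_cat C) Z = 0" using zero_object by simp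
  next
    fix X Y
    show "\<exists>S i1 i2 p1 p2. is_biproduct (op_cat C) X Y S i1 i2 p1 p2" using biproducts[of X Y] by simp blast
  next
    fix D A \<delta> assume "\<delta> \<in> Ext (op_cat C) D A"
    then have "\<delta> \<in> Ext C A D" by simp
    from realization_class[OF this] obtain B x y where "x \<in> Hom C D B" "y \<in> Hom C B A"
      "realization C A D \<delta> = seq_class C D A (B, x, y)" by blast
    then have "y \<in> Hom (op_cat C) A B \<and> x \<in> Hom (op_cat C) B D \<and>
          realization (op_cat C) D A \<delta> = seq_class (op_cat C) A D (B, y, x)"
      by (simp add: realization_op_cat seq_class_op_cat[OF lin])
    then show "\<exists>B x y. x \<in> Hom (op_cat C) A B \<and> y \<in> Hom (op_cat C) B D \<and>
          realization (op_cat C) D A \<delta> = seq_class (op_cat C) A D (B, x, y)"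
      by blast
  next
    fix A B D x y \<delta> A' B' D' x' y' \<delta>' a c
    assume "triangle (op_cat C) A B D x y \<delta>" "triangle (op_cat C) A' B' D' x' y' \<delta>'"
      "a \<in> Hom (op_cat C) A A'" "c \<in> Hom (op_cat C) D D'" "push (op_cat C) a \<delta> = pull (op_cat C) c \<delta>'"
    then have "\<exists>b\<in>Hom C B' B. b \<cdot> y' = y \<cdot> c \<and> x \<cdot> b = a \<cdot> x'"
      by (intro realize_morphism[of D' B' A' y' x' \<delta>' D B A y x \<delta>]) auto
    then show "\<exists>b\<in>Hom (op_cat C) B B'.
          b \<cdot>\<^bsub>op_cat C\<^esub> x = x' \<cdot>\<^bsub>op_cat C\<^esub> a \<and> y' \<cdot>\<^bsub>op_cat C\<^esub> b = c \<cdot>\<^bsub>op_cat C\<^esub> y"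
      by auto
  next
    fix A D S i1 i2 p1 p2 assume b: "is_biproduct (op_cat C) A D S i1 i2 p1 p2"
    then have "is_biproduct C D A S p2 p1 i2 i1" using is_biproduct_swap by fastforce
    from realization_zero[OF this] show "realization (op_cat C) D A 0 = seq_class (op_cat C) A D (S, i1, p2)"
      using b by (subst seq_class_op_cat[OF lin]) (auto simp: realization_op_cat is_biproduct_def)
  next
    fix A B D x y \<delta> A' B' D' x' y' \<delta>' SA iA iA' pA pA' SB iB iB' pB pB' SD iD iD' pD pD'
    assume t: "triangle (op_cat C) A B D x y \<delta>" "triangle (op_cat C) A' B' D' x' y' \<delta>'"
      and bA: "is_biproduct (op_cat C) A A' SA iA iA' pA pA'"
      and bB: "is_biproduct (op_cat C) B B' SB iB iB' pB pB'"
      and bD: "is_biproduct (op_cat C) D D' SD iD iD' pD pD'"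
    have t': "triangle C D B A y x \<delta>" "triangle C D' B' A' y' x' \<delta>'" using t by simp_all
    have i: "pA \<in> Hom C A SA" "pA' \<in> Hom C A' SA" "iA \<in> Hom C SA A" "iA' \<in> Hom C SA A'"
      "pB \<in> Hom C B SB" "pB' \<in> Hom C B' SB" "iB \<in> Hom C SB B" "iB' \<in> Hom C SB B'"
      "pD \<in> Hom C D SD" "pD' \<in> Hom C D' SD" "iD \<in> Hom C SD D" "iD' \<in> Hom C SD D'"
      "x \<in> Hom C B A" "y \<in> Hom C D B" "x' \<in> Hom C B' A'" "y' \<in> Hom C D' B'"
      "\<delta> \<in> Ext C A D" "\<delta>' \<in> Ext C A' D'"
      using bA bB bD triangle_in[OF t'(1)] triangle_in[OF t'(2)] by (auto simp: is_biproduct_def)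
    \<comment> \<open>Triple composites bracketed to the left become bracketed to the right in the
      opposite category.\<close>
    have c: "pA \<cdot> (x \<cdot> iB) = (pA \<cdot> x) \<cdot> iB" "pA' \<cdot> (x' \<cdot> iB') = (pA' \<cdot> x') \<cdot> iB'"
      "pB \<cdot> (y \<cdot> iD) = (pB \<cdot> y) \<cdot> iD" "pB' \<cdot> (y' \<cdot> iD') = (pB' \<cdot> y') \<cdot> iD'"
      using comp_assoc i by metis+
    have "realization C SA SD (push C pD (pull C iA \<delta>) + push C pD' (pull C iA' \<delta>')) =
      seq_class C SD SA (SB, pB \<cdot> y \<cdot> iD + pB' \<cdot> y' \<cdot> iD', pA \<cdot> x \<cdot> iB + pA' \<cdot> x' \<cdot> iB')"
      by (rule realization_sum[OF t']) (use bA bB bD in auto)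
    moreover have "push C pD (pull C iA \<delta>) = pull C iA (push C pD \<delta>)"
      "push C pD' (pull C iA' \<delta>') = pull C iA' (push C pD' \<delta>')" using push_pull i by metis+
    moreover have "pB \<cdot> y \<cdot> iD + pB' \<cdot> y' \<cdot> iD' \<in> Hom C SD SB" "pA \<cdot> x \<cdot> iB + pA' \<cdot> x' \<cdot> iB' \<in> Hom C SB SA"
      using i comp_in hom_add by metis+
    ultimately show "realization (op_cat C) SD SA
         (push (op_cat C) iA (pull (op_cat C) pD \<delta>) + push (op_cat C) iA' (pull (op_cat C) pD' \<delta>')) =
       seq_class (op_cat C) SA SD
        (SB, iB \<cdot>\<^bsub>op_cat C\<^esub> x \<cdot>\<^bsub>op_cat C\<^esub> pA + iB' \<cdot>\<^bsub>op_cat C\<^esub> x' \<cdot>\<^bsub>op_cat C\<^esub> pA',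
         iD \<cdot>\<^bsub>op_cat C\<^esub> y \<cdot>\<^bsub>op_cat C\<^esub> pB + iD' \<cdot>\<^bsub>op_cat C\<^esub> y' \<cdot>\<^bsub>op_cat C\<^esub> pB')"
      by (simp add: seq_class_op_cat[OF lin] realization_op_cat c)
  next
    fix A B D x y \<delta> A' B' D' x' y' \<delta>' a b
    assume "triangle (op_cat C) A B D x y \<delta>" "triangle (op_cat C) A' B' D' x' y' \<delta>'"
      "a \<in> Hom (op_cat C) A A'" "b \<in> Hom (op_cat C) B B'" "b \<cdot>\<^bsub>op_cat C\<^esub> x = x' \<cdot>\<^bsub>op_cat C\<^esub> a"
    then have "\<exists>c\<in>Hom C D' D. b \<cdot> y' = y \<cdot> c \<and> push C c \<delta>' = pull C a \<delta>"
      by (intro ET3_op[of D' B' A' y' x' \<delta>' D B A y x \<delta>]) auto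
    then show "\<exists>c\<in>Hom (op_cat C) D D'.
          c \<cdot>\<^bsub>op_cat C\<^esub> y = y' \<cdot>\<^bsub>op_cat C\<^esub> b \<and> push (op_cat C) a \<delta> = pull (op_cat C) c \<delta>'"
      by auto
  next
    fix A B D x y \<delta> A' B' D' x' y' \<delta>' b c
    assume "triangle (op_cat C) A B D x y \<delta>" "triangle (op_cat C) A' B' D' x' y' \<delta>'"
      "b \<in> Hom (op_cat C) B B'" "c \<in> Hom (op_cat C) D D'" "c \<cdot>\<^bsub>op_cat C\<^esub> y = y' \<cdot>\<^bsub>op_cat C\<^esub> b"
    then have "\<exists>a\<in>Hom C A' A. a \<cdot> x' = x \<cdot> b \<and> push C c \<delta>' = pull C a \<delta>"
      by (intro ET3[of D' B' A' y' x' \<delta>' D B A y x \<delta>]) auto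
    then show "\<exists>a\<in>Hom (op_cat C) A A'.
          b \<cdot>\<^bsub>op_cat C\<^esub> x = x' \<cdot>\<^bsub>op_cat C\<^esub> a \<and> push (op_cat C) a \<delta> = pull (op_cat C) c \<delta>'"
      by simp metis
  next
    fix A B D f f' \<delta> M F g g' \<delta>'
    assume "triangle (op_cat C) A B D f f' \<delta>" "triangle (op_cat C) B M F g g' \<delta>'"
    then show "\<exists>E d e h' \<delta>''. triangle (op_cat C) A M E (g \<cdot>\<^bsub>op_cat C\<^esub> f) h' \<delta>'' \<and>
         triangle (op_cat C) D E F d e (push (op_cat C) f' \<delta>') \<and>
         h' \<cdot>\<^bsub>op_cat C\<^esub> g = d \<cdot>\<^bsub>op_cat C\<^esub> f' \<and> e \<cdot>\<^bsub>op_cat C\<^esub> h' = g' \<and>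
         pull (op_cat C) d \<delta>'' = \<delta> \<and> push (op_cat C) f \<delta>'' = pull (op_cat C) e \<delta>'"
      using ET4_op[of D B A f' f \<delta> F M g' g \<delta>'] by simp
  next
    fix D B A f' f \<delta> F M g' g \<delta>'
    assume "triangle (op_cat C) D B A f' f \<delta>" "triangle (op_cat C) F M B g' g \<delta>'"
    then show "\<exists>E d e h' \<delta>''. triangle (op_cat C) E M A h' (f \<cdot>\<^bsub>op_cat C\<^esub> g) \<delta>'' \<and>
         triangle (op_cat C) F E D e d (pull (op_cat C) f' \<delta>') \<and>
         g \<cdot>\<^bsub>op_cat C\<^esub> h' = f' \<cdot>\<^bsub>op_cat C\<^esub> d \<and> h' \<cdot>\<^bsub>op_cat C\<^esub> e = g' \<and>
         push (op_cat C) d \<delta>'' = \<delta> \<and> pull (op_cat C) f \<delta>'' = push (op_cat C) e \<delta>'"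
      using ET4[of A B D f f' \<delta> M F g g' \<delta>'] by simp
  qed (simp_all add: Ext_subspace push_in pull_in push_ide pull_ide push_comp pull_comp push_pull[symmetric]
        push_add pull_add push_scale pull_scale add_push add_pull scale_push scale_pull
        ext.scale_right_distrib ext.scale_left_distrib)
qed

section \<open>Projective objects and rotation along a resolution\<close>

context extriangulated_category
begin

text \<open>The pullback of the extension is the obstruction to lifting a morphism through a
  deflation. Conversely, lifting the identity of \<open>P\<close> through the deflation realizing
  \<delta> shows that \<delta> vanishes.\<close>

lemma projective_obj_iff: "projective_obj C P \<longleftrightarrow> (\<forall>A. \<forall>\<delta>\<in>Ext C P A. \<delta> = 0)"
proof
  assume P: "projective_obj C P"
  show "\<forall>A. \<forall>\<delta>\<in>Ext C P A. \<delta> = 0"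
  proof (safe, goal_cases)
    case (1 A \<delta>)
    obtain B x y where t: "triangle C A B P x y \<delta>" using triangle_exists[OF 1] by blast
    obtain b where b: "b \<in> Hom C P B" "y \<cdot> b = ide C P"
      using P t ide_in unfolding projective_obj_def deflation_def by blast
    show ?case using pull_deflation_comp[OF t b(1)] b(2) pull_ide[OF 1] by simp
  qed
next
  assume "\<forall>A. \<forall>\<delta>\<in>Ext C P A. \<delta> = 0"
  then show "projective_obj C P"
    unfolding projective_obj_def deflation_def
    by (metis pull_eq_zero_lift pull_in triangle_in(3))
qed

lemma projective_mor_from_projective:
  "projective_obj C P \<Longrightarrow> f \<in> Hom C P X \<Longrightarrow> projective_mor C P X f"
  unfolding projective_mor_def projective_obj_iff using pull_in by blast

lemma projective_obj_iso:
  assumes "is_iso C P Q f" "projective_obj C P"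
  shows "projective_obj C Q"
  unfolding projective_obj_iff
proof (safe, goal_cases)
  case (1 A \<delta>)
  obtain g where g: "f \<in> Hom C P Q" "g \<in> Hom C Q P" "f \<cdot> g = ide C Q"
    using is_iso_inverseE[OF assms(1)] by metis
  have "pull C f \<delta> = 0" using assms(2) pull_in[OF g(1) 1] by (simp add: projective_obj_iff)
  then show ?case using pull_comp[OF g(1,2) 1] g(3) pull_ide[OF 1] pull_0[OF g(2)] by simp
qed

lemma projective_obj_biproduct:
  assumes "is_biproduct C P P' Q i1 i2 p1 p2" "projective_obj C P" "projective_obj C P'"
  shows "projective_obj C Q"
  unfolding projective_obj_iff
proof (safe, goal_cases)
  case (1 A \<delta>)
  have b: "i1 \<in> Hom C P Q" "i2 \<in> Hom C P' Q" "p1 \<in> Hom C Q P" "p2 \<in> Hom C Q P'"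
    "i1 \<cdot> p1 + i2 \<cdot> p2 = ide C Q"
    using assms(1) by (auto simp: is_biproduct_def)
  have "pull C i1 \<delta> = 0" "pull C i2 \<delta> = 0"
    using assms(2,3) pull_in[OF b(1) 1] pull_in[OF b(2) 1] by (auto simp: projective_obj_iff)
  then have "pull C (i1 \<cdot> p1) \<delta> = 0" "pull C (i2 \<cdot> p2) \<delta> = 0"
    using pull_comp[OF b(1,3) 1] pull_comp[OF b(2,4) 1] pull_0[OF b(3)] pull_0[OF b(4)] by auto
  then have "pull C (ide C Q) \<delta> = 0"
    using add_pull[OF comp_in[OF b(3,1)] comp_in[OF b(4,2)] 1] b(5) by simp
  then show ?case using pull_ide[OF 1] by simp
qed

text \<open>The sum of the resolution and the trivial triangle 0 -> P' -> P'. Using \<open>K\<close>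
  itself as biproduct of \<open>K\<close> and a zero object keeps the syzygy literally unchanged, so
  values computed from it can be compared directly.\<close>

lemma triangle_add_projective:
  assumes tri: "triangle C K P A i p \<epsilon>" and P: "projective_obj C P" "projective_obj C P'"
    and M: "is_biproduct C A P' M a s r t"
  obtains Q i' p' \<epsilon>' jP jP' rP rP' where "triangle C K Q M i' p' \<epsilon>'" "projective_obj C Q"
    "is_biproduct C P P' Q jP jP' rP rP'" "i' = jP \<cdot> i"
proof -
  obtain Z where Z: "ide C Z = 0" by (rule zero_objectE)
  obtain Q jP jP' rP rP' where Q: "is_biproduct C P P' Q jP jP' rP rP'" using biproducts by blast
  have in': "i \<in> Hom C K P" "p \<in> Hom C P A" "\<epsilon> \<in> Ext C A K" "jP \<in> Hom C P Q" "jP' \<in> Hom C P' Q"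
    using triangle_in[OF tri] Q by (auto simp: is_biproduct_def)
  have K: "is_biproduct C K Z K (ide C K) 0 (ide C K) 0"
    using Z by (auto simp: is_biproduct_def ide_in hom_0 comp_ide[OF ide_in] comp_0_left[OF hom_0]
       comp_0_right[OF ide_in] comp_0_left[OF ide_in])
  let ?e = "push C (ide C K) (pull C r \<epsilon>) + push C 0 (pull C t 0)"
  have r: "r \<in> Hom C M A" "t \<in> Hom C M P'" using M by (auto simp: is_biproduct_def)
  have e: "?e \<in> Ext C M K" using push_in[OF ide_in pull_in[OF r(1) in'(3)]] push_in[OF hom_0 pull_in[OF r(2) ext_0]]
    ext_add by blast
  let ?x = "jP \<cdot> i \<cdot> ide C K + jP' \<cdot> 0 \<cdot> 0" and ?y = "a \<cdot> p \<cdot> rP + s \<cdot> ide C P' \<cdot> rP'"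
  have x: "?x = jP \<cdot> i"
    using comp_0_right[OF in'(5)] comp_0_left[OF hom_0] comp_ide[OF comp_in[OF in'(1,4)]] by simp
  have y: "?y \<in> Hom C Q M" using M Q in'(2) ide_in comp_in unfolding is_biproduct_def by (metis hom_add)
  have x': "?x \<in> Hom C K Q" unfolding x using comp_in[OF in'(1,4)] .
  have "realization C M K ?e = seq_class C K M (Q, ?x, ?y)"
    by (rule realization_sum[OF tri triangle_ide_right[OF Z] K Q M])
  moreover have "(Q, ?x, ?y) \<in> seq_class C K M (Q, ?x, ?y)"
    using x' y is_iso_ide[of Q] ide_comp[OF x'] comp_ide[OF y] by (auto simp: seq_class_def)
  ultimately have "triangle C K Q M ?x ?y ?e" using e by (simp add: triangle_def)
  then show thesis using that[OF _ projective_obj_biproduct[OF Q P] Q x] by blast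
qed

text \<open>The middle term of the rotated triangle is the pullback of \<open>y\<close> and \<open>p\<close>; it splits off \<open>A\<close>
  because \<open>P\<close> is projective.\<close>

lemma rotate_triangle:
  assumes tri: "triangle C A B D x y \<delta>" and res: "triangle C K P D i p \<epsilon>" and P: "projective_obj C P"
  obtains M k m a s rA rP where "triangle C K M B k m (pull C y \<epsilon>)"
    "is_biproduct C A P M a s rA rP" "m \<cdot> a = x" "rP \<cdot> k = i"
proof -
  have in': "x \<in> Hom C A B" "y \<in> Hom C B D" "\<delta> \<in> Ext C D A" "i \<in> Hom C K P" "p \<in> Hom C P D"
    "\<epsilon> \<in> Ext C D K"
    using triangle_in[OF tri] triangle_in[OF res] by auto
  define \<delta>' where "\<delta>' = pull C y \<epsilon>"
  have d': "\<delta>' \<in> Ext C B K" unfolding \<delta>'_def using pull_in in' by blast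
  obtain M k m where M: "triangle C K M B k m \<delta>'" using triangle_exists[OF d'] by blast
  have km: "k \<in> Hom C K M" "m \<in> Hom C M B" using triangle_in[OF M] by auto
  \<comment> \<open>\<open>E\<close> is the cocone of the composite deflation M -> B -> D. It
    extends \<open>A\<close> by \<open>K\<close> with class the pullback of \<epsilon> along
    \<open>y \<cdot> x = 0\<close>, so it splits.\<close>
  obtain E d j h \<delta>'' where E: "triangle C E M D h (y \<cdot> m) \<delta>''" "triangle C K E A j d (pull C x \<delta>')"
    "m \<cdot> h = x \<cdot> d" "h \<cdot> j = k" "push C d \<delta>'' = \<delta>" "pull C y \<delta>'' = push C j \<delta>'"
    using ET4_op[OF tri M] by blast
  have inE: "h \<in> Hom C E M" "\<delta>'' \<in> Ext C D E" "j \<in> Hom C K E" "d \<in> Hom C E A"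
    using triangle_in[OF E(1)] triangle_in[OF E(2)] by auto
  have "pull C x \<delta>' = 0" unfolding \<delta>'_def
    using pull_comp[OF in'(2,1,6)] triangle_comp_zero[OF tri] pull_zero_map[OF in'(6)] by simp
  then obtain s0 r0 where S0: "is_biproduct C K A E j s0 r0 d" using E(2) zero_ext_biproduct by metis
  have S: "s0 \<in> Hom C A E" "r0 \<in> Hom C E K" "r0 \<cdot> j = ide C K" "d \<cdot> s0 = ide C A" "r0 \<cdot> s0 = 0"
    "d \<cdot> j = 0" "j \<cdot> r0 + s0 \<cdot> d = ide C E"
    using S0 by (auto simp: is_biproduct_def)
  have e': "push C r0 \<delta>'' \<in> Ext C D K" using push_in S inE by blast
  have "pull C y (push C r0 \<delta>'') = push C r0 (pull C y \<delta>'')"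
    using push_pull[OF S(2) in'(2) inE(2)] by simp
  also have "\<dots> = \<delta>'" using E(6) push_comp[OF inE(3) S(2) d'] S(3) push_ide[OF d'] by simp
  finally have "pull C y (\<epsilon> - push C r0 \<delta>'') = 0"
    using pull_diff[OF in'(2,6) e'] by (simp add: \<delta>'_def)
  then obtain c where c: "c \<in> Hom C A K" "\<epsilon> - push C r0 \<delta>'' = push C c \<delta>"
    using triangle_ext_extend[OF tri ext_diff[OF in'(6) e']] by blast
  \<comment> \<open>An arbitrary splitting pushes \<delta>'' to an extension that agrees with
    \<epsilon> only after pullback along \<open>y\<close>. The error is
    \<open>push C c \<delta>\<close>; adding \<open>c \<cdot> d\<close> to the retraction removes
    it, and the section is changed so that \<open>r \<cdot> s\<close> stays zero.\<close>
  define r where "r = r0 + c \<cdot> d"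
  define s where "s = s0 - j \<cdot> c"
  have cd: "c \<cdot> d \<in> Hom C E K" and jc: "j \<cdot> c \<in> Hom C A E" using comp_in c inE by blast+
  have r: "r \<in> Hom C E K" and s: "s \<in> Hom C A E"
    unfolding r_def s_def using hom_add hom_diff S cd jc by blast+
  have e: "push C r \<delta>'' = \<epsilon>"
    unfolding r_def using add_push[OF S(2) cd inE(2)] push_comp[OF inE(4) c(1) inE(2)] E(5) c(2)
    by (simp add: algebra_simps)
  have ds: "d \<cdot> s = ide C A"
    unfolding s_def using comp_diff_right[OF S(1) jc inE(4)] comp_assoc[OF c(1) inE(3,4)] S(4,6)
      comp_0_left[OF c(1)] by simp
  have dj: "r \<cdot> j = ide C K"
    unfolding r_def using comp_add_left[OF inE(3) S(2) cd] comp_assoc[OF inE(3,4) c(1)] S(3,6)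
      comp_0_right[OF c(1)] by simp
  have rs: "r \<cdot> s = 0"
  proof -
    have "r \<cdot> s = r \<cdot> s0 - (r \<cdot> j) \<cdot> c"
      unfolding s_def using comp_diff_right[OF S(1) jc r] comp_assoc[OF c(1) inE(3) r] by simp
    also have "r \<cdot> s0 = c"
      unfolding r_def using comp_add_left[OF S(1,2) cd] comp_assoc[OF S(1) inE(4) c(1)] S(4,5) comp_ide[OF c(1)]
      by simp
    finally show ?thesis using dj ide_comp[OF c(1)] by simp
  qed
  have js: "s \<cdot> d + j \<cdot> r = ide C E"
  proof -
    have "s \<cdot> d = s0 \<cdot> d - j \<cdot> (c \<cdot> d)"
      unfolding s_def using comp_diff_left[OF inE(4) S(1) jc] comp_assoc[OF inE(4) c(1) inE(3)] by simp
    moreover have "j \<cdot> r = j \<cdot> r0 + j \<cdot> (c \<cdot> d)"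
      unfolding r_def using comp_add_right[OF S(2) cd inE(3)] .
    ultimately show ?thesis using S(7) by (simp add: algebra_simps)
  qed
  have bip: "is_biproduct C A K E s j d r"
    unfolding is_biproduct_def using s r inE ds dj rs js S(6) by simp
  \<comment> \<open>(ET4) for the split inflation A -> E followed by E -> M: the cone of A -> M
    extends \<open>D\<close> by \<open>K\<close> with class \<epsilon>, hence is isomorphic to
    \<open>P\<close>. Being projective, it forces A -> M to split.\<close>
  obtain E' d1 e1 h1 \<delta>3 where E': "triangle C A M E' (h \<cdot> s) h1 \<delta>3" "triangle C K E' D d1 e1 (push C r \<delta>'')"
    "h1 \<cdot> h = d1 \<cdot> r"
    using ET4[OF biproduct_triangle[OF bip] E(1)] by blast
  have inE': "h \<cdot> s \<in> Hom C A M" "h1 \<in> Hom C M E'" "d1 \<in> Hom C K E'" "\<delta>3 \<in> Ext C E' A"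
    using triangle_in[OF E'(1)] triangle_in[OF E'(2)] by auto
  obtain b where b: "is_iso C P E' b" "b \<cdot> i = d1" using triangle_iso[OF res E'(2)[unfolded e]] by blast
  obtain b' where b': "b \<in> Hom C P E'" "b' \<in> Hom C E' P" "b' \<cdot> b = ide C P" "b \<cdot> b' = ide C E'"
    using is_iso_inverseE[OF b(1)] by metis
  have "\<delta>3 = 0" using projective_obj_iso[OF b(1) P] inE'(4) by (simp add: projective_obj_iff)
  then obtain s1 rA where B1: "is_biproduct C A E' M (h \<cdot> s) s1 rA h1" using zero_ext_biproduct E'(1) by metis
  then have i1: "s1 \<in> Hom C E' M" "rA \<in> Hom C M A" "h1 \<cdot> s1 = ide C E'" "h1 \<cdot> (h \<cdot> s) = 0"
    "rA \<cdot> s1 = 0" "rA \<cdot> (h \<cdot> s) = ide C A" "(h \<cdot> s) \<cdot> rA + s1 \<cdot> h1 = ide C M"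
    by (auto simp: is_biproduct_def)
  have 1: "(b' \<cdot> h1) \<cdot> (s1 \<cdot> b) = ide C P"
    using comp_assoc[OF comp_in[OF b'(1) i1(1)] inE'(2) b'(2)] comp_assoc[OF b'(1) i1(1) inE'(2)] i1(3)
      ide_comp[OF b'(1)] b'(3) by simp
  have 2: "rA \<cdot> (s1 \<cdot> b) = 0"
    using comp_assoc[OF b'(1) i1(1,2)] i1(5) comp_0_left[OF b'(1)] by simp
  have 3: "(b' \<cdot> h1) \<cdot> (h \<cdot> s) = 0"
    using comp_assoc[OF inE'(1,2) b'(2)] i1(4) comp_0_right[OF b'(2)] by simp
  have 4: "(s1 \<cdot> b) \<cdot> (b' \<cdot> h1) = s1 \<cdot> h1"
    using comp_assoc[OF comp_in[OF inE'(2) b'(2)] b'(1) i1(1)] comp_assoc[OF inE'(2) b'(2,1)] b'(4)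
      ide_comp[OF inE'(2)] by simp
  have "is_biproduct C A P M (h \<cdot> s) (s1 \<cdot> b) rA (b' \<cdot> h1)"
    unfolding is_biproduct_def using 1 2 3 4 i1 inE' comp_in b' by simp
  moreover have "m \<cdot> (h \<cdot> s) = x"
    using comp_assoc[OF s inE(1) km(2)] E(3) comp_assoc[OF s inE(4) in'(1)] ds comp_ide[OF in'(1)] by simp
  moreover have "(b' \<cdot> h1) \<cdot> k = i"
  proof -
    have "h1 \<cdot> k = d1"
      using E(4) comp_assoc[OF inE(3,1) inE'(2)] E'(3) comp_assoc[OF inE(3) r inE'(3)] dj
        comp_ide[OF inE'(3)] by simp
    then show ?thesis
      using comp_assoc[OF km(1) inE'(2) b'(2)] b(2) comp_assoc[OF in'(4) b'(1,2)] b'(3) ide_comp[OF in'(4)]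
      by simp
  qed
  ultimately show thesis using that M unfolding \<delta>'_def by blast
qed

end

section \<open>Iterated satellites\<close>

text \<open>The recursion defining \<open>neg_I\<close>, with the chosen resolutions as parameters:
  \<open>neg_II\<close> then becomes the same construction in the opposite category.\<close>

definition res_mor ::
    "('k, 'o, 'm, 'e, 'z) extri_cat_scheme \<Rightarrow> ('o \<Rightarrow> 'o) \<Rightarrow> ('o \<Rightarrow> 'e) \<Rightarrow> 'o \<Rightarrow> 'o \<Rightarrow> 'm \<Rightarrow> 'm" where
  "res_mor C S E D D' f = (SOME a. a \<in> Hom C (S D) (S D') \<and> push C a (E D) = pull C f (E D'))"

primrec sat_map ::
    "('k, 'o, 'm, 'e, 'z) extri_cat_scheme \<Rightarrow> ('o \<Rightarrow> 'o) \<Rightarrow> ('o \<Rightarrow> 'e)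
       \<Rightarrow> nat \<Rightarrow> 'o \<Rightarrow> 'o \<Rightarrow> 'm \<Rightarrow> 'm \<Rightarrow> 'm" where
  "sat_map C S E 0 = (\<lambda>D D' f u. f \<cdot>\<^bsub>C\<^esub> u)"
| "sat_map C S E (Suc n) = (\<lambda>D D' f u. sat_map C S E n (S D) (S D') (res_mor C S E D D' f) u)"

primrec sat ::
    "('k, 'o, 'm::zero, 'e, 'z) extri_cat_scheme \<Rightarrow> ('o \<Rightarrow> 'o) \<Rightarrow> ('o \<Rightarrow> 'o) \<Rightarrow> ('o \<Rightarrow> 'm) \<Rightarrow> ('o \<Rightarrow> 'e)
       \<Rightarrow> nat \<Rightarrow> 'o \<Rightarrow> 'o \<Rightarrow> 'm set" where
  "sat C S G I E 0 = (\<lambda>X D. Hom C X D)"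
| "sat C S G I E (Suc n) =
     (\<lambda>X D. {u \<in> sat C S G I E n X (S D). sat_map C S E n (S D) (G D) (I D) u = 0})"

text \<open>The class of functors carried by the induction on the degree: additive functors with
  values in subspaces of the ambient Hom space. Passing from \<open>F\<close> to the kernel of F(K)
  -> F(P), for chosen resolutions, stays in this class.\<close>

locale subspace_functor = extriangulated_category C
  for C :: "('k::field, 'o, 'm::ab_group_add, 'e::ab_group_add, 'z) extri_cat_scheme" (structure) +
  fixes F :: "'o \<Rightarrow> 'm set" and T :: "'o \<Rightarrow> 'o \<Rightarrow> 'm \<Rightarrow> 'm \<Rightarrow> 'm"
  assumes F_subspace: "hom.subspace (F D)"
    and T_in: "f \<in> Hom C D D' \<Longrightarrow> u \<in> F D \<Longrightarrow> T D D' f u \<in> F D'"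
    and T_add: "f \<in> Hom C D D' \<Longrightarrow> u \<in> F D \<Longrightarrow> v \<in> F D \<Longrightarrow> T D D' f (u + v) = T D D' f u + T D D' f v"
    and T_scale: "f \<in> Hom C D D' \<Longrightarrow> u \<in> F D \<Longrightarrow> T D D' f (hscale C c u) = hscale C c (T D D' f u)"
    and T_ide: "u \<in> F D \<Longrightarrow> T D D (ide C D) u = u"
    and T_comp: "f \<in> Hom C D D' \<Longrightarrow> g \<in> Hom C D' D'' \<Longrightarrow> u \<in> F D \<Longrightarrow>
       T D D'' (g \<cdot> f) u = T D' D'' g (T D D' f u)"
    and T_add_map: "f \<in> Hom C D D' \<Longrightarrow> f' \<in> Hom C D D' \<Longrightarrow> u \<in> F D \<Longrightarrow>
       T D D' (f + f') u = T D D' f u + T D D' f' u"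
begin

lemma F_0: "0 \<in> F D"
  using F_subspace hom.subspace_0 by blast

lemma T_0: "f \<in> Hom C D D' \<Longrightarrow> T D D' f 0 = 0"
  using T_add[OF _ F_0 F_0] by fastforce

lemma T_zero_map: "u \<in> F D \<Longrightarrow> T D D' 0 u = 0"
  using T_add_map[OF hom_0 hom_0] by fastforce

lemma T_diff_map:
  assumes "f \<in> Hom C D D'" "f' \<in> Hom C D D'" "u \<in> F D"
  shows "T D D' (f - f') u = T D D' f u - T D D' f' u"
  using T_add_map[OF hom_diff[OF assms(1,2)] assms(2,3)] by (simp add: algebra_simps)

text \<open>Two morphisms with the same effect on the extension differ by one that factors through the
  inflation.\<close>

lemma T_kernel_unique:
  assumes "triangle C K P D i p \<epsilon>" "a \<in> Hom C K K'" "a' \<in> Hom C K K'" "push C a \<epsilon> = push C a' \<epsilon>"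
    and u: "u \<in> F K" "T K P i u = 0"
  shows "T K K' a u = T K K' a' u"
proof -
  have i: "i \<in> Hom C K P" "\<epsilon> \<in> Ext C D K" using triangle_in[OF assms(1)] by auto
  have "push C (a - a') \<epsilon> = 0" using diff_push[OF assms(2,3) i(2)] assms(4) by simp
  then obtain b where b: "b \<in> Hom C P K'" "b \<cdot> i = a - a'"
    using push_eq_zero_extend[OF assms(1) hom_diff[OF assms(2,3)]] by blast
  have "T K K' a u - T K K' a' u = T K K' (b \<cdot> i) u" using T_diff_map[OF assms(2,3) u(1)] b(2) by simp
  also have "\<dots> = 0" using T_comp[OF i(1) b(1) u(1)] u(2) T_0[OF b(1)] by simp
  finally show ?thesis by simp
qed

lemma T_kernel_in:
  assumes t: "triangle C K P D i p \<epsilon>" "triangle C K' P' D' i' p' \<epsilon>'"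
    and a: "a \<in> Hom C K K'" "f \<in> Hom C D D'" "push C a \<epsilon> = pull C f \<epsilon>'"
    and u: "u \<in> F K" "T K P i u = 0"
  shows "T K' P' i' (T K K' a u) = 0"
proof -
  have i: "i \<in> Hom C K P" "i' \<in> Hom C K' P'" using triangle_in t by blast+
  obtain b where b: "b \<in> Hom C P P'" "b \<cdot> i = i' \<cdot> a"
    using realize_morphism[OF t a] by blast
  have "T K' P' i' (T K K' a u) = T P P' b (T K P i u)"
    using T_comp[OF a(1) i(2) u(1)] T_comp[OF i(1) b(1) u(1)] b(2) by simp
  then show ?thesis using u(2) T_0[OF b(1)] by simp
qed

end

context extriangulated_category
begin

lemma projective_resolution_morphism:
  assumes "triangle C K P D i p \<epsilon>" "projective_mor C P D p" "triangle C K' P' D' i' p' \<epsilon>'"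
    and f: "f \<in> Hom C D D'"
  obtains a where "a \<in> Hom C K K'" "push C a \<epsilon> = pull C f \<epsilon>'"
proof -
  have e: "\<epsilon>' \<in> Ext C D' K'" using triangle_in[OF assms(3)] by simp
  have "pull C p (pull C f \<epsilon>') = 0" using assms(2) pull_in[OF f e] by (simp add: projective_mor_def)
  then show thesis using that triangle_ext_extend[OF assms(1) pull_in[OF f e]] by metis
qed

end

text \<open>Lifts of the identity in both directions are mutually inverse on the kernels, because
  their composites fix the extension, and the kernel sees a morphism only through its effect on the
  extension.\<close>

lemma (in subspace_functor) card_kernel_independent:
  assumes t: "triangle C K P D i p \<epsilon>" "triangle C K' P' D i' p' \<epsilon>'"
    and p: "projective_mor C P D p" "projective_mor C P' D p'"
  shows "card {u \<in> F K. T K P i u = 0} = card {u \<in> F K'. T K' P' i' u = 0}"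
proof -
  have e: "\<epsilon> \<in> Ext C D K" "\<epsilon>' \<in> Ext C D K'" using triangle_in t by blast+
  obtain a where a: "a \<in> Hom C K K'" "push C a \<epsilon> = pull C (ide C D) \<epsilon>'"
    using projective_resolution_morphism[OF t(1) p(1) t(2) ide_in] by blast
  obtain b where b: "b \<in> Hom C K' K" "push C b \<epsilon>' = pull C (ide C D) \<epsilon>"
    using projective_resolution_morphism[OF t(2) p(2) t(1) ide_in] by blast
  have *: "T K' K b' (T K K' a' u) = u"
    if t: "triangle C K P D i p \<epsilon>" and e: "\<epsilon>' \<in> Ext C D K'" and ab: "a' \<in> Hom C K K'" "b' \<in> Hom C K' K"
      "push C a' \<epsilon> = pull C (ide C D) \<epsilon>'" "push C b' \<epsilon>' = pull C (ide C D) \<epsilon>"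
      and u: "u \<in> F K" "T K P i u = 0"
    for K K' P i p \<epsilon> \<epsilon>' a' b' u
  proof -
    have "\<epsilon> \<in> Ext C D K" using triangle_in t by blast
    then have "push C (b' \<cdot> a') \<epsilon> = push C (ide C K) \<epsilon>"
      using push_comp[OF ab(1,2)] ab(3,4) pull_ide[OF e] by (simp add: pull_ide push_ide)
    then show ?thesis
      using T_kernel_unique[OF t comp_in[OF ab(1,2)] ide_in _ u] T_comp[OF ab(1,2) u(1)] T_ide[OF u(1)] by simp
  qed
  have "bij_betw (T K K' a) {u \<in> F K. T K P i u = 0} {u \<in> F K'. T K' P' i' u = 0}"
    by (rule bij_betw_byWitness[where f' = "T K' K b"])
      (use *[OF t(1) e(2) a(1) b(1) a(2) b(2)] *[OF t(2) e(1) b(1) a(1) b(2) a(2)] T_in[OF a(1)] T_in[OF b(1)]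
       T_kernel_in[OF t a(1) ide_in a(2)] T_kernel_in[OF t(2,1) b(1) ide_in b(2)] in auto)
  then show ?thesis by (rule bij_betw_same_card)
qed

locale satellites = extriangulated_category C
  for C :: "('k::field, 'o, 'm::ab_group_add, 'e::ab_group_add, 'z) extri_cat_scheme" (structure) +
  fixes S G :: "'o \<Rightarrow> 'o" and I p :: "'o \<Rightarrow> 'm" and E :: "'o \<Rightarrow> 'e"
  assumes resolution: "triangle C (S D) (G D) D (I D) (p D) (E D)"
    and resolution_projective: "projective_mor C (G D) D (p D)"
begin

lemma E_in: "E D \<in> Ext C D (S D)"
  using triangle_in resolution by blast

lemma I_in: "I D \<in> Hom C (S D) (G D)"
  using triangle_in resolution by blast

lemma res_mor:
  assumes "f \<in> Hom C D D'"
  shows "res_mor C S E D D' f \<in> Hom C (S D) (S D')"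
    "push C (res_mor C S E D D' f) (E D) = pull C f (E D')"
proof -
  have "\<exists>a. a \<in> Hom C (S D) (S D') \<and> push C a (E D) = pull C f (E D')"
    using projective_resolution_morphism[OF resolution resolution_projective resolution assms] by metis
  from someI_ex[OF this] show "res_mor C S E D D' f \<in> Hom C (S D) (S D')"
    "push C (res_mor C S E D D' f) (E D) = pull C f (E D')" unfolding res_mor_def by auto
qed

text \<open>The lifts picked by \<open>SOME\<close> respect composition and sums only up to
  morphisms through the inflation. The kernel does not see that difference, so the functor laws hold
  strictly there.\<close>

lemma subspace_functor_satellite:
  assumes "subspace_functor C F T"
  shows "subspace_functor C (\<lambda>D. {u \<in> F (S D). T (S D) (G D) (I D) u = 0})
    (\<lambda>D D' f. T (S D) (S D') (res_mor C S E D D' f))"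
proof -
  interpret subspace_functor C F T by fact
  note uniq = T_kernel_unique[OF resolution]
  show ?thesis
  proof unfold_locales
    fix D
    show "hom.subspace {u \<in> F (S D). T (S D) (G D) (I D) u = 0}"
      unfolding hom.subspace_def
      using F_0 F_subspace[of "S D", THEN hom.subspace_add] F_subspace[of "S D", THEN hom.subspace_scale]
      by (auto simp: T_0[OF I_in] T_add[OF I_in] T_scale[OF I_in])
  next
    fix f D D' u assume f: "f \<in> Hom C D D'" and u: "u \<in> {u \<in> F (S D). T (S D) (G D) (I D) u = 0}"
    show "T (S D) (S D') (res_mor C S E D D' f) u \<in> {u \<in> F (S D'). T (S D') (G D') (I D') u = 0}"
      using T_in[OF res_mor(1)[OF f]] T_kernel_in[OF resolution resolution res_mor(1)[OF f] f res_mor(2)[OF f]] u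
      by auto
  next
    fix D u assume u: "u \<in> {u \<in> F (S D). T (S D) (G D) (I D) u = 0}"
    have "T (S D) (S D) (res_mor C S E D D (ide C D)) u = T (S D) (S D) (ide C (S D)) u"
      by (rule uniq) (use u res_mor[OF ide_in] ide_in in \<open>auto simp: pull_ide[OF E_in] push_ide[OF E_in]\<close>)
    then show "T (S D) (S D) (res_mor C S E D D (ide C D)) u = u" using u T_ide by simp
  next
    fix f D D' g D'' u
    assume f: "f \<in> Hom C D D'" and g: "g \<in> Hom C D' D''" and u: "u \<in> {u \<in> F (S D). T (S D) (G D) (I D) u = 0}"
    let ?a = "res_mor C S E D D' f" and ?b = "res_mor C S E D' D'' g"
    note a = res_mor[OF f] and b = res_mor[OF g] and c = res_mor[OF comp_in[OF f g]]
    have "push C (?b \<cdot> ?a) (E D) = pull C f (push C ?b (E D'))"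
      using push_comp[OF a(1) b(1) E_in] a(2) push_pull[OF b(1) f E_in] by simp
    also have "\<dots> = pull C (g \<cdot> f) (E D'')" using b(2) pull_comp[OF g f E_in] by simp
    finally have "T (S D) (S D'') (res_mor C S E D D'' (g \<cdot> f)) u = T (S D) (S D'') (?b \<cdot> ?a) u"
      by (intro uniq[OF c(1) comp_in[OF a(1) b(1)]]) (use u c(2) in auto)
    then show "T (S D) (S D'') (res_mor C S E D D'' (g \<cdot> f)) u = T (S D') (S D'') ?b (T (S D) (S D') ?a u)"
      using T_comp[OF a(1) b(1)] u by simp
  next
    fix f D D' f' u
    assume f: "f \<in> Hom C D D'" and f': "f' \<in> Hom C D D'" and u: "u \<in> {u \<in> F (S D). T (S D) (G D) (I D) u = 0}"
    let ?a = "res_mor C S E D D' f" and ?b = "res_mor C S E D D' f'"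
    note a = res_mor[OF f] and b = res_mor[OF f'] and c = res_mor[OF hom_add[OF f f']]
    have "T (S D) (S D') (res_mor C S E D D' (f + f')) u = T (S D) (S D') (?a + ?b) u"
      by (intro uniq[OF c(1) hom_add[OF a(1) b(1)]])
        (use u a(2) b(2) c(2) in \<open>auto simp: add_push[OF a(1) b(1) E_in] add_pull[OF f f' E_in]\<close>)
    then show "T (S D) (S D') (res_mor C S E D D' (f + f')) u = T (S D) (S D') ?a u + T (S D) (S D') ?b u"
      using T_add_map[OF a(1) b(1)] u by simp
  qed (use res_mor T_add T_scale in auto)
qed

lemma subspace_functor_sat: "subspace_functor C (sat C S G I E n X) (sat_map C S E n)"
proof (induction n)
  case 0
  show ?case
    by unfold_locales
      (auto simp: Hom_subspace ide_comp comp_in comp_add_right comp_scale_right comp_assoc comp_add_left)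
next
  case (Suc n)
  then show ?case using subspace_functor_satellite by simp
qed

text \<open>The chosen resolutions use projective morphisms; this exchanges them for any resolution
  by a projective object, which is what rotation supplies.\<close>

lemma card_sat_Suc:
  assumes "triangle C K P D i q \<epsilon>" "projective_obj C P"
  shows "card (sat C S G I E (Suc n) X D) =
    card {u \<in> sat C S G I E n X K. sat_map C S E n K P i u = 0}"
  using subspace_functor.card_kernel_independent[OF subspace_functor_sat[of n X] resolution assms(1)
      resolution_projective projective_mor_from_projective[OF assms(2)]] triangle_in[OF assms(1)] by simp

text \<open>Resolve \<open>P\<close> by 0 -> P -> P: additive functors vanish on a zero object.
  Independence of the resolution transports only the cardinality, and a subspace with one element is
  zero.\<close>

lemma sat_projective:
  assumes "projective_obj C P"
  shows "sat C S G I E (Suc n) X P = {0}"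
proof -
  obtain Z where Z: "ide C Z = 0" by (rule zero_objectE)
  interpret sub: subspace_functor C "sat C S G I E n X" "sat_map C S E n" by (rule subspace_functor_sat)
  interpret sub': subspace_functor C "sat C S G I E (Suc n) X" "sat_map C S E (Suc n)" by (rule subspace_functor_sat)
  have "u = 0" if "u \<in> sat C S G I E n X Z" for u
    using sub.T_ide[OF that] sub.T_zero_map[OF that, of Z] Z by simp
  then have "{u \<in> sat C S G I E n X Z. sat_map C S E n Z P 0 u = 0} = {0}"
    using sub.F_0 sub.T_0[OF hom_0] by blast
  then have "card (sat C S G I E (Suc n) X P) = 1"
    using card_sat_Suc[OF triangle_ide_right[OF Z] assms, of n X] by simp
  then show ?thesis using sub'.F_0[of P] by (metis card_1_singletonE singletonD)
qed

text \<open>From negative degree 2 on, the kernel is taken of a map into a satellite of a projective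
  object, which is zero. In degree 1 the target is Hom(X,P), and the kernel condition
  remains.\<close>

lemma card_sat_Suc_Suc:
  assumes "triangle C K P D i q \<epsilon>" "projective_obj C P"
  shows "card (sat C S G I E (Suc (Suc n)) X D) = card (sat C S G I E (Suc n) X K)"
proof -
  interpret sub: subspace_functor C "sat C S G I E (Suc n) X" "sat_map C S E (Suc n)" by (rule subspace_functor_sat)
  have i: "i \<in> Hom C K P" using triangle_in[OF assms(1)] by simp
  have "{u \<in> sat C S G I E (Suc n) X K. sat_map C S E (Suc n) K P i u = 0} = sat C S G I E (Suc n) X K"
    using sub.T_in[OF i] sat_projective[OF assms(2)] by blast
  then show ?thesis using card_sat_Suc[OF assms, of "Suc n" X] by simp
qed

lemma card_sat_1:
  assumes "triangle C K P D i q \<epsilon>" "projective_obj C P"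
  shows "card (sat C S G I E (Suc 0) X D) = card {u \<in> Hom C X K. i \<cdot> u = 0}"
  using card_sat_Suc[OF assms, of 0 X] by simp

text \<open>\<open>A\<close> and \<open>M\<close> have resolutions with the same syzygy
  \<open>K\<close>. In degree 1 the two inflations differ by the split monomorphism
  \<open>jP\<close>, so their kernels agree.\<close>

lemma card_sat_add_projective:
  assumes ep: "enough_projectives C" and P: "projective_obj C P'" and M: "is_biproduct C A P' M a s r t"
  shows "card (sat C S G I E (Suc n) X M) = card (sat C S G I E (Suc n) X A)"
proof -
  obtain K P i q \<epsilon> where res: "triangle C K P A i q \<epsilon>" "projective_obj C P"
    using ep unfolding enough_projectives_def by blast
  obtain Q i' q' \<epsilon>' jP jP' rP rP' where Q: "triangle C K Q M i' q' \<epsilon>'" "projective_obj C Q"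
    "is_biproduct C P P' Q jP jP' rP rP'" "i' = jP \<cdot> i"
    using triangle_add_projective[OF res P M] by metis
  show ?thesis
  proof (cases n)
    case 0
    have i: "i \<in> Hom C K P" using triangle_in[OF res(1)] by simp
    have j: "jP \<in> Hom C P Q" "rP \<in> Hom C Q P" "rP \<cdot> jP = ide C P" using Q(3) by (auto simp: is_biproduct_def)
    have "i' \<cdot> u = 0 \<longleftrightarrow> i \<cdot> u = 0" if u: "u \<in> Hom C X K" for u
    proof -
      have 1: "i' \<cdot> u = jP \<cdot> (i \<cdot> u)" unfolding Q(4) by (rule comp_assoc[OF u i j(1)])
      have 2: "i \<cdot> u = rP \<cdot> (jP \<cdot> (i \<cdot> u))"
        using comp_assoc[OF comp_in[OF u i] j(1,2)] j(3) ide_comp[OF comp_in[OF u i]] by simp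
      show ?thesis
      proof
        assume "i' \<cdot> u = 0"
        then show "i \<cdot> u = 0" using 1 2 comp_0_right[OF j(2)] by simp
      next
        assume "i \<cdot> u = 0"
        then show "i' \<cdot> u = 0" using 1 comp_0_right[OF j(1)] by simp
      qed
    qed
    then have "{u \<in> Hom C X K. i' \<cdot> u = 0} = {u \<in> Hom C X K. i \<cdot> u = 0}" by blast
    then show ?thesis using card_sat_1[OF res, of X] card_sat_1[OF Q(1,2), of X] 0 by simp
  next
    case (Suc m)
    then show ?thesis using card_sat_Suc_Suc[OF res] card_sat_Suc_Suc[OF Q(1,2)] by simp
  qed
qed

lemma sat_subspace: "hom.subspace (sat C S G I E n X D)"
  by (rule subspace_functor.F_subspace[OF subspace_functor_sat])

end

section \<open>Defect of additivity of satellites in the second argument\<close>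

context extriangulated_category
begin

lemma kernel_post_subspace:
  "x \<in> Hom C A B \<Longrightarrow> hom.subspace {u \<in> Hom C X A. x \<cdot> u = 0}"
  unfolding hom.subspace_def
  by (auto simp: hom_0 hom_add hom_scale comp_0_right comp_add_right comp_scale_right)

lemma kernel_pre_subspace:
  "y \<in> Hom C B D \<Longrightarrow> hom.subspace {u \<in> Hom C D Y. u \<cdot> y = 0}"
  unfolding hom.subspace_def
  by (auto simp: hom_0 hom_add hom_scale comp_0_left comp_add_left comp_scale_left)

lemma kernel_pull_subspace:
  "y \<in> Hom C B D \<Longrightarrow> ext.subspace {\<epsilon> \<in> Ext C D Y. pull C y \<epsilon> = 0}"
  unfolding ext.subspace_def
  by (auto simp: ext_0 ext_add ext_scale pull_0 pull_add pull_scale)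

text \<open>The connecting map sends \<open>u\<close> to the component of \<open>k \<cdot> u\<close> in \<open>A\<close>.\<close>

lemma card_kernel_rotation:
  assumes tri: "triangle C A B D x y \<delta>" and res: "triangle C K P D i p \<epsilon>"
    and rot: "triangle C K M B k m \<delta>'" "is_biproduct C A P M a s rA rP" "m \<cdot> a = x" "rP \<cdot> k = i"
    and fin: "finite (Hom C X K)"
  shows "card {u \<in> Hom C X K. i \<cdot> u = 0} = card {u \<in> Hom C X A. x \<cdot> u = 0} * card {u \<in> Hom C X K. k \<cdot> u = 0}"
proof -
  have in': "x \<in> Hom C A B" "i \<in> Hom C K P" "k \<in> Hom C K M" "m \<in> Hom C M B"
    "a \<in> Hom C A M" "s \<in> Hom C P M" "rA \<in> Hom C M A" "rP \<in> Hom C M P"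
    using triangle_in[OF tri] triangle_in[OF res] triangle_in[OF rot(1)] rot(2) by (auto simp: is_biproduct_def)
  have b: "rA \<cdot> a = ide C A" "rP \<cdot> a = 0" "a \<cdot> rA + s \<cdot> rP = ide C M"
    using rot(2) by (auto simp: is_biproduct_def)
  let ?G = "{u \<in> Hom C X K. i \<cdot> u = 0}"
  have rAk: "rA \<cdot> k \<in> Hom C K A" using comp_in in' by blast
  have rPk: "rP \<cdot> (k \<cdot> u) = i \<cdot> u" if "u \<in> Hom C X K" for u
    using comp_assoc[OF that in'(3,8)] rot(4) by simp
  \<comment> \<open>In the decomposition of \<open>M\<close>, the component of
    \<open>k \<cdot> u\<close> in \<open>P\<close> is \<open>i \<cdot> u\<close>, which is zero on
    \<open>?G\<close>.\<close>
  have ku: "k \<cdot> u = a \<cdot> ((rA \<cdot> k) \<cdot> u)" if u: "u \<in> ?G" for u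
  proof -
    have u': "u \<in> Hom C X K" "k \<cdot> u \<in> Hom C X M" using u in' comp_in by blast+
    have "k \<cdot> u = (a \<cdot> rA + s \<cdot> rP) \<cdot> (k \<cdot> u)" using b(3) ide_comp[OF u'(2)] by simp
    also have "\<dots> = a \<cdot> (rA \<cdot> (k \<cdot> u)) + s \<cdot> (rP \<cdot> (k \<cdot> u))"
      using comp_add_left[OF u'(2) comp_in[OF in'(7,5)] comp_in[OF in'(8,6)]]
        comp_assoc[OF u'(2) in'(7,5)] comp_assoc[OF u'(2) in'(8,6)] by simp
    also have "s \<cdot> (rP \<cdot> (k \<cdot> u)) = 0" using rPk[OF u'(1)] u comp_0_right[OF in'(6)] by simp
    finally show ?thesis using comp_assoc[OF u'(1) in'(3,7)] by simp
  qed
  have "card ?G = card {u \<in> ?G. (rA \<cdot> k) \<cdot> u = 0} * card ((\<lambda>u. (rA \<cdot> k) \<cdot> u) ` ?G)"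
    by (rule card_eq_card_kernel_times_card_image)
      (use fin hom_0 hom_diff in'(2) rAk in \<open>auto simp: comp_0_right comp_diff_right\<close>)
  moreover have "{u \<in> ?G. (rA \<cdot> k) \<cdot> u = 0} = {u \<in> Hom C X K. k \<cdot> u = 0}"
  proof safe
    fix u assume u: "u \<in> Hom C X K"
    show "k \<cdot> u = 0" if "i \<cdot> u = 0" "(rA \<cdot> k) \<cdot> u = 0" using ku[of u] u that comp_0_right[OF in'(5)] by simp
    assume k: "k \<cdot> u = 0"
    show "i \<cdot> u = 0" using rPk[OF u] k comp_0_right[OF in'(8)] by simp
    show "(rA \<cdot> k) \<cdot> u = 0" using comp_assoc[OF u in'(3,7)] k comp_0_right[OF in'(7)] by simp
  qed
  moreover have "(\<lambda>u. (rA \<cdot> k) \<cdot> u) ` ?G = {u \<in> Hom C X A. x \<cdot> u = 0}"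
  proof (intro equalityI subsetI)
    fix v assume "v \<in> (\<lambda>u. (rA \<cdot> k) \<cdot> u) ` ?G"
    then obtain u where u: "u \<in> ?G" "v = (rA \<cdot> k) \<cdot> u" by blast
    have v: "v \<in> Hom C X A" using u rAk comp_in by blast
    have "x \<cdot> v = m \<cdot> (k \<cdot> u)" using comp_assoc[OF v in'(5,4)] rot(3) ku[OF u(1)] u(2) by simp
    also have "\<dots> = 0"
    proof -
      have u': "u \<in> Hom C X K" using u by simp
      show ?thesis using comp_assoc[OF u' in'(3,4)] triangle_comp_zero[OF rot(1)] comp_0_left[OF u'] by simp
    qed
    finally show "v \<in> {u \<in> Hom C X A. x \<cdot> u = 0}" using v by simp
  next
    fix v assume v: "v \<in> {u \<in> Hom C X A. x \<cdot> u = 0}"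
    then have v': "v \<in> Hom C X A" by simp
    \<comment> \<open>Surjectivity: \<open>a \<cdot> v\<close> is killed by \<open>m\<close>, so it
      lifts through \<open>k\<close>, and the lift is a preimage of \<open>v\<close>.\<close>
    have "m \<cdot> (a \<cdot> v) = 0" using comp_assoc[OF v' in'(5,4)] rot(3) v by simp
    then obtain u where u: "u \<in> Hom C X K" "k \<cdot> u = a \<cdot> v" using triangle_lift[OF rot(1) comp_in[OF v' in'(5)]] by blast
    have "i \<cdot> u = 0" using rPk[OF u(1)] u(2) comp_assoc[OF v' in'(5,8)] b(2) comp_0_left[OF v'] by simp
    moreover have "(rA \<cdot> k) \<cdot> u = v"
      using comp_assoc[OF u(1) in'(3,7)] u(2) comp_assoc[OF v' in'(5,7)] b(1) ide_comp[OF v'] by simp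
    ultimately show "v \<in> (\<lambda>u. (rA \<cdot> k) \<cdot> u) ` ?G" using u by blast
  qed
  ultimately show ?thesis by (simp add: mult.commute)
qed

lemma card_field_gt_1: "finite (UNIV :: 'k set) \<Longrightarrow> 1 < CARD('k)"
  using card_mono[of UNIV "{0, 1 :: 'k}"] by simp

end

text \<open>The rotation induction with the kernel of Hom(X,A) -> Hom(X,B) as defect. The rotated
  triangle has the syzygy \<open>K\<close> of \<open>D\<close> as first term, and the defects before
  and after rotation add up to the satellite of \<open>D\<close> in degree 1.\<close>

lemma (in satellites) alternating_sum_sat_second:
  assumes finK: "finite (UNIV :: 'k set)" and fin: "\<And>n D. finite (sat C S G I E n X D)"
    and ep: "enough_projectives C" and tri: "triangle C A B D x y \<delta>"
    and van: "\<And>n. n > N \<Longrightarrow> hom.dim (sat C S G I E n X A) = 0"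
      "\<And>n. n > N \<Longrightarrow> hom.dim (sat C S G I E n X B) = 0"
      "\<And>n. n > N \<Longrightarrow> hom.dim (sat C S G I E n X D) = 0"
  shows "alternating_sum N (\<lambda>n. hom.dim (sat C S G I E n X B)) -
    alternating_sum N (\<lambda>n. hom.dim (sat C S G I E n X A)) -
    alternating_sum N (\<lambda>n. hom.dim (sat C S G I E n X D)) = int (hom.dim {u \<in> Hom C X A. x \<cdot> u = 0})"
proof -
  define T where "T A B D k \<longleftrightarrow>
    (\<exists>x y \<delta>. triangle C A B D x y \<delta> \<and> k = hom.dim {u \<in> Hom C X A. x \<cdot> u = 0})" for A B D k
  let ?e = "\<lambda>D n. hom.dim (sat C S G I E n X D)"
  note q = card_field_gt_1[OF finK]
  have e: "card (sat C S G I E n X D) = CARD('k) ^ ?e D n" for n D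
    using hom.card_finite_subspace[OF finK sat_subspace fin] .
  have eq: "?e D n = ?e D' n'" if "card (sat C S G I E n X D) = card (sat C S G I E n' X D')" for n n' D D'
    using that q unfolding e by simp
  have finH: "finite (Hom C X D)" for D using fin[of 0 D] by simp
  have "alternating_sum N (?e B) - alternating_sum N (?e A) - alternating_sum N (?e D) =
      int (hom.dim {u \<in> Hom C X A. x \<cdot> u = 0})"
  proof (rule alternating_sum_rotation[where T = T])
    fix A B D k assume "T A B D k"
    then obtain x y \<delta> where t: "triangle C A B D x y \<delta>" and k: "k = hom.dim {u \<in> Hom C X A. x \<cdot> u = 0}"
      unfolding T_def by blast
    obtain K P i p' \<epsilon> where res: "triangle C K P D i p' \<epsilon>" "projective_obj C P"
      using ep unfolding enough_projectives_def by blast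
    obtain M k' m a s rA rP where rot: "triangle C K M B k' m (pull C y \<epsilon>)"
      "is_biproduct C A P M a s rA rP" "m \<cdot> a = x" "rP \<cdot> k' = i"
      using rotate_triangle[OF t res] by metis
    let ?k = "hom.dim {u \<in> Hom C X K. k' \<cdot> u = 0}"
    have c: "card {u \<in> Hom C X A. x \<cdot> u = 0} = CARD('k) ^ hom.dim {u \<in> Hom C X A. x \<cdot> u = 0}"
      "card {u \<in> Hom C X K. k' \<cdot> u = 0} = CARD('k) ^ ?k"
      using hom.card_finite_subspace[OF finK kernel_post_subspace] finH triangle_in[OF t] triangle_in[OF rot(1)]
      by auto
    have "CARD('k) ^ ?e D 1 = CARD('k) ^ (k + ?k)"
      using e[of 1 D] card_sat_1[OF res, of X] card_kernel_rotation[OF t res(1) rot finH] c k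
      by (simp add: power_add)
    then have "k + ?k = ?e D 1" using q by simp
    moreover have "T K M B ?k" unfolding T_def using rot(1) by blast
    moreover have "\<forall>n\<ge>1. ?e K n = ?e D (Suc n)"
    proof (intro allI impI)
      fix n :: nat assume "n \<ge> 1"
      then obtain n' where n: "n = Suc n'" by (cases n) auto
      show "?e K n = ?e D (Suc n)" unfolding n by (rule eq, rule card_sat_Suc_Suc[OF res, symmetric])
    qed
    moreover have "\<forall>n\<ge>1. ?e M n = ?e A n"
    proof (intro allI impI)
      fix n :: nat assume "n \<ge> 1"
      then obtain n' where n: "n = Suc n'" by (cases n) auto
      show "?e M n = ?e A n" unfolding n by (rule eq, rule card_sat_add_projective[OF ep res(2) rot(2)])
    qed
    ultimately show "\<exists>A' B' k'. T A' B' B k' \<and> k + k' = ?e D 1 \<and>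
        (\<forall>n\<ge>1. ?e A' n = ?e D (Suc n)) \<and> (\<forall>n\<ge>1. ?e B' n = ?e A n)"
      by blast
  next
    show "T A B D (hom.dim {u \<in> Hom C X A. x \<cdot> u = 0})" unfolding T_def using tri by blast
  qed (use van in auto)
  then show ?thesis by simp
qed


section \<open>Defect of additivity of satellites in the first argument\<close>

context extriangulated_category
begin

text \<open>The pairs \<open>(\<phi>, f)\<close> with \<open>\<phi> \<cdot> y = 0\<close>, \<open>i \<cdot> f = 0\<close> and \<open>\<phi>\<^sup>* \<epsilon> = f\<^sub>* \<delta>\<close> form a relation that replaces the
  connecting map from \<open>{f. i \<cdot> f = 0}\<close> to \<open>{\<phi>. \<phi> \<cdot> y = 0}\<close>, which need not be well defined. Its two
  indeterminacies \<open>Kf\<close> and \<open>K\<phi>\<close> are compared through the \<open>\<tau> : B \<rightarrow> K\<close> and \<open>\<rho> : D \<rightarrow> P\<close> with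
  \<open>i \<cdot> \<tau> = \<rho> \<cdot> y\<close>.\<close>

lemma card_kernel_first_argument:
  assumes tri: "triangle C A B D x y \<delta>" and res: "triangle C K P Y i g \<epsilon>"
    and inj: "inj_on (\<lambda>f. f \<cdot> y) (Hom C D P)"
    and fin: "\<And>X Y. finite (Hom C X Y)"
  shows "card {u \<in> Hom C A K. i \<cdot> u = 0} * card {u \<in> Hom C D K. i \<cdot> u = 0} =
    card {u \<in> Hom C B K. i \<cdot> u = 0} * card {u \<in> Hom C D Y. u \<cdot> y = 0} * card {u \<in> Hom C D K. u \<cdot> y = 0}"
proof -
  have in': "x \<in> Hom C A B" "y \<in> Hom C B D" "\<delta> \<in> Ext C D A" "i \<in> Hom C K P" "g \<in> Hom C P Y" "\<epsilon> \<in> Ext C Y K"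
    using triangle_in[OF tri] triangle_in[OF res] by auto
  have mono: "f = 0" if "f \<in> Hom C D P" "f \<cdot> y = 0" for f
    using inj_onD[OF inj, of f 0] that hom_0 comp_0_left[OF in'(2)] by simp
  have mono': "i \<cdot> f = 0" if "f \<in> Hom C D K" "f \<cdot> y = 0" for f
    using mono[OF comp_in[OF that(1) in'(4)]] comp_assoc[OF in'(2) that(1) in'(4)] that(2) comp_0_right[OF in'(4)]
    by simp
  define ZA where "ZA = {u \<in> Hom C A K. i \<cdot> u = 0}"
  define ZB where "ZB = {u \<in> Hom C B K. i \<cdot> u = 0}"
  define ZD where "ZD = {u \<in> Hom C D K. i \<cdot> u = 0}"
  define MY where "MY = {u \<in> Hom C D Y. u \<cdot> y = 0}"
  define MK where "MK = {u \<in> Hom C D K. u \<cdot> y = 0}"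
  define W where "W = {(\<phi>, f). \<phi> \<in> MY \<and> f \<in> ZA \<and> pull C \<phi> \<epsilon> = push C f \<delta>}"
  define K\<phi> where "K\<phi> = {\<phi> \<in> MY. pull C \<phi> \<epsilon> = 0}"
  define Kf where "Kf = {f \<in> ZA. push C f \<delta> = 0}"
  define T where "T = {\<tau> \<in> Hom C B K. (i \<cdot> \<tau>) \<cdot> x = 0}"
  define R where "R = {\<rho> \<in> Hom C D P. (g \<cdot> \<rho>) \<cdot> y = 0}"
  have finW: "finite W"
    by (rule finite_subset[of _ "Hom C D Y \<times> Hom C A K"]) (use fin in \<open>auto simp: W_def MY_def ZA_def\<close>)
  have MY_diff: "u - v \<in> MY" if "u \<in> MY" "v \<in> MY" for u v
    using that hom_diff comp_diff_left[OF in'(2)] by (auto simp: MY_def)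
  have ZA_diff: "u - v \<in> ZA" if "u \<in> ZA" "v \<in> ZA" for u v
    using that hom_diff comp_diff_right[OF _ _ in'(4)] by (auto simp: ZA_def)
  have MY_0: "0 \<in> MY" and ZA_0: "0 \<in> ZA"
    using comp_0_left[OF in'(2)] comp_0_right[OF in'(4)] hom_0 by (auto simp: MY_def ZA_def)
  have W_0: "0 \<in> W"
    using MY_0 ZA_0 pull_zero_map[OF in'(6)] push_zero_map[OF in'(3)] by (simp add: W_def zero_prod_def)
  have W_diff: "u - v \<in> W" if uv: "u \<in> W" "v \<in> W" for u v
  proof -
    obtain \<phi> f \<phi>' f' where e: "u = (\<phi>, f)" "v = (\<phi>', f')" by (metis surj_pair)
    have "\<phi> \<in> Hom C D Y" "\<phi>' \<in> Hom C D Y" "f \<in> Hom C A K" "f' \<in> Hom C A K"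
      using uv e by (auto simp: W_def MY_def ZA_def)
    then show ?thesis using uv e MY_diff ZA_diff diff_pull[OF _ _ in'(6)] diff_push[OF _ _ in'(3)]
      by (auto simp: W_def)
  qed
  have snd_image: "snd ` W = ZA"
  proof (intro equalityI subsetI)
    fix f assume f: "f \<in> ZA"
    then have f': "f \<in> Hom C A K" "i \<cdot> f = 0" by (auto simp: ZA_def)
    have "push C i (push C f \<delta>) = 0"
      using push_comp[OF f'(1) in'(4,3)] f'(2) push_zero_map[OF in'(3)] by simp
    then obtain \<phi> where \<phi>: "\<phi> \<in> Hom C D Y" "push C f \<delta> = pull C \<phi> \<epsilon>"
      using triangle_ext_lift[OF res push_in[OF f'(1) in'(3)]] by blast
    obtain \<psi> where \<psi>: "\<psi> \<in> Hom C B P" "\<psi> \<cdot> x = i \<cdot> f" "g \<cdot> \<psi> = \<phi> \<cdot> y"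
      using realize_morphism[OF tri res f'(1) \<phi>] by blast
    obtain \<rho> where \<rho>: "\<rho> \<in> Hom C D P" "\<rho> \<cdot> y = \<psi>"
      using triangle_extend[OF tri \<psi>(1)] \<psi>(2) f'(2) by metis
    \<comment> \<open>The \<phi> given by exactness need not vanish on \<open>y\<close>. The filler
      \<psi> of the morphism of triangles factors as \<open>\<rho> \<cdot> y\<close>, so subtracting
      \<open>g \<cdot> \<rho>\<close> corrects \<phi>; the pullback of \<epsilon> does not change,
      since it dies along \<open>g\<close>.\<close>
    have g\<rho>: "g \<cdot> \<rho> \<in> Hom C D Y" using comp_in \<rho> in' by blast
    have "(\<phi> - g \<cdot> \<rho>) \<cdot> y = 0"
      using comp_diff_left[OF in'(2) \<phi>(1) g\<rho>] comp_assoc[OF in'(2) \<rho>(1) in'(5)] \<rho>(2) \<psi>(3) by simp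
    moreover have "pull C (\<phi> - g \<cdot> \<rho>) \<epsilon> = push C f \<delta>"
      using diff_pull[OF \<phi>(1) g\<rho> in'(6)] pull_deflation_comp[OF res \<rho>(1)] \<phi>(2) by simp
    ultimately have "(\<phi> - g \<cdot> \<rho>, f) \<in> W" using f hom_diff[OF \<phi>(1) g\<rho>] by (simp add: W_def MY_def)
    then show "f \<in> snd ` W" by force
  qed (auto simp: W_def)
  have fst_image: "fst ` W = MY"
  proof (intro equalityI subsetI)
    fix \<phi> assume \<phi>: "\<phi> \<in> MY"
    then have \<phi>': "\<phi> \<in> Hom C D Y" "\<phi> \<cdot> y = g \<cdot> 0" using comp_0_right[OF in'(5)] by (auto simp: MY_def)
    \<comment> \<open>As \<open>\<phi> \<cdot> y\<close> is zero, the zero map B -> P is an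
      admissible middle component. This choice also forces \<open>i \<cdot> f\<close> to
      vanish.\<close>
    obtain f where f: "f \<in> Hom C A K" "0 \<cdot> x = i \<cdot> f" "push C f \<delta> = pull C \<phi> \<epsilon>"
      using ET3_op[OF tri res hom_0 \<phi>'] by blast
    have "(\<phi>, f) \<in> W" using \<phi> f comp_0_left[OF in'(1)] by (simp add: W_def ZA_def)
    then show "\<phi> \<in> fst ` W" by force
  qed (auto simp: W_def)
  have W1: "card W = card K\<phi> * card ZA"
  proof -
    have "{w \<in> W. snd w = 0} = (\<lambda>\<phi>. (\<phi>, 0)) ` K\<phi>"
      using push_zero_map[OF in'(3)] ZA_0 by (auto simp: W_def K\<phi>_def)
    then have "card {w \<in> W. snd w = 0} = card K\<phi>" by (simp add: card_image inj_on_def)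
    then show ?thesis
      using card_eq_card_kernel_times_card_image[OF finW W_0 W_diff, of snd] snd_image by simp
  qed
  have W2: "card W = card Kf * card MY"
  proof -
    have "{w \<in> W. fst w = 0} = Pair 0 ` Kf"
      using pull_zero_map[OF in'(6)] MY_0 by (auto simp: W_def Kf_def)
    then have "card {w \<in> W. fst w = 0} = card Kf" by (simp add: card_image inj_on_def)
    then show ?thesis
      using card_eq_card_kernel_times_card_image[OF finW W_0 W_diff, of fst] fst_image by simp
  qed
  have T_hom: "i \<cdot> \<tau> \<in> Hom C B P" "(i \<cdot> \<tau>) \<cdot> x = i \<cdot> (\<tau> \<cdot> x)" "\<tau> \<cdot> x \<in> Hom C A K" if "\<tau> \<in> Hom C B K" for \<tau>
    using comp_in[OF that in'(4)] comp_assoc[OF in'(1) that in'(4)] comp_in[OF in'(1) that] by auto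
  have R_hom: "g \<cdot> \<rho> \<in> Hom C D Y" "(g \<cdot> \<rho>) \<cdot> y = g \<cdot> (\<rho> \<cdot> y)" "\<rho> \<cdot> y \<in> Hom C B P" if "\<rho> \<in> Hom C D P" for \<rho>
    using comp_in[OF that in'(5)] comp_assoc[OF in'(2) that in'(5)] comp_in[OF in'(2) that] by auto
  have T_diff: "u - v \<in> T" if "u \<in> T" "v \<in> T" for u v
    using that T_hom(1) hom_diff comp_diff_right[OF _ _ in'(4)] comp_diff_left[OF in'(1) T_hom(1) T_hom(1)]
    by (auto simp: T_def)
  have R_diff: "u - v \<in> R" if "u \<in> R" "v \<in> R" for u v
    using that R_hom(1) hom_diff comp_diff_right[OF _ _ in'(5)] comp_diff_left[OF in'(2) R_hom(1) R_hom(1)]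
    by (auto simp: R_def)
  have T_0: "0 \<in> T" and R_0: "0 \<in> R"
    using comp_0_right[OF in'(4)] comp_0_right[OF in'(5)] comp_0_left[OF in'(1)] comp_0_left[OF in'(2)] hom_0
    by (auto simp: T_def R_def)
  have finTR: "finite T" "finite R" using fin by (auto simp: T_def R_def)
  let ?H = "Hom C D K"
  have Hy: "(\<lambda>u. u \<cdot> y) ` ?H = {\<tau> \<in> T. \<tau> \<cdot> x = 0}"
  proof (intro equalityI subsetI)
    fix \<tau> assume "\<tau> \<in> (\<lambda>u. u \<cdot> y) ` ?H"
    then obtain u where u: "u \<in> ?H" "\<tau> = u \<cdot> y" by blast
    have "\<tau> \<cdot> x = 0"
      using comp_assoc[OF in'(1,2) u(1)] u(2) triangle_comp_zero[OF tri] comp_0_right[OF u(1)] by simp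
    moreover have "\<tau> \<in> Hom C B K" using u comp_in in' by blast
    ultimately show "\<tau> \<in> {\<tau> \<in> T. \<tau> \<cdot> x = 0}" using T_hom comp_0_right[OF in'(4)] by (simp add: T_def)
  next
    fix \<tau> assume "\<tau> \<in> {\<tau> \<in> T. \<tau> \<cdot> x = 0}"
    then have "\<tau> \<in> Hom C B K" "\<tau> \<cdot> x = 0" by (auto simp: T_def)
    then show "\<tau> \<in> (\<lambda>u. u \<cdot> y) ` ?H" using triangle_extend[OF tri] by (metis image_eqI)
  qed
  have Tx: "(\<lambda>\<tau>. \<tau> \<cdot> x) ` T = Kf"
  proof (intro equalityI subsetI)
    fix f assume "f \<in> (\<lambda>\<tau>. \<tau> \<cdot> x) ` T"
    then show "f \<in> Kf" using T_hom push_comp_inflation[OF tri] by (auto simp: T_def Kf_def ZA_def)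
  next
    fix f assume "f \<in> Kf"
    then have f: "f \<in> Hom C A K" "i \<cdot> f = 0" "push C f \<delta> = 0" by (auto simp: Kf_def ZA_def)
    obtain \<tau> where "\<tau> \<in> Hom C B K" "\<tau> \<cdot> x = f" using push_eq_zero_extend[OF tri f(1,3)] by blast
    then show "f \<in> (\<lambda>\<tau>. \<tau> \<cdot> x) ` T" using T_hom f(2) by (auto simp: T_def image_iff)
  qed
  have iH: "(\<lambda>u. i \<cdot> u) ` ?H = {\<rho> \<in> R. g \<cdot> \<rho> = 0}"
  proof (intro equalityI subsetI)
    fix \<rho> assume "\<rho> \<in> (\<lambda>u. i \<cdot> u) ` ?H"
    then obtain u where u: "u \<in> ?H" "\<rho> = i \<cdot> u" by blast
    have "g \<cdot> \<rho> = 0"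
      using comp_assoc[OF u(1) in'(4,5)] u(2) triangle_comp_zero[OF res] comp_0_left[OF u(1)] by simp
    moreover have "\<rho> \<in> Hom C D P" using u comp_in in' by blast
    ultimately show "\<rho> \<in> {\<rho> \<in> R. g \<cdot> \<rho> = 0}" using comp_0_left[OF in'(2)] by (simp add: R_def)
  next
    fix \<rho> assume "\<rho> \<in> {\<rho> \<in> R. g \<cdot> \<rho> = 0}"
    then have "\<rho> \<in> Hom C D P" "g \<cdot> \<rho> = 0" by (auto simp: R_def)
    then show "\<rho> \<in> (\<lambda>u. i \<cdot> u) ` ?H" using triangle_lift[OF res] by (metis image_eqI)
  qed
  have gR: "(\<lambda>\<rho>. g \<cdot> \<rho>) ` R = K\<phi>"
  proof (intro equalityI subsetI)
    fix \<phi> assume "\<phi> \<in> (\<lambda>\<rho>. g \<cdot> \<rho>) ` R"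
    then show "\<phi> \<in> K\<phi>" using R_hom pull_deflation_comp[OF res] by (auto simp: R_def K\<phi>_def MY_def)
  next
    fix \<phi> assume "\<phi> \<in> K\<phi>"
    then have \<phi>: "\<phi> \<in> Hom C D Y" "\<phi> \<cdot> y = 0" "pull C \<phi> \<epsilon> = 0" by (auto simp: K\<phi>_def MY_def)
    obtain \<rho> where "\<rho> \<in> Hom C D P" "g \<cdot> \<rho> = \<phi>" using pull_eq_zero_lift[OF res \<phi>(1,3)] by blast
    then show "\<phi> \<in> (\<lambda>\<rho>. g \<cdot> \<rho>) ` R" using \<phi>(2) by (auto simp: R_def image_iff)
  qed
  \<comment> \<open>Both sides are the maps B -> P that vanish on \<open>x\<close> and are killed by
    \<open>g\<close>: they extend over \<open>y\<close> by the first condition and lift through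
    \<open>i\<close> by the second.\<close>
  have iT: "(\<lambda>\<tau>. i \<cdot> \<tau>) ` T = (\<lambda>\<rho>. \<rho> \<cdot> y) ` R"
  proof (intro equalityI subsetI)
    fix \<psi> assume "\<psi> \<in> (\<lambda>\<tau>. i \<cdot> \<tau>) ` T"
    then obtain \<tau> where \<tau>: "\<tau> \<in> Hom C B K" "(i \<cdot> \<tau>) \<cdot> x = 0" "\<psi> = i \<cdot> \<tau>" by (auto simp: T_def)
    obtain \<rho> where \<rho>: "\<rho> \<in> Hom C D P" "\<rho> \<cdot> y = \<psi>"
      using triangle_extend[OF tri T_hom(1)[OF \<tau>(1)] \<tau>(2)] \<tau>(3) by blast
    have "(g \<cdot> \<rho>) \<cdot> y = 0"
      using R_hom(2)[OF \<rho>(1)] \<rho>(2) \<tau>(3) comp_assoc[OF \<tau>(1) in'(4,5)] triangle_comp_zero[OF res]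
        comp_0_left[OF \<tau>(1)] by simp
    then show "\<psi> \<in> (\<lambda>\<rho>. \<rho> \<cdot> y) ` R" using \<rho> by (auto simp: R_def)
  next
    fix \<psi> assume "\<psi> \<in> (\<lambda>\<rho>. \<rho> \<cdot> y) ` R"
    then obtain \<rho> where \<rho>: "\<rho> \<in> Hom C D P" "(g \<cdot> \<rho>) \<cdot> y = 0" "\<psi> = \<rho> \<cdot> y" by (auto simp: R_def)
    have "g \<cdot> \<psi> = 0" using R_hom(2)[OF \<rho>(1)] \<rho> by simp
    then obtain \<tau> where \<tau>: "\<tau> \<in> Hom C B K" "i \<cdot> \<tau> = \<psi>"
      using triangle_lift[OF res] R_hom(3)[OF \<rho>(1)] \<rho>(3) by metis
    have "(i \<cdot> \<tau>) \<cdot> x = 0"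
      using \<tau>(2) \<rho>(3) comp_assoc[OF in'(1,2) \<rho>(1)] triangle_comp_zero[OF tri] comp_0_right[OF \<rho>(1)] by simp
    then show "\<psi> \<in> (\<lambda>\<tau>. i \<cdot> \<tau>) ` T" using \<tau> by (auto simp: T_def)
  qed
  have cT: "card T = card ((\<lambda>u. u \<cdot> y) ` ?H) * card Kf"
    unfolding Hy Tx[symmetric]
    by (rule card_eq_card_kernel_times_card_image[OF finTR(1) T_0 T_diff])
      (auto simp: T_def comp_diff_left[OF in'(1)])
  have cR: "card R = card ((\<lambda>u. i \<cdot> u) ` ?H) * card K\<phi>"
    unfolding iH gR[symmetric]
    by (rule card_eq_card_kernel_times_card_image[OF finTR(2) R_0 R_diff])
      (auto simp: R_def comp_diff_right[OF _ _ in'(5)])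
  have cH1: "card ?H = card MK * card ((\<lambda>u. u \<cdot> y) ` ?H)"
    unfolding MK_def
    by (rule card_eq_card_kernel_times_card_image[OF fin hom_0 hom_diff]) (auto simp: comp_diff_left[OF in'(2)])
  have cH2: "card ?H = card ZD * card ((\<lambda>u. i \<cdot> u) ` ?H)"
    unfolding ZD_def
    by (rule card_eq_card_kernel_times_card_image[OF fin hom_0 hom_diff]) (auto simp: comp_diff_right[OF _ _ in'(4)])
  have cT2: "card T = card ZB * card ((\<lambda>\<tau>. i \<cdot> \<tau>) ` T)"
  proof -
    have "{\<tau> \<in> T. i \<cdot> \<tau> = 0} = ZB" using comp_0_left[OF in'(1)] by (auto simp: T_def ZB_def)
    moreover have "card T = card {\<tau> \<in> T. i \<cdot> \<tau> = 0} * card ((\<lambda>\<tau>. i \<cdot> \<tau>) ` T)"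
      by (rule card_eq_card_kernel_times_card_image[OF finTR(1) T_0 T_diff])
        (auto simp: T_def comp_diff_right[OF _ _ in'(4)])
    ultimately show ?thesis by simp
  qed
  \<comment> \<open>Injectivity of precomposition with \<open>y\<close> on maps into
    \<open>P\<close> makes the diagonal \<rho> \<mapsto> \<open>\<rho> \<cdot> y\<close> lose
    nothing, which links the two chains of counts.\<close>
  have cR2: "card ((\<lambda>\<rho>. \<rho> \<cdot> y) ` R) = card R"
    by (rule card_image) (use inj in \<open>auto simp: R_def inj_on_def\<close>)
  have pos: "card K\<phi> > 0" "card ((\<lambda>u. u \<cdot> y) ` ?H) > 0" "card ((\<lambda>u. i \<cdot> u) ` ?H) > 0"
  proof -
    have "0 \<in> K\<phi>" using MY_0 pull_zero_map[OF in'(6)] by (simp add: K\<phi>_def)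
    moreover have "finite K\<phi>" using fin by (auto simp: K\<phi>_def MY_def)
    ultimately show "card K\<phi> > 0" by (auto simp: card_gt_0_iff)
    have "?H \<noteq> {}" using hom_0 by blast
    then show "card ((\<lambda>u. u \<cdot> y) ` ?H) > 0" "card ((\<lambda>u. i \<cdot> u) ` ?H) > 0" using fin by (auto simp: card_gt_0_iff)
  qed
  let ?a = "card ((\<lambda>u. u \<cdot> y) ` ?H)" and ?b = "card ((\<lambda>u. i \<cdot> u) ` ?H)"
  have 1: "card K\<phi> * card ZA = card Kf * card MY" using W1 W2 by simp
  have 2: "?a * card Kf = card ZB * (?b * card K\<phi>)" using cT cT2 iT cR cR2 by simp
  have 3: "card MK * ?a = card ZD * ?b" using cH1 cH2 by simp
  \<comment> \<open>The claim is multiplied by the auxiliary cardinalities, so that the three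
    relations apply by substitution; being positive, they cancel at the end.\<close>
  have "(card ZA * card ZD) * (card K\<phi> * ?a * ?b) = (card K\<phi> * card ZA) * (card ZD * ?b) * ?a"
    by (simp add: ac_simps)
  also have "\<dots> = (?a * card Kf) * card MY * (card MK * ?a)" unfolding 1 3[symmetric] by (simp add: ac_simps)
  also have "\<dots> = (card ZB * card MY * card MK) * (card K\<phi> * ?a * ?b)" unfolding 2 by (simp add: ac_simps)
  finally have "card ZA * card ZD = card ZB * card MY * card MK" using pos by simp
  then show ?thesis unfolding ZA_def ZB_def ZD_def MY_def MK_def .
qed

end

text \<open>The triangle stays fixed and \<open>Y\<close> moves to a syzygy, so one injectivity
  hypothesis on \<open>y\<close> serves every step and each step lowers the degree by one.\<close>

lemma (in satellites) alternating_sum_sat_first: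
  assumes finK: "finite (UNIV :: 'k set)" and fin: "\<And>n X D. finite (sat C S G I E n X D)"
    and ep: "enough_projectives C" and tri: "triangle C A B D x y \<delta>"
    and inj: "\<And>P. projective_obj C P \<Longrightarrow> inj_on (\<lambda>f. f \<cdot> y) (Hom C D P)"
    and van: "\<And>n. n > N \<Longrightarrow> hom.dim (sat C S G I E n A Y) = 0"
      "\<And>n. n > N \<Longrightarrow> hom.dim (sat C S G I E n B Y) = 0"
      "\<And>n. n > N \<Longrightarrow> hom.dim (sat C S G I E n D Y) = 0"
  shows "alternating_sum N (\<lambda>n. hom.dim (sat C S G I E n B Y)) -
    alternating_sum N (\<lambda>n. hom.dim (sat C S G I E n A Y)) -
    alternating_sum N (\<lambda>n. hom.dim (sat C S G I E n D Y)) = int (hom.dim {u \<in> Hom C D Y. u \<cdot> y = 0})"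
  using van
proof (induction N arbitrary: Y)
  let ?e = "\<lambda>X Y n. hom.dim (sat C S G I E n X Y)" and ?m = "\<lambda>Y. hom.dim {u \<in> Hom C D Y. u \<cdot> y = 0}"
  note q = card_field_gt_1[OF finK]
  have y: "y \<in> Hom C B D" using triangle_in[OF tri] by simp
  have finH: "finite (Hom C X Y)" for X Y using fin[of 0 X Y] by simp
  have e: "card (sat C S G I E n X Y) = CARD('k) ^ ?e X Y n" for n X Y
    using hom.card_finite_subspace[OF finK sat_subspace fin] .
  have m: "card {u \<in> Hom C D Y. u \<cdot> y = 0} = CARD('k) ^ ?m Y" for Y
    using hom.card_finite_subspace[OF finK kernel_pre_subspace[OF y]] finH by simp
  have step: "\<exists>K. (\<forall>X n. ?e X K (Suc n) = ?e X Y (Suc (Suc n))) \<and>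
      ?e A Y 1 + ?e D Y 1 = ?e B Y 1 + ?m Y + ?m K" for Y
  proof -
    obtain K P i g \<epsilon> where res: "triangle C K P Y i g \<epsilon>" "projective_obj C P"
      using ep unfolding enough_projectives_def by blast
    have "CARD('k) ^ (?e A Y 1 + ?e D Y 1) = CARD('k) ^ (?e B Y 1 + ?m Y + ?m K)"
      using card_kernel_first_argument[OF tri res(1) inj[OF res(2)] finH] card_sat_1[OF res]
      by (simp add: power_add e[symmetric] m[symmetric] del: sat.simps)
    then have "?e A Y 1 + ?e D Y 1 = ?e B Y 1 + ?m Y + ?m K" using q by simp
    moreover have "?e X K (Suc n) = ?e X Y (Suc (Suc n))" for X n
    proof -
      have "CARD('k) ^ ?e X K (Suc n) = CARD('k) ^ ?e X Y (Suc (Suc n))"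
        using card_sat_Suc_Suc[OF res, of n X] unfolding e by simp
      then show ?thesis using q by simp
    qed
    ultimately show ?thesis by blast
  qed
  {
    case 0
    obtain K where K: "?e A Y 1 + ?e D Y 1 = ?e B Y 1 + ?m Y + ?m K" using step[of Y] by blast
    \<comment> \<open>With nothing left in degree 1, the defects at \<open>Y\<close> and at its
      syzygy are natural numbers with sum 0.\<close>
    have "?e A Y 1 = 0" "?e B Y 1 = 0" "?e D Y 1 = 0" by (rule 0, simp)+
    then show ?case using K by (simp del: sat.simps)
  next
    case (Suc N)
    obtain K where K: "\<And>X n. ?e X K (Suc n) = ?e X Y (Suc (Suc n))"
      "?e A Y 1 + ?e D Y 1 = ?e B Y 1 + ?m Y + ?m K"
      using step[of Y] by blast
    have K': "?e X K n = ?e X Y (Suc n)" if "n \<ge> 1" for X n using K(1)[of "n - 1" X] that by simp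
    have s: "alternating_sum (Suc N) (?e X Y) = - int (?e X Y 1) - alternating_sum N (?e X K)" for X
      by (rule alternating_sum_Suc_shift) (rule K')
    have "alternating_sum N (?e B K) - alternating_sum N (?e A K) - alternating_sum N (?e D K) = int (?m K)"
      by (rule Suc.IH) (use Suc.prems K' in \<open>auto simp del: sat.simps\<close>)
    then show ?case unfolding s using K(2) by linarith
  }
qed

section \<open>Higher positive extensions\<close>

definition lin_ext ::
    "('a::field \<Rightarrow> 'b::ab_group_add \<Rightarrow> 'b) \<Rightarrow> ('w \<Rightarrow> 'b) \<Rightarrow> ('w \<Rightarrow>\<^sub>0 'a) \<Rightarrow> 'b" where
  "lin_ext sc \<phi> r = (\<Sum>w\<in>Poly_Mapping.keys r. sc (Poly_Mapping.lookup r w) (\<phi> w))"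

context vector_space
begin

lemma lin_ext_eq_sum:
  assumes "finite F" "Poly_Mapping.keys r \<subseteq> F"
  shows "lin_ext scale \<phi> r = (\<Sum>w\<in>F. scale (Poly_Mapping.lookup r w) (\<phi> w))"
  unfolding lin_ext_def by (rule sum.mono_neutral_left) (use assms in \<open>auto simp: in_keys_iff\<close>)

lemma lin_ext_0 [simp]: "lin_ext scale \<phi> 0 = 0"
  by (simp add: lin_ext_def)

lemma lin_ext_add: "lin_ext scale \<phi> (r + s) = lin_ext scale \<phi> r + lin_ext scale \<phi> s"
proof -
  let ?F = "Poly_Mapping.keys r \<union> Poly_Mapping.keys s"
  have "lin_ext scale \<phi> (r + s) = (\<Sum>w\<in>?F. scale (Poly_Mapping.lookup (r + s) w) (\<phi> w))"
    by (rule lin_ext_eq_sum) (use Poly_Mapping.keys_add[of r s] in auto)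
  also have "\<dots> = (\<Sum>w\<in>?F. scale (Poly_Mapping.lookup r w) (\<phi> w)) +
      (\<Sum>w\<in>?F. scale (Poly_Mapping.lookup s w) (\<phi> w))"
    by (simp add: lookup_add scale_left_distrib sum.distrib)
  also have "\<dots> = lin_ext scale \<phi> r + lin_ext scale \<phi> s"
    using lin_ext_eq_sum[of ?F r] lin_ext_eq_sum[of ?F s] by simp
  finally show ?thesis .
qed

lemma lin_ext_scale: "lin_ext scale \<phi> (pm_scale c r) = scale c (lin_ext scale \<phi> r)"
proof -
  have "lin_ext scale \<phi> (pm_scale c r) =
      (\<Sum>w\<in>Poly_Mapping.keys r. scale (Poly_Mapping.lookup (pm_scale c r) w) (\<phi> w))"
    by (rule lin_ext_eq_sum) (auto simp: in_keys_iff lookup_pm_scale)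
  then show ?thesis by (simp add: lin_ext_def lookup_pm_scale scale_sum_right)
qed

lemma lin_ext_diff: "lin_ext scale \<phi> (r - s) = lin_ext scale \<phi> r - lin_ext scale \<phi> s"
  using lin_ext_add[of \<phi> "r - s" s] by (simp add: algebra_simps)

lemma lin_ext_sum: "lin_ext scale \<phi> (\<Sum>i\<in>I. r i) = (\<Sum>i\<in>I. lin_ext scale \<phi> (r i))"
  by (induction I rule: infinite_finite_induct) (auto simp: lin_ext_add)

lemma lin_ext_chain_gen [simp]: "lin_ext scale \<phi> (chain_gen w) = \<phi> w"
  by (simp add: lin_ext_def chain_gen_def)

lemma lin_ext_tensor_ext: "lin_ext scale \<phi> (tensor_ext r M \<delta>) = lin_ext scale (\<lambda>w. \<phi> ((M, \<delta>) # w)) r"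
  unfolding tensor_ext_def lin_ext_sum lin_ext_scale lin_ext_chain_gen by (simp add: lin_ext_def)

lemma lin_ext_mem:
  assumes "r \<in> pm.span X" "subspace V" "\<And>x. x \<in> X \<Longrightarrow> lin_ext scale \<phi> x \<in> V"
  shows "lin_ext scale \<phi> r \<in> V"
  using assms(1)
proof (induction rule: pm.span_induct)
  show "pm.subspace {r. lin_ext scale \<phi> r \<in> V}"
    unfolding pm.subspace_def using assms(2)
    by (auto simp: lin_ext_add lin_ext_scale subspace_0 subspace_add subspace_scale)
qed (use assms in auto)

end

lemma tensor_ext_eq_lin_ext: "tensor_ext r M \<delta> = lin_ext pm_scale (\<lambda>w. chain_gen ((M, \<delta>) # w)) r"
  by (simp add: tensor_ext_def lin_ext_def)

text \<open>The contravariant action on chains, which changes only the extension nearest to the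
  source. The value at the empty chain is a default.\<close>

definition pull_chain ::
    "('k, 'o, 'm, 'e, 'z) extri_cat_scheme \<Rightarrow> 'm \<Rightarrow> ('o \<times> 'e) list \<Rightarrow> (('o \<times> 'e) list \<Rightarrow>\<^sub>0 'k::field)" where
  "pull_chain C a w = (case w of [] \<Rightarrow> 0 | (N, \<eta>) # w' \<Rightarrow> chain_gen ((N, pull C a \<eta>) # w'))"

lemma pull_chain_simps [simp]:
  "pull_chain C a [] = 0"
  "pull_chain C a ((N, \<eta>) # w) = chain_gen ((N, pull C a \<eta>) # w)"
  by (simp_all add: pull_chain_def)

text \<open>Dimension shift on generators. An extension \<delta> of \<open>X\<close> by
  \<open>M\<close> is \<open>push C a \<epsilon>\<close> for some \<open>a\<close> from the syzygy;
  the coend relation moves \<open>a\<close> onto the rest of the chain, and \<epsilon> is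
  dropped.\<close>

definition shift_chain ::
    "('k, 'o, 'm, 'e, 'z) extri_cat_scheme \<Rightarrow> 'o \<Rightarrow> 'e \<Rightarrow> ('o \<times> 'e) list \<Rightarrow> (('o \<times> 'e) list \<Rightarrow>\<^sub>0 'k::field)" where
  "shift_chain C K \<epsilon> w = (case w of [] \<Rightarrow> 0
     | (M, \<delta>) # w' \<Rightarrow> pull_chain C (SOME a. a \<in> Hom C K M \<and> push C a \<epsilon> = \<delta>) w')"

lemma chain_nonempty:
  assumes "is_chain C M A w" "length w = Suc n"
  obtains N \<eta> w' where "w = (N, \<eta>) # w'" "\<eta> \<in> Ext C M N" "is_chain C N A w'" "length w' = n"
  using assms by (cases w) auto

lemma chain_gen_in_yon_free: "is_chain C X A w \<Longrightarrow> length w = n \<Longrightarrow> chain_gen w \<in> yon_free C n X A"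
  unfolding yon_free_def by (rule pm.span_base) blast

lemma yon_rel_subspace: "pm.subspace (yon_rel C n X A)"
  by (cases n) (simp_all only: yon_rel.simps pm.subspace_span pm.subspace_single_0)

lemma yon_free_subspace: "pm.subspace (yon_free C n X A)"
  by (simp add: yon_free_def pm.subspace_span)

lemma yon_rel_tensor:
  "\<delta> \<in> Ext C X M \<Longrightarrow> r \<in> yon_rel C n M A \<Longrightarrow> tensor_ext r M \<delta> \<in> yon_rel C (Suc n) X A"
  unfolding yon_rel.simps by (rule pm.span_base, rule UnI1, rule UnI1, rule UnI1) blast

lemma yon_rel_add:
  "\<delta> \<in> Ext C X M \<Longrightarrow> \<delta>' \<in> Ext C X M \<Longrightarrow> is_chain C M A w \<Longrightarrow> length w = n \<Longrightarrow>
    chain_gen ((M, \<delta> + \<delta>') # w) - chain_gen ((M, \<delta>) # w) - chain_gen ((M, \<delta>') # w) \<in> yon_rel C (Suc n) X A"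
  unfolding yon_rel.simps by (rule pm.span_base, rule UnI1, rule UnI1, rule UnI2) blast

lemma yon_rel_scale:
  "\<delta> \<in> Ext C X M \<Longrightarrow> is_chain C M A w \<Longrightarrow> length w = n \<Longrightarrow>
    chain_gen ((M, escale C t \<delta>) # w) - pm_scale t (chain_gen ((M, \<delta>) # w)) \<in> yon_rel C (Suc n) X A"
  unfolding yon_rel.simps by (rule pm.span_base, rule UnI1, rule UnI2) blast

lemma yon_rel_balanced:
  "a \<in> Hom C M M' \<Longrightarrow> \<delta> \<in> Ext C X M \<Longrightarrow> \<epsilon> \<in> Ext C M' N \<Longrightarrow> is_chain C N A w \<Longrightarrow>
    Suc (length w) = n \<Longrightarrow> chain_gen ((M', push C a \<delta>) # (N, \<epsilon>) # w) -
      chain_gen ((M, \<delta>) # (N, pull C a \<epsilon>) # w) \<in> yon_rel C (Suc n) X A"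
  unfolding yon_rel.simps by (rule pm.span_base, rule UnI2) blast

text \<open>The universal property of the presentation: a map on chains descends as soon as it
  respects the four families of relations. The first family is stated with the leading letter fixed,
  so that facts one degree lower apply.\<close>

lemma yon_rel_Suc_lin_ext:
  fixes C :: "('k::field, 'o, 'm, 'e::ab_group_add, 'z) extri_cat_scheme"
  assumes "vector_space sc" and V: "module.subspace sc V"
    and r: "r \<in> yon_rel C (Suc n) X A"
    and 1: "\<And>M \<delta> r. \<delta> \<in> Ext C X M \<Longrightarrow> r \<in> yon_rel C n M A \<Longrightarrow> lin_ext sc (\<lambda>w. \<phi> ((M, \<delta>) # w)) r \<in> V"
    and 2: "\<And>M \<delta> \<delta>' w. \<delta> \<in> Ext C X M \<Longrightarrow> \<delta>' \<in> Ext C X M \<Longrightarrow> is_chain C M A w \<Longrightarrow> length w = n \<Longrightarrow>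
      \<phi> ((M, \<delta> + \<delta>') # w) - \<phi> ((M, \<delta>) # w) - \<phi> ((M, \<delta>') # w) \<in> V"
    and 3: "\<And>M t \<delta> w. \<delta> \<in> Ext C X M \<Longrightarrow> is_chain C M A w \<Longrightarrow> length w = n \<Longrightarrow>
      \<phi> ((M, escale C t \<delta>) # w) - sc t (\<phi> ((M, \<delta>) # w)) \<in> V"
    and 4: "\<And>M M' N a \<delta> \<epsilon> w. a \<in> Hom C M M' \<Longrightarrow> \<delta> \<in> Ext C X M \<Longrightarrow> \<epsilon> \<in> Ext C M' N \<Longrightarrow>
      is_chain C N A w \<Longrightarrow> Suc (length w) = n \<Longrightarrow>
      \<phi> ((M', push C a \<delta>) # (N, \<epsilon>) # w) - \<phi> ((M, \<delta>) # (N, pull C a \<epsilon>) # w) \<in> V"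
  shows "lin_ext sc \<phi> r \<in> V"
proof -
  interpret vector_space sc by fact
  show ?thesis
  proof (rule lin_ext_mem[OF r[unfolded yon_rel.simps] V], elim UnE CollectE exE conjE)
    fix x r M \<delta> assume "x = tensor_ext r M \<delta>" "\<delta> \<in> Ext C X M" "r \<in> yon_rel C n M A"
    then show "lin_ext sc \<phi> x \<in> V" using 1 by (simp add: lin_ext_tensor_ext)
  qed (auto simp: lin_ext_diff lin_ext_scale 2 3 4)
qed

section \<open>Dimension shift for positive extensions\<close>

context extriangulated_category
begin

text \<open>A case distinction replaces induction: relations of lower degree sit in the tail of a
  chain, which pulling back leaves alone.\<close>

lemma pull_chain_yon_rel:
  assumes a: "a \<in> Hom C K M" and r: "r \<in> yon_rel C n M A"
  shows "lin_ext pm_scale (pull_chain C a) r \<in> yon_rel C n K A"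
proof (cases n)
  case 0
  then show ?thesis using r by simp
next
  case (Suc m)
  show ?thesis
    unfolding Suc
  proof (rule yon_rel_Suc_lin_ext[OF pm.vector_space_axioms yon_rel_subspace r[unfolded Suc]])
    fix N \<eta> r assume "\<eta> \<in> Ext C M N" "r \<in> yon_rel C m N A"
    then show "lin_ext pm_scale (\<lambda>w. pull_chain C a ((N, \<eta>) # w)) r \<in> yon_rel C (Suc m) K A"
      using yon_rel_tensor[OF pull_in[OF a]] by (simp add: tensor_ext_eq_lin_ext del: yon_rel.simps)
  next
    fix N \<eta> \<eta>' w assume "\<eta> \<in> Ext C M N" "\<eta>' \<in> Ext C M N" "is_chain C N A w" "length w = m"
    then show "pull_chain C a ((N, \<eta> + \<eta>') # w) - pull_chain C a ((N, \<eta>) # w) - pull_chain C a ((N, \<eta>') # w)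
        \<in> yon_rel C (Suc m) K A"
      using yon_rel_add[OF pull_in[OF a] pull_in[OF a]] by (simp add: pull_add[OF a] del: yon_rel.simps)
  next
    fix N t \<eta> w assume "\<eta> \<in> Ext C M N" "is_chain C N A w" "length w = m"
    then show "pull_chain C a ((N, escale C t \<eta>) # w) - pm_scale t (pull_chain C a ((N, \<eta>) # w))
        \<in> yon_rel C (Suc m) K A"
      using yon_rel_scale[OF pull_in[OF a]] by (simp add: pull_scale[OF a] del: yon_rel.simps)
  next
    fix N N' L b \<eta> \<theta> w
    assume "b \<in> Hom C N N'" "\<eta> \<in> Ext C M N" "\<theta> \<in> Ext C N' L" "is_chain C L A w" "Suc (length w) = m"
    then show "pull_chain C a ((N', push C b \<eta>) # (L, \<theta>) # w) - pull_chain C a ((N, \<eta>) # (L, pull C b \<theta>) # w)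
        \<in> yon_rel C (Suc m) K A"
      using yon_rel_balanced[OF _ pull_in[OF a]] by (simp add: push_pull[OF _ a, symmetric] del: yon_rel.simps)
  qed
qed

text \<open>The inverse of \<open>shift_chain\<close> is tensoring with \<epsilon>. Degree
  \<open>n\<close> must be positive: the lift \<open>rep M \<delta>\<close> is unique only up to
  morphisms through \<open>P\<close>, and these act as zero on extensions, as E(P,-) vanishes, but
  not on Hom.\<close>

lemma card_quot_space_yon_shift:
  assumes res: "triangle C K P X i p \<epsilon>" and P: "projective_obj C P" and n: "n = Suc m"
  shows "card (quot_space (yon_free C (Suc n) X A) (yon_rel C (Suc n) X A)) =
    card (quot_space (yon_free C n K A) (yon_rel C n K A))"
proof -
  have in': "i \<in> Hom C K P" "p \<in> Hom C P X" "\<epsilon> \<in> Ext C X K" using triangle_in[OF res] by auto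
  define rep where "rep M \<delta> = (SOME a. a \<in> Hom C K M \<and> push C a \<epsilon> = \<delta>)" for M \<delta>
  have rep: "rep M \<delta> \<in> Hom C K M" "push C (rep M \<delta>) \<epsilon> = \<delta>" if "\<delta> \<in> Ext C X M" for M \<delta>
  proof -
    have "pull C p \<delta> = 0" using P pull_in[OF in'(2) that] by (simp add: projective_obj_iff)
    then have "\<exists>a. a \<in> Hom C K M \<and> push C a \<epsilon> = \<delta>" using triangle_ext_extend[OF res that] by metis
    from someI_ex[OF this] show "rep M \<delta> \<in> Hom C K M" "push C (rep M \<delta>) \<epsilon> = \<delta>" unfolding rep_def by auto
  qed
  have uniq: "pull C a \<eta> = pull C a' \<eta>"
    if a: "a \<in> Hom C K M" "a' \<in> Hom C K M" "push C a \<epsilon> = push C a' \<epsilon>" and h: "\<eta> \<in> Ext C M N" for a a' M N \<eta>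
  proof -
    have "push C (a - a') \<epsilon> = 0" using diff_push[OF a(1,2) in'(3)] a(3) by simp
    then obtain b where b: "b \<in> Hom C P M" "b \<cdot> i = a - a'"
      using push_eq_zero_extend[OF res hom_diff[OF a(1,2)]] by blast
    have "pull C b \<eta> = 0" using P pull_in[OF b(1) h] by (simp add: projective_obj_iff)
    then have "pull C (b \<cdot> i) \<eta> = 0" using pull_comp[OF b(1) in'(1) h] pull_0[OF in'(1)] by simp
    then show ?thesis using b(2) diff_pull[OF a(1,2) h] by simp
  qed
  have shift: "shift_chain C K \<epsilon> ((M, \<delta>) # w) = pull_chain C (rep M \<delta>) w" for M \<delta> w
    by (simp add: shift_chain_def rep_def)
  let ?\<beta> = "lin_ext pm_scale (shift_chain C K \<epsilon>)" and ?\<alpha> = "\<lambda>r :: ('o \<times> 'e) list \<Rightarrow>\<^sub>0 'k. tensor_ext r K \<epsilon>"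
  have \<beta>_free: "?\<beta> r \<in> yon_free C n K A" if "r \<in> yon_free C (Suc n) X A" for r
  proof (rule pm.lin_ext_mem[OF that[unfolded yon_free_def] yon_free_subspace], safe)
    fix w assume w: "is_chain C X A w" "length w = Suc n"
    then obtain M \<delta> w' where 1: "w = (M, \<delta>) # w'" "\<delta> \<in> Ext C X M" "is_chain C M A w'" "length w' = Suc m"
      unfolding n by (rule chain_nonempty)
    obtain N \<eta> v where 2: "w' = (N, \<eta>) # v" "\<eta> \<in> Ext C M N" "is_chain C N A v" "length v = m"
      using 1(3,4) by (rule chain_nonempty)
    show "?\<beta> (chain_gen w) \<in> yon_free C n K A"
      using pull_in[OF rep(1)[OF 1(2)] 2(2)] 2 1(1) n by (simp add: shift chain_gen_in_yon_free)
  qed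
  have \<alpha>_free: "?\<alpha> r \<in> yon_free C (Suc n) X A" if "r \<in> yon_free C n K A" for r
    unfolding tensor_ext_eq_lin_ext
    by (rule pm.lin_ext_mem[OF that[unfolded yon_free_def] yon_free_subspace])
      (use in' in \<open>auto intro!: chain_gen_in_yon_free\<close>)
  have \<beta>_rel: "?\<beta> r \<in> yon_rel C n K A" if "r \<in> yon_rel C (Suc n) X A" for r
  proof (rule yon_rel_Suc_lin_ext[OF pm.vector_space_axioms yon_rel_subspace that])
    fix M \<delta> r assume "\<delta> \<in> Ext C X M" "r \<in> yon_rel C n M A"
    then show "lin_ext pm_scale (\<lambda>w. shift_chain C K \<epsilon> ((M, \<delta>) # w)) r \<in> yon_rel C n K A"
      unfolding shift using pull_chain_yon_rel rep(1) by blast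
  next
    fix M \<delta> \<delta>' w assume d: "\<delta> \<in> Ext C X M" "\<delta>' \<in> Ext C X M" and w: "is_chain C M A w" "length w = n"
    obtain N \<eta> v where v: "w = (N, \<eta>) # v" "\<eta> \<in> Ext C M N" "is_chain C N A v" "length v = m"
      using w unfolding n by (rule chain_nonempty)
    note r = rep[OF d(1)] rep[OF d(2)] rep[OF ext_add[OF d]]
    have "pull C (rep M (\<delta> + \<delta>')) \<eta> = pull C (rep M \<delta> + rep M \<delta>') \<eta>"
      by (rule uniq[OF r(5) hom_add[OF r(1,3)] _ v(2)]) (use r add_push[OF r(1,3) in'(3)] in simp)
    then have "pull C (rep M (\<delta> + \<delta>')) \<eta> = pull C (rep M \<delta>) \<eta> + pull C (rep M \<delta>') \<eta>"
      using add_pull[OF r(1,3) v(2)] by simp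
    then show "shift_chain C K \<epsilon> ((M, \<delta> + \<delta>') # w) - shift_chain C K \<epsilon> ((M, \<delta>) # w) -
        shift_chain C K \<epsilon> ((M, \<delta>') # w) \<in> yon_rel C n K A"
      unfolding shift v(1) n using yon_rel_add[OF pull_in[OF r(1) v(2)] pull_in[OF r(3) v(2)] v(3,4)]
      by (simp del: yon_rel.simps)
  next
    fix M t \<delta> w assume d: "\<delta> \<in> Ext C X M" and w: "is_chain C M A w" "length w = n"
    obtain N \<eta> v where v: "w = (N, \<eta>) # v" "\<eta> \<in> Ext C M N" "is_chain C N A v" "length v = m"
      using w unfolding n by (rule chain_nonempty)
    note r = rep[OF d] rep[OF ext_scale[OF d]]
    have "pull C (rep M (escale C t \<delta>)) \<eta> = pull C (hscale C t (rep M \<delta>)) \<eta>"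
      by (rule uniq[OF r(3) hom_scale[OF r(1)] _ v(2)]) (use r scale_push[OF r(1) in'(3)] in simp)
    then have "pull C (rep M (escale C t \<delta>)) \<eta> = escale C t (pull C (rep M \<delta>) \<eta>)"
      using scale_pull[OF r(1) v(2)] by simp
    then show "shift_chain C K \<epsilon> ((M, escale C t \<delta>) # w) - pm_scale t (shift_chain C K \<epsilon> ((M, \<delta>) # w))
        \<in> yon_rel C n K A"
      unfolding shift v(1) n using yon_rel_scale[OF pull_in[OF r(1) v(2)] v(3,4)]
      by (simp del: yon_rel.simps)
  next
    fix M M' N b \<delta> \<eta> w
    assume b: "b \<in> Hom C M M'" and d: "\<delta> \<in> Ext C X M" and h: "\<eta> \<in> Ext C M' N"
    note r = rep[OF d] rep[OF push_in[OF b d]]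
    have "pull C (rep M' (push C b \<delta>)) \<eta> = pull C (b \<cdot> rep M \<delta>) \<eta>"
      by (rule uniq[OF r(3) comp_in[OF r(1) b] _ h]) (use r push_comp[OF r(1) b in'(3)] in simp)
    then have "pull C (rep M' (push C b \<delta>)) \<eta> = pull C (rep M \<delta>) (pull C b \<eta>)"
      using pull_comp[OF b r(1) h] by simp
    then show "shift_chain C K \<epsilon> ((M', push C b \<delta>) # (N, \<eta>) # w) -
        shift_chain C K \<epsilon> ((M, \<delta>) # (N, pull C b \<eta>) # w) \<in> yon_rel C n K A"
      unfolding shift using pm.subspace_0[OF yon_rel_subspace] by (simp del: yon_rel.simps)
  qed
  have \<beta>\<alpha>: "?\<beta> (?\<alpha> r) = r" if "r \<in> yon_free C n K A" for r
  proof -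
    have "?\<beta> (?\<alpha> r) - r \<in> {0}"
      using that unfolding yon_free_def
    proof (induction rule: pm.span_induct)
      show "pm.subspace {r. ?\<beta> (?\<alpha> r) - r \<in> {0}}"
        unfolding pm.subspace_def by (auto simp: tensor_ext_eq_lin_ext pm.lin_ext_add pm.lin_ext_scale)
    next
      fix r :: "('o \<times> 'e) list \<Rightarrow>\<^sub>0 'k" assume "r \<in> {chain_gen w |w. is_chain C K A w \<and> length w = n}"
      then obtain w where w: "r = chain_gen w" "is_chain C K A w" "length w = n" by blast
      obtain N \<eta> v where v: "w = (N, \<eta>) # v" "\<eta> \<in> Ext C K N"
        using w(2,3) unfolding n by (rule chain_nonempty)
      have "pull C (rep K \<epsilon>) \<eta> = pull C (ide C K) \<eta>"
        by (rule uniq[OF rep(1)[OF in'(3)] ide_in _ v(2)]) (use rep(2)[OF in'(3)] push_ide[OF in'(3)] in simp)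
      then show "?\<beta> (?\<alpha> r) - r \<in> {0}"
        using w(1) v pull_ide[OF v(2)] by (simp add: tensor_ext_eq_lin_ext shift)
    qed
    then show ?thesis by simp
  qed
  have \<alpha>\<beta>: "?\<alpha> (?\<beta> r) - r \<in> yon_rel C (Suc n) X A" if "r \<in> yon_free C (Suc n) X A" for r
    using that unfolding yon_free_def
  proof (induction rule: pm.span_induct)
    show "pm.subspace {r. ?\<alpha> (?\<beta> r) - r \<in> yon_rel C (Suc n) X A}"
      unfolding pm.subspace_def
    proof (safe, goal_cases)
      case 1
      then show ?case
        using pm.subspace_0[OF yon_rel_subspace] by (simp add: tensor_ext_eq_lin_ext del: yon_rel.simps)
    next
      case (2 r s)
      have "?\<alpha> (?\<beta> (r + s)) - (r + s) = (?\<alpha> (?\<beta> r) - r) + (?\<alpha> (?\<beta> s) - s)"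
        by (simp add: tensor_ext_eq_lin_ext pm.lin_ext_add)
      from this[symmetric] show ?case using pm.subspace_add[OF yon_rel_subspace 2] by (simp only:)
    next
      case (3 c r)
      have "?\<alpha> (?\<beta> (pm_scale c r)) - pm_scale c r = pm_scale c (?\<alpha> (?\<beta> r) - r)"
        by (simp only: tensor_ext_eq_lin_ext pm.lin_ext_scale pm.scale_right_diff_distrib)
      from this[symmetric] show ?case using pm.subspace_scale[OF yon_rel_subspace 3, of c] by (simp only:)
    qed
  next
    fix r :: "('o \<times> 'e) list \<Rightarrow>\<^sub>0 'k" assume "r \<in> {chain_gen w |w. is_chain C X A w \<and> length w = Suc n}"
    then obtain w where w: "r = chain_gen w" "is_chain C X A w" "length w = Suc n" by blast
    obtain M \<delta> w' where 1: "w = (M, \<delta>) # w'" "\<delta> \<in> Ext C X M" "is_chain C M A w'" "length w' = Suc m"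
      using w(2,3) unfolding n by (rule chain_nonempty)
    obtain N \<eta> v where 2: "w' = (N, \<eta>) # v" "\<eta> \<in> Ext C M N" "is_chain C N A v" "length v = m"
      using 1(3,4) by (rule chain_nonempty)
    \<comment> \<open>In this order the composite is the identity only modulo the coend relation,
      here used for the lift of \<delta>.\<close>
    have "chain_gen ((M, push C (rep M \<delta>) \<epsilon>) # (N, \<eta>) # v) -
        chain_gen ((K, \<epsilon>) # (N, pull C (rep M \<delta>) \<eta>) # v) \<in> yon_rel C (Suc n) X A"
      by (rule yon_rel_balanced[OF rep(1)[OF 1(2)] in'(3) 2(2,3)]) (use 2(4) n in simp)
    then have "chain_gen w - ?\<alpha> (?\<beta> (chain_gen w)) \<in> yon_rel C (Suc n) X A"
      using 1(1) 2(1) rep(2)[OF 1(2)] by (simp add: tensor_ext_eq_lin_ext shift del: yon_rel.simps)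
    from pm.subspace_neg[OF yon_rel_subspace this] show "?\<alpha> (?\<beta> r) - r \<in> yon_rel C (Suc n) X A"
      unfolding w(1) minus_diff_eq .
  qed
  note sub = pm.subspace_0[OF yon_rel_subspace] pm.subspace_diff[OF yon_rel_subspace]
  show ?thesis
  proof (rule card_quot_space_eqI[where f = ?\<beta> and g = ?\<alpha>])
    fix r s assume "r \<in> yon_free C n K A" "s \<in> yon_free C n K A" "r - s \<in> yon_rel C n K A"
    from yon_rel_tensor[OF in'(3) this(3)] show "?\<alpha> r - ?\<alpha> s \<in> yon_rel C (Suc n) X A"
      by (simp add: tensor_ext_eq_lin_ext pm.lin_ext_diff del: yon_rel.simps)
  next
    fix r s assume "r - s \<in> yon_rel C (Suc n) X A"
    from \<beta>_rel[OF this] show "?\<beta> r - ?\<beta> s \<in> yon_rel C n K A" unfolding pm.lin_ext_diff .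
  next
    fix r assume "r \<in> yon_free C n K A"
    from \<beta>\<alpha>[OF this] show "?\<beta> (?\<alpha> r) - r \<in> yon_rel C n K A" by (simp add: sub(1) del: yon_rel.simps)
  qed (rule \<beta>_free \<alpha>_free \<alpha>\<beta> sub; assumption)+
qed

text \<open>\<open>ext_card\<close> uses \<open>Ext\<close> itself in degree 1 and the presentation
  from degree 2 on; this joins the two descriptions, so that the shift also covers the passage from
  degree 2 to degree 1.\<close>

lemma card_quot_space_yon_1:
  "card (quot_space (yon_free C (Suc 0) X A) (yon_rel C (Suc 0) X A)) = card (Ext C X A)"
proof -
  define \<phi> where "\<phi> w = (case w of [] \<Rightarrow> 0 | (M, \<delta>) # w' \<Rightarrow> \<delta>)" for w :: "('o \<times> 'e) list"
  have \<phi>: "\<phi> ((M, \<delta>) # w) = \<delta>" for M \<delta> w by (simp add: \<phi>_def)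
  let ?f = "lin_ext (escale C) \<phi>" and ?g = "\<lambda>\<delta>. chain_gen [(A, \<delta>)] :: ('o \<times> 'e) list \<Rightarrow>\<^sub>0 'k"
  have f_free: "?f r \<in> Ext C X A" if "r \<in> yon_free C (Suc 0) X A" for r
  proof (rule ext.lin_ext_mem[OF that[unfolded yon_free_def] Ext_subspace], safe)
    fix w assume "is_chain C X A w" "length w = Suc 0"
    then obtain M \<delta> v where "w = (M, \<delta>) # v" "\<delta> \<in> Ext C X M" "is_chain C M A v" "length v = 0"
      by (rule chain_nonempty)
    then show "?f (chain_gen w) \<in> Ext C X A" by (simp add: \<phi>)
  qed
  have f_rel: "?f r \<in> {0}" if "r \<in> yon_rel C (Suc 0) X A" for r
    by (rule yon_rel_Suc_lin_ext[OF ext.vector_space_axioms ext.subspace_single_0 that]) (auto simp: \<phi>)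
  note sub = pm.subspace_0[OF yon_rel_subspace] pm.subspace_diff[OF yon_rel_subspace]
    pm.subspace_add[OF yon_rel_subspace] pm.subspace_scale[OF yon_rel_subspace]
  have g_add: "?g (\<delta> + \<delta>') - ?g \<delta> - ?g \<delta>' \<in> yon_rel C (Suc 0) X A"
    if "\<delta> \<in> Ext C X A" "\<delta>' \<in> Ext C X A" for \<delta> \<delta>'
    by (rule yon_rel_add[OF that]) auto
  have g_scale: "?g (escale C t \<delta>) - pm_scale t (?g \<delta>) \<in> yon_rel C (Suc 0) X A" if "\<delta> \<in> Ext C X A" for t \<delta>
    by (rule yon_rel_scale[OF that]) auto
  \<comment> \<open>Membership in \<open>yon_free\<close> is carried along: the closure steps need
    \<open>?f r\<close> to be an extension before additivity of \<open>?g\<close> modulo relations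
    applies.\<close>
  have gf: "r \<in> yon_free C (Suc 0) X A \<and> ?g (?f r) - r \<in> yon_rel C (Suc 0) X A"
    if "r \<in> yon_free C (Suc 0) X A" for r
    using that[unfolded yon_free_def]
  proof (induction rule: pm.span_induct)
    show "pm.subspace {r. r \<in> yon_free C (Suc 0) X A \<and> ?g (?f r) - r \<in> yon_rel C (Suc 0) X A}"
      unfolding pm.subspace_def
    proof (safe, goal_cases)
      case 1
      show ?case by (rule pm.subspace_0[OF yon_free_subspace])
    next
      case 2
      show ?case using g_scale[OF ext_0, of 0] by (simp del: yon_rel.simps)
    next
      case (3 r s)
      then show ?case by (intro pm.subspace_add[OF yon_free_subspace])
    next
      case (4 r s)
      have "?g (?f (r + s)) - (r + s) =
          (?g (?f r + ?f s) - ?g (?f r) - ?g (?f s)) + ((?g (?f r) - r) + (?g (?f s) - s))"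
        by (simp add: ext.lin_ext_add)
      from this[symmetric] show ?case
        using sub(3)[OF g_add[OF f_free[OF 4(1)] f_free[OF 4(3)]] sub(3)[OF 4(2,4)]] by (simp only:)
    next
      case (5 c r)
      then show ?case by (intro pm.subspace_scale[OF yon_free_subspace])
    next
      case (6 c r)
      have "?g (?f (pm_scale c r)) - pm_scale c r =
          (?g (escale C c (?f r)) - pm_scale c (?g (?f r))) + pm_scale c (?g (?f r) - r)"
        by (simp only: ext.lin_ext_scale pm.scale_right_diff_distrib) simp
      from this[symmetric] show ?case
        using sub(3)[OF g_scale[OF f_free[OF 6(1)], of c] sub(4)[OF 6(2), of c]] by (simp only:)
    qed
  next
    fix r :: "('o \<times> 'e) list \<Rightarrow>\<^sub>0 'k" assume "r \<in> {chain_gen w |w. is_chain C X A w \<and> length w = Suc 0}"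
    then obtain w where w: "r = chain_gen w" "is_chain C X A w" "length w = Suc 0" by blast
    obtain M \<delta> v where v: "w = (M, \<delta>) # v" "is_chain C M A v" "length v = 0"
      using w(2,3) by (rule chain_nonempty)
    then have "v = []" by simp
    then have "w = [(A, \<delta>)]" using v(1,2) by simp
    then show "r \<in> yon_free C (Suc 0) X A \<and> ?g (?f r) - r \<in> yon_rel C (Suc 0) X A"
      using w by (simp add: \<phi> sub(1) chain_gen_in_yon_free del: yon_rel.simps)
  qed
  have "card (quot_space (yon_free C (Suc 0) X A) (yon_rel C (Suc 0) X A)) = card (quot_space (Ext C X A) {0})"
  proof (rule card_quot_space_eqI[where f = ?f and g = ?g])
    fix r s assume "r - s \<in> yon_rel C (Suc 0) X A"
    then show "?f r - ?f s \<in> {0}" using f_rel by (metis ext.lin_ext_diff)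
  next
    fix \<delta> assume "\<delta> \<in> Ext C X A"
    then show "?g \<delta> \<in> yon_free C (Suc 0) X A" by (simp add: chain_gen_in_yon_free)
  next
    fix \<delta> \<delta>' :: 'e assume "\<delta> - \<delta>' \<in> {0}"
    then show "?g \<delta> - ?g \<delta>' \<in> yon_rel C (Suc 0) X A" by (simp add: sub(1) del: yon_rel.simps)
  next
    fix r s assume "r \<in> yon_rel C (Suc 0) X A" "s \<in> yon_rel C (Suc 0) X A"
    then show "r - s \<in> yon_rel C (Suc 0) X A" by (rule sub(2))
  next
    show "0 \<in> yon_rel C (Suc 0) X A" by (rule sub(1))
  qed (use f_free gf in \<open>auto simp: \<phi> simp del: yon_rel.simps\<close>)
  moreover have "quot_space (Ext C X A) {0} = (\<lambda>\<delta>. {\<delta>}) ` Ext C X A"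
    by (auto simp: quot_space_def quotient_def)
  ultimately show ?thesis by (simp add: card_image)
qed

lemma ext_card_shift:
  assumes "triangle C K P X i p \<epsilon>" "projective_obj C P" "n \<ge> 1"
  shows "ext_card C d (int (Suc n)) X Y = ext_card C d (int n) K Y"
proof -
  obtain m where n: "n = Suc m" using assms(3) by (cases n) auto
  show ?thesis
  proof (cases m)
    case 0
    then show ?thesis using card_quot_space_yon_shift[OF assms(1,2) n, of Y] card_quot_space_yon_1[of K Y] n
      by (simp add: ext_card_def nat_add_distrib numeral_2_eq_2 del: yon_rel.simps)
  next
    case (Suc m')
    have "nat (int (Suc n)) = Suc n" "nat (int n) = n" by simp_all
    then show ?thesis using card_quot_space_yon_shift[OF assms(1,2) n, of Y] n Suc
      by (simp add: ext_card_def del: yon_rel.simps nat_int of_nat_Suc)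
  qed
qed

lemma pull_summand_inj:
  assumes "is_biproduct C A P' M a s r t" "projective_obj C P'" "\<eta> \<in> Ext C M Y"
  shows "pull C r (pull C a \<eta>) = \<eta>"
proof -
  have b: "a \<in> Hom C A M" "s \<in> Hom C P' M" "r \<in> Hom C M A" "t \<in> Hom C M P'" "a \<cdot> r + s \<cdot> t = ide C M"
    using assms(1) by (auto simp: is_biproduct_def)
  have "pull C s \<eta> = 0" using assms(2) pull_in[OF b(2) assms(3)] by (simp add: projective_obj_iff)
  then have "pull C (s \<cdot> t) \<eta> = 0" using pull_comp[OF b(2,4) assms(3)] pull_0[OF b(4)] by simp
  then have "pull C (ide C M) \<eta> = pull C (a \<cdot> r) \<eta>"
    using add_pull[OF comp_in[OF b(3,1)] comp_in[OF b(4,2)] assms(3)] b(5) by simp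
  then show ?thesis using pull_ide[OF assms(3)] pull_comp[OF b(1,3) assms(3)] by simp
qed

text \<open>From degree 2 on, both objects share a syzygy. In degree 1, pulling back along the
  inclusion of \<open>A\<close> is bijective, since the projective summand has no
  extensions.\<close>

lemma ext_card_add_projective:
  assumes ep: "enough_projectives C" and P: "projective_obj C P'" and M: "is_biproduct C A P' M a s r t"
    and n: "n \<ge> 1"
  shows "ext_card C d (int n) M Y = ext_card C d (int n) A Y"
proof (cases "n = 1")
  case True
  have b: "a \<in> Hom C A M" "r \<in> Hom C M A" "r \<cdot> a = ide C A" using M by (auto simp: is_biproduct_def)
  have inv: "pull C a (pull C r \<eta>) = \<eta>" if "\<eta> \<in> Ext C A Y" for \<eta>
    using pull_comp[OF b(2,1) that] b(3) pull_ide[OF that] by simp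
  have "bij_betw (pull C a) (Ext C M Y) (Ext C A Y)"
    by (rule bij_betw_byWitness[where f' = "pull C r"])
      (use pull_summand_inj[OF M P] inv pull_in[OF b(1)] pull_in[OF b(2)] in auto)
  then have "card (Ext C M Y) = card (Ext C A Y)" by (rule bij_betw_same_card)
  then show ?thesis using True by (simp add: ext_card_def)
next
  case False
  then obtain m where m: "n = Suc m" "m \<ge> 1" using n by (cases n) auto
  obtain K P i q \<epsilon> where res: "triangle C K P A i q \<epsilon>" "projective_obj C P"
    using ep unfolding enough_projectives_def by blast
  obtain Q i' q' \<epsilon>' jP jP' rP rP' where Q: "triangle C K Q M i' q' \<epsilon>'" "projective_obj C Q"
    using triangle_add_projective[OF res P M] by metis
  show ?thesis unfolding m(1) using ext_card_shift[OF res m(2)] ext_card_shift[OF Q m(2)] by simp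
qed

lemma ext_card_pos:
  assumes finK: "finite (UNIV :: 'k set)" and n: "n \<ge> 1" and fd: "ext_fin_dim C d (int n) X Y"
  shows "ext_card C d (int n) X Y = CARD('k) ^ ext_dim C d (int n) X Y"
proof (cases "n = 1")
  case True
  then have "finite (Ext C X Y)"
    using fd ext.fin_dim_imp_finite[OF finK] by (simp add: ext_fin_dim_def)
  then show ?thesis using True ext.card_finite_subspace[OF finK Ext_subspace] by (simp add: ext_card_def ext_dim_def)
next
  case False
  then show ?thesis
    using n fd pm.card_quot_space[OF finK yon_rel_subspace yon_free_subspace]
    by (simp add: ext_card_def ext_dim_def ext_fin_dim_def)
qed

text \<open>The defect is the kernel of E(D,Y) -> E(B,Y). After rotation it is the kernel of E(B,Y)
  -> E(M,Y); as \<open>M\<close> is \<open>A\<close> plus a projective, this equals the kernel of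
  E(B,Y) -> E(A,Y), hence the image of the previous map. So consecutive defects add up to the
  dimension of E(D,Y).\<close>

lemma alternating_sum_ext:
  assumes finK: "finite (UNIV :: 'k set)" and fd: "\<And>n X. n \<ge> 1 \<Longrightarrow> ext_fin_dim C d (int n) X Y"
    and ep: "enough_projectives C" and tri: "triangle C A B D x y \<delta>"
    and van: "\<And>n. n > N \<Longrightarrow> ext_dim C d (int n) A Y = 0"
      "\<And>n. n > N \<Longrightarrow> ext_dim C d (int n) B Y = 0"
      "\<And>n. n > N \<Longrightarrow> ext_dim C d (int n) D Y = 0"
  shows "alternating_sum N (\<lambda>n. ext_dim C d (int n) B Y) - alternating_sum N (\<lambda>n. ext_dim C d (int n) A Y) -
    alternating_sum N (\<lambda>n. ext_dim C d (int n) D Y) = int (ext.dim {\<epsilon> \<in> Ext C D Y. pull C y \<epsilon> = 0})"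
proof -
  define T where "T A B D k \<longleftrightarrow>
    (\<exists>x y \<delta>. triangle C A B D x y \<delta> \<and> k = ext.dim {\<epsilon> \<in> Ext C D Y. pull C y \<epsilon> = 0})" for A B D k
  let ?e = "\<lambda>X n. ext_dim C d (int n) X Y"
  note q = card_field_gt_1[OF finK]
  have e: "ext_card C d (int n) X Y = CARD('k) ^ ?e X n" if "n \<ge> 1" for n X
    using ext_card_pos[OF finK that fd[OF that]] .
  have eq: "?e X n = ?e X' n'" if "ext_card C d (int n) X Y = ext_card C d (int n') X' Y" "n \<ge> 1" "n' \<ge> 1"
    for n n' X X'
    using that(1) q unfolding e[OF that(2)] e[OF that(3)] by simp
  have finE: "finite (Ext C X Y)" for X
    using fd[of 1] ext.fin_dim_imp_finite[OF finK] by (simp add: ext_fin_dim_def)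
  show ?thesis
  proof (rule alternating_sum_rotation[where T = T])
    fix A B D k assume "T A B D k"
    then obtain x y \<delta> where t: "triangle C A B D x y \<delta>" and k: "k = ext.dim {\<epsilon> \<in> Ext C D Y. pull C y \<epsilon> = 0}"
      unfolding T_def by blast
    obtain K P i p' \<epsilon> where res: "triangle C K P D i p' \<epsilon>" "projective_obj C P"
      using ep unfolding enough_projectives_def by blast
    obtain M k' m a s rA rP where rot: "triangle C K M B k' m (pull C y \<epsilon>)"
      "is_biproduct C A P M a s rA rP" "m \<cdot> a = x"
      using rotate_triangle[OF t res] by metis
    have in': "x \<in> Hom C A B" "y \<in> Hom C B D" "a \<in> Hom C A M" "rA \<in> Hom C M A" "m \<in> Hom C M B"
      using triangle_in[OF t] triangle_in[OF rot(1)] rot(2) by (auto simp: is_biproduct_def)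
    let ?k = "ext.dim {\<epsilon> \<in> Ext C B Y. pull C m \<epsilon> = 0}"
    have c: "card {\<epsilon> \<in> Ext C D Y. pull C y \<epsilon> = 0} = CARD('k) ^ k"
      "card {\<epsilon> \<in> Ext C B Y. pull C m \<epsilon> = 0} = CARD('k) ^ ?k"
      unfolding k using ext.card_finite_subspace[OF finK kernel_pull_subspace] finE in' by auto
    have image: "pull C y ` Ext C D Y = {\<epsilon> \<in> Ext C B Y. pull C m \<epsilon> = 0}"
    proof (intro equalityI subsetI)
      fix \<eta> assume "\<eta> \<in> pull C y ` Ext C D Y"
      then obtain \<zeta> where z: "\<zeta> \<in> Ext C D Y" "\<eta> = pull C y \<zeta>" by blast
      have h: "\<eta> \<in> Ext C B Y" using z pull_in[OF in'(2)] by blast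
      have "pull C x \<eta> = 0"
        using pull_comp[OF in'(2,1) z(1)] z(2) triangle_comp_zero[OF t] pull_zero_map[OF z(1)] by simp
      then have "pull C a (pull C m \<eta>) = 0" using pull_comp[OF in'(5,3) h] rot(3) by simp
      then have "pull C m \<eta> = 0"
        using pull_summand_inj[OF rot(2) res(2) pull_in[OF in'(5) h]] pull_0[OF in'(4)] by simp
      then show "\<eta> \<in> {\<epsilon> \<in> Ext C B Y. pull C m \<epsilon> = 0}" using h by simp
    next
      fix \<eta> assume "\<eta> \<in> {\<epsilon> \<in> Ext C B Y. pull C m \<epsilon> = 0}"
      then have h: "\<eta> \<in> Ext C B Y" "pull C m \<eta> = 0" by auto
      have "pull C x \<eta> = 0" using pull_comp[OF in'(5,3) h(1)] rot(3) h(2) pull_0[OF in'(3)] by simp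
      then show "\<eta> \<in> pull C y ` Ext C D Y" using triangle_ext_middle[OF t h(1)] by blast
    qed
    have "card (Ext C D Y) = card {\<epsilon> \<in> Ext C D Y. pull C y \<epsilon> = 0} * card (pull C y ` Ext C D Y)"
      by (rule card_eq_card_kernel_times_card_image[OF finE ext_0 ext_diff]) (auto simp: pull_diff[OF in'(2)])
    then have "CARD('k) ^ ?e D 1 = CARD('k) ^ (k + ?k)"
      using e[of 1 D] c image by (simp add: power_add ext_card_def)
    then have "k + ?k = ?e D 1" using q by simp
    moreover have "T K M B ?k" unfolding T_def using rot(1) by blast
    moreover have "\<forall>n\<ge>1. ?e K n = ?e D (Suc n)"
    proof (intro allI impI)
      fix n :: nat assume n: "n \<ge> 1"
      show "?e K n = ?e D (Suc n)" by (rule eq[OF ext_card_shift[OF res n, symmetric]]) (use n in auto)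
    qed
    moreover have "\<forall>n\<ge>1. ?e M n = ?e A n"
    proof (intro allI impI)
      fix n :: nat assume n: "n \<ge> 1"
      show "?e M n = ?e A n" by (rule eq[OF ext_card_add_projective[OF ep res(2) rot(2) n]]) (use n in auto)
    qed
    ultimately show "\<exists>A' B' k'. T A' B' B k' \<and> k + k' = ?e D 1 \<and>
        (\<forall>n\<ge>1. ?e A' n = ?e D (Suc n)) \<and> (\<forall>n\<ge>1. ?e B' n = ?e A n)"
      by blast
  next
    show "T A B D (ext.dim {\<epsilon> \<in> Ext C D Y. pull C y \<epsilon> = 0})" unfolding T_def using tri by blast
  qed (use van in auto)
qed

end

section \<open>Additivity of the Euler form\<close>

lemma neg_I_eq_sat:
  "neg_I_map C n = sat_map C (syz C) (syz_ext C) n"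
  "neg_I C n = sat C (syz C) (syz_mid C) (syz_infl C) (syz_ext C) n"
proof -
  show m: "neg_I_map C n = sat_map C (syz C) (syz_ext C) n" for n
    by (induction n) (simp_all add: syz_mor_def res_mor_def)
  show "neg_I C n = sat C (syz C) (syz_mid C) (syz_infl C) (syz_ext C) n"
    by (induction n) (simp_all add: m)
qed

text \<open>The resolved argument of type II is the first one; in the opposite category it takes the
  second place, hence the exchange of \<open>A\<close> and \<open>X\<close>.\<close>

lemma neg_II_eq_sat:
  "neg_II_map C n A A' f = sat_map (op_cat C) (cosyz C) (cosyz_ext C) n A' A f"
  "neg_II C n A X = sat (op_cat C) (cosyz C) (cosyz_mid C) (cosyz_defl C) (cosyz_ext C) n X A"
proof -
  have r: "cosyz_mor C A A' f = res_mor (op_cat C) (cosyz C) (cosyz_ext C) A' A f" for A A' f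
    by (simp add: cosyz_mor_def res_mor_def eq_commute)
  show m: "neg_II_map C n A A' f = sat_map (op_cat C) (cosyz C) (cosyz_ext C) n A' A f" for n A A' f
    by (induction n arbitrary: A A' f) (simp_all add: r fun_eq_iff)
  show "neg_II C n A X = sat (op_cat C) (cosyz C) (cosyz_mid C) (cosyz_defl C) (cosyz_ext C) n X A"
    by (induction n arbitrary: A) (simp_all add: m)
qed

section \<open>Sums and products of finite support\<close>

lemma sum_symmetric_int_interval:
  fixes g :: "int \<Rightarrow> 'a::comm_monoid_add"
  shows "(\<Sum>i = - int N..int N. g i) = g 0 + (\<Sum>n = 1..N. g (int n)) + (\<Sum>n = 1..N. g (- int n))"
proof (induction N)
  case (Suc N)
  have "{- int (Suc N)..int (Suc N)} = insert (- int (Suc N)) (insert (int (Suc N)) {- int N..int N})"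
    by auto
  then have "(\<Sum>i = - int (Suc N)..int (Suc N). g i) =
      g (- int (Suc N)) + (g (int (Suc N)) + (\<Sum>i = - int N..int N. g i))"
    by simp
  then show ?case using Suc by (simp add: ac_simps)
qed simp

lemma prod_power_int:
  fixes q :: "'a::field"
  assumes "q \<noteq> 0"
  shows "(\<Prod>i\<in>I. q powi f i) = q powi (\<Sum>i\<in>I. f i)"
  by (induction I rule: infinite_finite_induct) (auto simp: power_int_add assms)

text \<open>\<open>Prod_any\<close> has the default value 1 on infinite support, so the vanishing
  beyond \<open>N\<close> is what identifies it with a genuine product.\<close>

lemma Prod_any_alternating_powers:
  fixes c e :: "nat \<Rightarrow> nat" and q :: nat
  assumes q: "q > 0" and c: "\<And>n. n \<ge> 1 \<Longrightarrow> c n = q ^ e n" and van: "\<And>n. n > N \<Longrightarrow> e n = 0"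
  shows "Prod_any (\<lambda>i. if i > 0 then (of_nat (c i) :: rat) powi ((-1) ^ i) else 1) =
    of_nat q powi alternating_sum N e"
proof -
  have p: "(of_nat (c n) :: rat) powi ((-1) ^ n) = of_nat q powi ((-1) ^ n * int (e n))" if "n \<ge> 1" for n
  proof -
    have "(of_nat (c n) :: rat) = of_nat q powi int (e n)" by (simp add: c[OF that])
    then show ?thesis by (simp only: power_int_mult[symmetric] mult.commute[of "int (e n)"])
  qed
  have "Prod_any (\<lambda>i. if i > 0 then (of_nat (c i) :: rat) powi ((-1) ^ i) else 1) =
      (\<Prod>i = 1..N. if i > 0 then (of_nat (c i) :: rat) powi ((-1) ^ i) else 1)"
  proof (rule Prod_any.expand_superset)
    show "{i. (if i > 0 then (of_nat (c i) :: rat) powi ((-1) ^ i) else 1) \<noteq> 1} \<subseteq> {1..N}"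
    proof
      fix i assume "i \<in> {i. (if i > 0 then (of_nat (c i) :: rat) powi ((-1) ^ i) else 1) \<noteq> 1}"
      then have i: "i \<ge> 1" "(of_nat (c i) :: rat) powi ((-1) ^ i) \<noteq> 1" by (auto split: if_splits)
      have "\<not> i > N"
      proof
        assume "i > N"
        then have "c i = 1" using van c[OF i(1)] by simp
        then show False using i(2) by simp
      qed
      then show "i \<in> {1..N}" using i(1) by simp
    qed
  qed simp
  also have "\<dots> = (\<Prod>i = 1..N. of_nat q powi ((-1) ^ i * int (e i)))"
    by (rule prod.cong) (auto simp: p)
  also have "\<dots> = of_nat q powi alternating_sum N e"
    unfolding alternating_sum_def by (rule prod_power_int) (use q in simp)
  finally show ?thesis .
qed

text \<open>Nonzero terms are at least 1, so a finite set with more of them than the total sum would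
  be a contradiction.\<close>

lemma finite_support_of_summable_nat:
  fixes f :: "'a \<Rightarrow> nat"
  assumes "(\<lambda>i. real (f i)) summable_on UNIV"
  shows "finite {i. f i \<noteq> 0}"
proof (rule ccontr)
  assume "infinite {i. f i \<noteq> 0}"
  define n where "n = nat \<lceil>infsum (\<lambda>i. real (f i)) UNIV\<rceil> + 1"
  obtain F where F: "finite F" "card F = n" "F \<subseteq> {i. f i \<noteq> 0}"
    using infinite_arbitrarily_large[OF \<open>infinite {i. f i \<noteq> 0}\<close>] by blast
  have "real n = (\<Sum>i\<in>F. 1)" using F by simp
  also have "\<dots> \<le> (\<Sum>i\<in>F. real (f i))" by (rule sum_mono) (use F in auto)
  also have "\<dots> \<le> infsum (\<lambda>i. real (f i)) UNIV"
    by (rule finite_sum_le_infsum[OF assms F(1)]) auto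
  finally show False unfolding n_def by linarith
qed

section \<open>The Euler form under the finiteness assumptions\<close>

locale euler_finite_category = extriangulated_category C
  for C :: "('k::{field,finite}, 'o, 'm::ab_group_add, 'e::ab_group_add) extri_cat" (structure) +
  assumes ep: "enough_projectives C" and ei: "enough_injectives C"
    and fd: "ext_fin_dim C d i X Y"
    and summable: "(\<lambda>i::int. real (ext_dim C d i X Y)) summable_on UNIV"
    and deflation_mono:
      "projective_obj C P \<Longrightarrow> deflation C B D y \<Longrightarrow> inj_on (\<lambda>f. f \<cdot> y) (Hom C D P)"
begin

lemma finK: "finite (UNIV :: 'k set)"
  by simp

lemma satellites_I:
  "satellites C (syz C) (syz_mid C) (syz_infl C) (\<lambda>D. case proj_res C D of (K, G, i, g, \<delta>) \<Rightarrow> g) (syz_ext C)"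
proof unfold_locales
  fix D
  obtain K P i g \<delta> where "triangle C K P D i g \<delta>" "projective_obj C P"
    using ep unfolding enough_projectives_def by blast
  then have "case (K, P, i, g, \<delta>) of (K, G, i, g, \<delta>) \<Rightarrow> triangle C K G D i g \<delta> \<and> projective_mor C G D g"
    using projective_mor_from_projective triangle_in(2) by simp
  from someI[of "\<lambda>(K, G, i, g, \<delta>). triangle C K G D i g \<delta> \<and> projective_mor C G D g", OF this]
  have "case proj_res C D of (K, G, i, g, \<delta>) \<Rightarrow> triangle C K G D i g \<delta> \<and> projective_mor C G D g"
    unfolding proj_res_def .
  then show "triangle C (syz C D) (syz_mid C D) D (syz_infl C D) (case proj_res C D of (K, G, i, g, \<delta>) \<Rightarrow> g) (syz_ext C D)"
    "projective_mor C (syz_mid C D) D (case proj_res C D of (K, G, i, g, \<delta>) \<Rightarrow> g)"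
    by (auto simp: syz_def syz_mid_def syz_infl_def syz_ext_def split: prod.splits)
qed

lemma satellites_II:
  "satellites (op_cat C) (cosyz C) (cosyz_mid C) (cosyz_defl C)
     (\<lambda>A. case inj_res C A of (J, S, j, s, \<delta>) \<Rightarrow> j) (cosyz_ext C)"
proof -
  interpret op: extriangulated_category "op_cat C" by (rule extriangulated_category_op_cat)
  show ?thesis
  proof unfold_locales
    fix A
    obtain J S j s \<delta> where "triangle C A J S j s \<delta>" "injective_obj C J"
      using ei unfolding enough_injectives_def by blast
    then have "case (J, S, j, s, \<delta>) of (J, S, j, s, \<delta>) \<Rightarrow> triangle C A J S j s \<delta> \<and> injective_mor C A J j"
      using op.projective_mor_from_projective[of J j A] triangle_in(1) by simp
    from someI[of "\<lambda>(J, S, j, s, \<delta>). triangle C A J S j s \<delta> \<and> injective_mor C A J j", OF this]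
    have "case inj_res C A of (J, S, j, s, \<delta>) \<Rightarrow> triangle C A J S j s \<delta> \<and> injective_mor C A J j"
      unfolding inj_res_def .
    then show "triangle (op_cat C) (cosyz C A) (cosyz_mid C A) A (cosyz_defl C A)
        (case inj_res C A of (J, S, j, s, \<delta>) \<Rightarrow> j) (cosyz_ext C A)"
      "projective_mor (op_cat C) (cosyz_mid C A) A (case inj_res C A of (J, S, j, s, \<delta>) \<Rightarrow> j)"
      by (auto simp: cosyz_def cosyz_mid_def cosyz_defl_def cosyz_ext_def split: prod.splits)
  qed
qed

lemma ext_dim_neg: "ext_dim C d (- int n) X Y = hom.dim (neg_ext C d n X Y)"
  by (simp add: ext_dim_def)

lemma finite_neg_ext: "finite (neg_ext C d n X Y)"
  using fd[of d "- int n" X Y] hom.fin_dim_imp_finite[OF finK] by (simp add: ext_fin_dim_def)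

lemma neg_ext_subspace: "hom.subspace (neg_ext C d n X Y)"
proof (cases d)
  case TypeI
  interpret sat: satellites C "syz C" "syz_mid C" "syz_infl C" "\<lambda>D. case proj_res C D of (K, G, i, g, \<delta>) \<Rightarrow> g" "syz_ext C"
    by (rule satellites_I)
  show ?thesis using TypeI sat.sat_subspace by (simp add: neg_ext_def neg_I_eq_sat)
next
  case TypeII
  interpret sat: satellites "op_cat C" "cosyz C" "cosyz_mid C" "cosyz_defl C"
    "\<lambda>A. case inj_res C A of (J, S, j, s, \<delta>) \<Rightarrow> j" "cosyz_ext C"
    by (rule satellites_II)
  show ?thesis using TypeII sat.sat_subspace by (simp add: neg_ext_def neg_II_eq_sat)
qed

lemma ext_card_neg: "ext_card C d (- int n) X Y = CARD('k) ^ ext_dim C d (- int n) X Y"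
  using hom.card_finite_subspace[OF finK neg_ext_subspace finite_neg_ext]
  by (simp add: ext_card_def ext_dim_neg)

lemma neg_ext_0: "neg_ext C d 0 X Y = Hom C X Y"
  by (cases d) (auto simp: neg_ext_def)

lemma finite_Hom: "finite (Hom C X Y)"
  using finite_neg_ext[of TypeI 0 X Y] by (simp add: neg_ext_0)

lemma card_Hom: "card (Hom C X Y) = CARD('k) ^ ext_dim C d 0 X Y"
  using ext_card_neg[of d 0 X Y] by (simp add: ext_card_def neg_ext_0)

lemma ext_vanish_bound: "\<exists>N. \<forall>i. \<bar>i\<bar> > int N \<longrightarrow> ext_dim C d i X Y = 0"
proof -
  have "finite ((\<lambda>i. nat \<bar>i\<bar>) ` {i. ext_dim C d i X Y \<noteq> 0})" (is "finite ?S")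
    by (rule finite_imageI[OF finite_support_of_summable_nat[OF summable]])
  then obtain N where N: "\<forall>n\<in>?S. n \<le> N"
    unfolding finite_nat_set_iff_bounded_le by blast
  have "ext_dim C d i X Y = 0" if i: "\<bar>i\<bar> > int N" for i
  proof (rule ccontr)
    assume "ext_dim C d i X Y \<noteq> 0"
    then have "nat \<bar>i\<bar> \<in> ?S" by simp
    then have "nat \<bar>i\<bar> \<le> N" by (rule bspec[OF N])
    then show False using i by linarith
  qed
  then show ?thesis by blast
qed

lemma euler_form_eq:
  assumes "\<forall>i. \<bar>i\<bar> > int N \<longrightarrow> ext_dim C d i X Y = 0"
  shows "euler_form C d X Y = int (ext_dim C d 0 X Y) + alternating_sum N (\<lambda>n. ext_dim C d (int n) X Y) +
    alternating_sum N (\<lambda>n. ext_dim C d (- int n) X Y)"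
proof -
  let ?g = "\<lambda>i::int. (if even i then 1 else -1) * int (ext_dim C d i X Y)"
  have "euler_form C d X Y = (\<Sum>i = - int N..int N. ?g i)"
    unfolding euler_form_def
  proof (rule Sum_any.expand_superset)
    show "{i. ?g i \<noteq> 0} \<subseteq> {- int N..int N}"
    proof
      fix i assume "i \<in> {i. ?g i \<noteq> 0}"
      then have "\<not> \<bar>i\<bar> > int N" using assms by auto
      then show "i \<in> {- int N..int N}" by auto
    qed
  qed simp
  then show ?thesis
    unfolding sum_symmetric_int_interval alternating_sum_def by (simp add: minus_one_power_iff)
qed

lemma neg_euler_eq:
  assumes "\<forall>i. \<bar>i\<bar> > int N \<longrightarrow> ext_dim C d i X Y = 0"
  shows "neg_euler C d X Y = of_nat CARD('k) powi alternating_sum N (\<lambda>n. ext_dim C d (- int n) X Y)"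
  unfolding neg_euler_def
  by (rule Prod_any_alternating_powers) (use assms in \<open>auto simp: ext_card_neg\<close>)

lemma pos_euler_eq:
  assumes "\<forall>i. \<bar>i\<bar> > int N \<longrightarrow> ext_dim C d i X Y = 0"
  shows "pos_euler C X Y = of_nat CARD('k) powi alternating_sum N (\<lambda>n. ext_dim C d (int n) X Y)"
  unfolding pos_euler_def
proof (rule Prod_any_alternating_powers)
  fix n :: nat assume n: "n \<ge> 1"
  have "ext_card C TypeI (int n) X Y = ext_card C d (int n) X Y" using n by (simp add: ext_card_def)
  then show "ext_card C TypeI (int n) X Y = CARD('k) ^ ext_dim C d (int n) X Y"
    using ext_card_pos[OF finK n fd] by simp
qed (use assms in auto)

text \<open>The bridge between the two Hall products: positive degrees and degree 0 together
  contribute the Euler form minus its negative part, and the negative part is the exponent of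
  \<open>neg_euler\<close>.\<close>

lemma hom_euler_eq:
  "hom_euler C X Y = of_nat CARD('k) powi (- euler_form C d X Y) * neg_euler C d X Y"
proof -
  obtain N where N: "\<forall>i. \<bar>i\<bar> > int N \<longrightarrow> ext_dim C d i X Y = 0"
    using ext_vanish_bound[of d X Y] by blast
  define q where "q = (of_nat CARD('k) :: rat)"
  have q: "q \<noteq> 0" by (simp add: q_def)
  have h: "of_nat (card (Hom C X Y)) = q powi int (ext_dim C d 0 X Y)"
    by (simp add: card_Hom[of X Y d] q_def)
  show ?thesis
    unfolding hom_euler_def h pos_euler_eq[OF N] neg_euler_eq[OF N] euler_form_eq[OF N] q_def[symmetric]
      power_int_add[OF disjI1[OF q], symmetric]
    by (simp add: power_int_minus[symmetric] inverse_eq_divide[symmetric] add.commute)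
qed

text \<open>For type I the first argument is the parameter of the satellites and the counted
  relation is needed. For type II the reversed triangle varies the resolved argument, so rotation
  suffices; its defect, read backwards, is again the kernel of precomposition with
  \<open>y\<close>.\<close>

lemma alternating_sum_neg_ext:
  assumes tri: "triangle C A B D x y \<delta>"
    and van: "\<And>n. n > N \<Longrightarrow> ext_dim C d (- int n) A Y = 0"
      "\<And>n. n > N \<Longrightarrow> ext_dim C d (- int n) B Y = 0"
      "\<And>n. n > N \<Longrightarrow> ext_dim C d (- int n) D Y = 0"
  shows "alternating_sum N (\<lambda>n. ext_dim C d (- int n) B Y) -
    alternating_sum N (\<lambda>n. ext_dim C d (- int n) A Y) -
    alternating_sum N (\<lambda>n. ext_dim C d (- int n) D Y) = int (hom.dim {u \<in> Hom C D Y. u \<cdot> y = 0})"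
proof (cases d)
  case TypeI
  interpret sat: satellites C "syz C" "syz_mid C" "syz_infl C" "\<lambda>D. case proj_res C D of (K, G, i, g, \<delta>) \<Rightarrow> g" "syz_ext C"
    by (rule satellites_I)
  have "deflation C B D y" using tri by (auto simp: deflation_def)
  note mono = deflation_mono[OF _ this]
  have e: "neg_ext C d n X Y = sat C (syz C) (syz_mid C) (syz_infl C) (syz_ext C) n X Y" for n X Y
    using TypeI by (simp add: neg_ext_def neg_I_eq_sat)
  show ?thesis
    unfolding ext_dim_neg e
  proof (rule sat.alternating_sum_sat_first[OF finK _ ep tri])
    show "finite (sat C (syz C) (syz_mid C) (syz_infl C) (syz_ext C) n X D)" for n X D
      using finite_neg_ext[of d n X D] unfolding e .
    show "inj_on (\<lambda>f. f \<cdot> y) (Hom C D P)" if "projective_obj C P" for P using mono[OF that] .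
  qed (fact van[unfolded ext_dim_neg e])+
next
  case TypeII
  interpret sat: satellites "op_cat C" "cosyz C" "cosyz_mid C" "cosyz_defl C"
    "\<lambda>A. case inj_res C A of (J, S, j, s, \<delta>) \<Rightarrow> j" "cosyz_ext C"
    by (rule satellites_II)
  have t: "triangle (op_cat C) D B A y x \<delta>" using tri by simp
  have ep': "enough_projectives (op_cat C)" using ei by simp
  have e: "neg_ext C d n X Y = sat (op_cat C) (cosyz C) (cosyz_mid C) (cosyz_defl C) (cosyz_ext C) n Y X" for n X Y
    using TypeII by (simp add: neg_ext_def neg_II_eq_sat)
  have "alternating_sum N (\<lambda>n. ext_dim C d (- int n) B Y) -
    alternating_sum N (\<lambda>n. ext_dim C d (- int n) D Y) -
    alternating_sum N (\<lambda>n. ext_dim C d (- int n) A Y) = int (hom.dim {u \<in> Hom C D Y. u \<cdot> y = 0})"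
    unfolding ext_dim_neg e
  proof (rule sat.alternating_sum_sat_second[OF finK _ ep' t, of Y N, unfolded op_cat_simps])
    show "finite (sat (op_cat C) (cosyz C) (cosyz_mid C) (cosyz_defl C) (cosyz_ext C) n Y D)" for n D
      using finite_neg_ext[of d n D Y] unfolding e .
  qed (fact van[unfolded ext_dim_neg e])+
  then show ?thesis by linarith
qed

text \<open>The count for the exact sequence Hom(D,Y) -> Hom(B,Y) -> Hom(A,Y) -> E(D,Y) -> E(B,Y),
  cut off by the kernels of its first and last maps.\<close>

lemma dim_Hom_triangle:
  assumes tri: "triangle C A B D x y \<delta>"
  shows "ext_dim C d 0 A Y + ext_dim C d 0 D Y = ext_dim C d 0 B Y +
    hom.dim {u \<in> Hom C D Y. u \<cdot> y = 0} + ext.dim {\<epsilon> \<in> Ext C D Y. pull C y \<epsilon> = 0}"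
proof -
  have in': "x \<in> Hom C A B" "y \<in> Hom C B D" "\<delta> \<in> Ext C D A" using triangle_in[OF tri] by auto
  have finE: "finite (Ext C D Y)"
    using fd[of d 1 D Y] ext.fin_dim_imp_finite[OF finK] by (simp add: ext_fin_dim_def)
  let ?D = "(\<lambda>u. u \<cdot> y) ` Hom C D Y" and ?B = "(\<lambda>u. u \<cdot> x) ` Hom C B Y"
  let ?m = "hom.dim {u \<in> Hom C D Y. u \<cdot> y = 0}" and ?k = "ext.dim {\<epsilon> \<in> Ext C D Y. pull C y \<epsilon> = 0}"
  have m: "card {u \<in> Hom C D Y. u \<cdot> y = 0} = CARD('k) ^ ?m"
    using hom.card_finite_subspace[OF finK kernel_pre_subspace[OF in'(2)]] finite_Hom by simp
  have k: "card {\<epsilon> \<in> Ext C D Y. pull C y \<epsilon> = 0} = CARD('k) ^ ?k"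
    using ext.card_finite_subspace[OF finK kernel_pull_subspace[OF in'(2)]] finE by simp
  have 1: "card (Hom C D Y) = card {u \<in> Hom C D Y. u \<cdot> y = 0} * card ?D"
    by (rule card_eq_card_kernel_times_card_image[OF finite_Hom hom_0 hom_diff])
      (auto simp: comp_diff_left[OF in'(2)])
  have kerB: "{u \<in> Hom C B Y. u \<cdot> x = 0} = ?D"
  proof (intro equalityI subsetI)
    fix f assume "f \<in> {u \<in> Hom C B Y. u \<cdot> x = 0}"
    then show "f \<in> ?D" using triangle_extend[OF tri, of f Y] by blast
  next
    fix f assume "f \<in> ?D"
    then obtain g where g: "g \<in> Hom C D Y" "f = g \<cdot> y" by blast
    then show "f \<in> {u \<in> Hom C B Y. u \<cdot> x = 0}"
      using comp_in[OF in'(2) g(1)] comp_assoc[OF in'(1,2) g(1)] triangle_comp_zero[OF tri] comp_0_right[OF g(1)]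
      by simp
  qed
  have 2: "card (Hom C B Y) = card ?D * card ?B"
    unfolding kerB[symmetric]
    by (rule card_eq_card_kernel_times_card_image[OF finite_Hom hom_0 hom_diff])
      (auto simp: comp_diff_left[OF in'(1)])
  have kerA: "{a \<in> Hom C A Y. push C a \<delta> = 0} = ?B"
  proof (intro equalityI subsetI)
    fix a assume "a \<in> {a \<in> Hom C A Y. push C a \<delta> = 0}"
    then show "a \<in> ?B" using push_eq_zero_extend[OF tri, of a Y] by blast
  next
    fix a assume "a \<in> ?B"
    then show "a \<in> {a \<in> Hom C A Y. push C a \<delta> = 0}"
      using comp_in[OF in'(1)] push_comp_inflation[OF tri] by blast
  qed
  have image: "(\<lambda>a. push C a \<delta>) ` Hom C A Y = {\<epsilon> \<in> Ext C D Y. pull C y \<epsilon> = 0}"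
  proof (intro equalityI subsetI)
    fix \<epsilon> assume "\<epsilon> \<in> (\<lambda>a. push C a \<delta>) ` Hom C A Y"
    then obtain a where a: "a \<in> Hom C A Y" "\<epsilon> = push C a \<delta>" by blast
    then show "\<epsilon> \<in> {\<epsilon> \<in> Ext C D Y. pull C y \<epsilon> = 0}"
      using push_in[OF a(1) in'(3)] push_pull[OF a(1) in'(2,3), symmetric] triangle_pull_zero[OF tri] push_0[OF a(1)]
      by simp
  next
    fix \<epsilon> assume "\<epsilon> \<in> {\<epsilon> \<in> Ext C D Y. pull C y \<epsilon> = 0}"
    then show "\<epsilon> \<in> (\<lambda>a. push C a \<delta>) ` Hom C A Y" using triangle_ext_extend[OF tri, of \<epsilon> Y] by blast
  qed
  have 3: "card (Hom C A Y) = card ?B * card {\<epsilon> \<in> Ext C D Y. pull C y \<epsilon> = 0}"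
    unfolding kerA[symmetric] image[symmetric]
    by (rule card_eq_card_kernel_times_card_image[OF finite_Hom hom_0 hom_diff])
      (auto simp: diff_push[OF _ _ in'(3)])
  have "CARD('k) ^ (ext_dim C d 0 A Y + ext_dim C d 0 D Y) = CARD('k) ^ (ext_dim C d 0 B Y + ?m + ?k)"
    unfolding power_add card_Hom[symmetric] m[symmetric] k[symmetric] using 1 2 3 by (simp add: ac_simps)
  then show ?thesis using card_field_gt_1[OF finK] by simp
qed

lemma euler_form_triangle:
  assumes tri: "triangle C A B D x y \<delta>"
  shows "euler_form C d B Y = euler_form C d A Y + euler_form C d D Y"
proof -
  obtain NA where NA: "\<forall>i. \<bar>i\<bar> > int NA \<longrightarrow> ext_dim C d i A Y = 0"
    using ext_vanish_bound[of d A Y] by blast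
  obtain NB where NB: "\<forall>i. \<bar>i\<bar> > int NB \<longrightarrow> ext_dim C d i B Y = 0"
    using ext_vanish_bound[of d B Y] by blast
  obtain ND where ND: "\<forall>i. \<bar>i\<bar> > int ND \<longrightarrow> ext_dim C d i D Y = 0"
    using ext_vanish_bound[of d D Y] by blast
  define N where "N = max NA (max NB ND)"
  have N: "\<forall>i. \<bar>i\<bar> > int N \<longrightarrow> ext_dim C d i A Y = 0" "\<forall>i. \<bar>i\<bar> > int N \<longrightarrow> ext_dim C d i B Y = 0"
    "\<forall>i. \<bar>i\<bar> > int N \<longrightarrow> ext_dim C d i D Y = 0"
    using NA NB ND by (auto simp: N_def)
  have "alternating_sum N (\<lambda>n. ext_dim C d (int n) B Y) - alternating_sum N (\<lambda>n. ext_dim C d (int n) A Y) -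
    alternating_sum N (\<lambda>n. ext_dim C d (int n) D Y) = int (ext.dim {\<epsilon> \<in> Ext C D Y. pull C y \<epsilon> = 0})"
    by (rule alternating_sum_ext[OF finK fd ep tri]) (use N in auto)
  moreover have "alternating_sum N (\<lambda>n. ext_dim C d (- int n) B Y) -
    alternating_sum N (\<lambda>n. ext_dim C d (- int n) A Y) -
    alternating_sum N (\<lambda>n. ext_dim C d (- int n) D Y) = int (hom.dim {u \<in> Hom C D Y. u \<cdot> y = 0})"
    by (rule alternating_sum_neg_ext[OF tri]) (use N in auto)
  \<comment> \<open>The defects of the positive and the negative half are exactly the two correction
    terms of the Hom dimensions, so everything cancels.\<close>
  ultimately show ?thesis
    using dim_Hom_triangle[OF tri, of d Y]
    unfolding euler_form_eq[OF N(1)] euler_form_eq[OF N(2)] euler_form_eq[OF N(3)]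
    by linarith
qed

text \<open>An isomorphism X -> X' exhibits \<open>X'\<close> as biproduct of \<open>X\<close> and a
  zero object. Additivity then gives invariance without comparing the extension groups degree by
  degree.\<close>

lemma euler_form_isomorphic:
  assumes "isomorphic C X X'"
  shows "euler_form C d X Y = euler_form C d X' Y"
proof -
  obtain Z where Z: "ide C Z = 0" by (rule zero_objectE)
  obtain f g where f: "f \<in> Hom C X X'" "g \<in> Hom C X' X" "g \<cdot> f = ide C X" "f \<cdot> g = ide C X'"
    using assms unfolding isomorphic_def is_iso_def by blast
  have "is_biproduct C X Z X' f 0 g 0"
    using f Z hom_0 comp_0_right[OF f(2)] comp_0_left[OF f(1)] comp_0_left[OF hom_0]
    by (simp add: is_biproduct_def)
  from euler_form_triangle[OF biproduct_triangle[OF this]]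
  have "euler_form C d X' Y = euler_form C d X Y + euler_form C d Z Y" .
  moreover have "euler_form C d Z Y = 0"
    using euler_form_triangle[OF triangle_ide_left[OF Z], of d Z Y] by simp
  ultimately show ?thesis by simp
qed

text \<open>Without a deflation from \<open>L\<close> to \<open>Y\<close> with cocone
  \<open>X\<close> both sides are zero. Otherwise such a deflation supplies the triangle from which
  <L,Y> = <X,Y> + <Y,Y> follows.\<close>

lemma hall_F_eq: "hall_F C X Y L = of_nat CARD('k) powi (- euler_form C d X Y) * hall_G C d X Y L"
proof (cases "card (deflations_cocone C X L Y) = 0")
  case True
  then show ?thesis by (simp add: hall_F_def hall_G_def)
next
  case False
  then obtain A x g \<delta> where A: "triangle C A L Y x g \<delta>" "isomorphic C A X"
    by (auto simp: deflations_cocone_def card_eq_0_iff)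
  have e: "euler_form C d L Y = euler_form C d X Y + euler_form C d Y Y"
    using euler_form_triangle[OF A(1)] euler_form_isomorphic[OF A(2)] by simp
  have q: "(of_nat CARD('k) :: rat) \<noteq> 0" by simp
  then have "(of_nat CARD('k) :: rat) powi (- euler_form C d L Y) / of_nat CARD('k) powi (- euler_form C d Y Y) =
      of_nat CARD('k) powi (- euler_form C d X Y)"
    unfolding power_int_diff[OF disjI1[OF q], symmetric] e by simp
  then show ?thesis
    unfolding hall_F_def hall_G_def hom_euler_eq[of _ _ d] by (simp add: field_simps)
qed

lemma class_sum_hall_F:
  "class_sum C (\<lambda>L. pm_scale (hall_F C X Y L) (hall_basis C L)) =
     pm_scale (of_nat CARD('k) powi (- euler_form C d X Y))
       (class_sum C (\<lambda>L. pm_scale (hall_G C d X Y L) (hall_basis C L)))"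
proof -
  let ?q = "(of_nat CARD('k) :: rat) powi (- euler_form C d X Y)"
  let ?g = "\<lambda>c. if c \<in> range (iso_class C)
    then pm_scale (hall_G C d X Y (class_rep c)) (hall_basis C (class_rep c)) else 0"
  have q: "?q \<noteq> 0" by simp
  have "class_sum C (\<lambda>L. pm_scale (hall_F C X Y L) (hall_basis C L)) = Sum_any (\<lambda>c. pm_scale ?q (?g c))"
    unfolding class_sum_def by (rule arg_cong[where f = Sum_any]) (auto simp: hall_F_eq[of X Y _ d])
  also have "\<dots> = pm_scale ?q (Sum_any ?g)"
  proof -
    \<comment> \<open>\<open>Sum_any\<close> sums over the support. A nonzero scalar preserves the
      support, so it can be pulled out without knowing that the support is finite.\<close>
    have "{c. pm_scale ?q (?g c) \<noteq> 0} = {c. ?g c \<noteq> 0}" using q by (simp only: pm.scale_eq_0_iff) simp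
    then show ?thesis unfolding Sum_any.expand_set by (simp only: pm.scale_sum_right)
  qed
  finally show ?thesis by (simp add: class_sum_def)
qed

end

theorem proposition7p1:
  fixes C :: "('k::{field,finite}, 'o, 'm::ab_group_add, 'e::ab_group_add) extri_cat"
    and d :: neg_type
  assumes "krull_schmidt_category C"
    and "extriangulated_category C"
    and "enough_projectives C" and "enough_injectives C"
    and "\<And>X Y d i. ext_fin_dim C d i X Y"
    and "\<And>X Y d. (\<lambda>i::int. real (ext_dim C d i X Y)) summable_on UNIV"
    and "\<And>I A B x. injective_obj C I \<Longrightarrow> inflation C A B x
           \<Longrightarrow> inj_on (\<lambda>f. x \<cdot>\<^bsub>C\<^esub> f) (Hom C I A)"
    and "\<And>P B D y. projective_obj C P \<Longrightarrow> deflation C B D y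
           \<Longrightarrow> inj_on (\<lambda>f. f \<cdot>\<^bsub>C\<^esub> y) (Hom C D P)"
  shows "(\<forall>v\<in>hall_space C. \<forall>w\<in>hall_space C. hall_mult C v w = tw_hall_mult C d v w) \<and>
    (\<forall>X Y. class_sum C (\<lambda>L. pm_scale (hall_F C X Y L) (hall_basis C L)) =
       pm_scale (of_nat CARD('k) powi (- euler_form C d X Y))
         (class_sum C (\<lambda>L. pm_scale (hall_G C d X Y L) (hall_basis C L))))"
proof -
  interpret extriangulated_category C by fact
  interpret euler_finite_category C
    using assms(3-6,8) by unfold_locales
  \<comment> \<open>Both products are bilinear extensions of their values on pairs of objects, so
    the identity of these values gives equality on the whole ambient space.\<close>
  have "hall_mult C = tw_hall_mult C d"
    unfolding hall_mult_def tw_hall_mult_def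
    by (rule arg_cong[where f = bilinear_ext]) (intro ext class_sum_hall_F)
  then show ?thesis using class_sum_hall_F by simp
qed

end
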